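(* Let $G$ be a locally compact abelian group, let $\mu,\nu$ be two bounded regular real Borel measures on $G$, and let $C\in\mathbb{R}$. Then the inequality $$\int_G f\,d\nu \le C\int_G f\,d\mu$$ holds for all doubly positive continuous functions $f$ on $G$ if and only if the measure $C\mu-\nu$ can be decomposed as $$C\mu-\nu=\sigma+\tau+o,$$ where $\sigma$ is a nonnegative real measure, $\tau$ is a real measure of positive type, and $o$ is an odd measure (all of them being real regular Borel measures of finite total variation on $G$).
   Context: $G$ is a locally compact abelian (Hausdorff) group, written additively, with Haar measure $\lambda$. "Bounded" measure means of finite total variation. A function $f:G\to\mathbb{C}$ is positive definite if $\sum_{j,k=1}^n c_j\overline{c_k}f(x_j-x_k)\ge 0$ for all $n\in\mathbb{N}$, $c_j\in\mathbb{C}$, $x_j\in G$. A function is doubly positive if it is both positive definite and nonnegative. For $u\in\mathcal{C}_c(G,\mathbb{C})$ (continuous with compact support) put $\widetilde{u}(x)=\overline{u(-x)}$ and $(u\star\widetilde{u})(x)=\int_G u(x-y)\widetilde{u}(y)\,d\lambda(y)$. A measure $\tau$ is of positive type if $\int_G (u\star\widetilde{u})\,d\tau\ge 0$ for all $u\in\mathcal{C}_c(G,\mathbb{C})$. A measure $o$ is odd if $o(-E)=-o(E)$ for all Borel sets $E$. *)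

theory Defs
  imports "HOL-Analysis.Analysis"
begin

text \<open>
  A real (signed) Borel measure is a set function \<open>m :: 'a set \<Rightarrow> real\<close>; only its values on
  \<^term>\<open>sets borel\<close> matter. Countable additivity forces \<open>m {} = 0\<close>, as the constant sequence
  \<open>m {}\<close> has to be summable.
\<close>

definition real_borel_measure :: "('a::topological_space set \<Rightarrow> real) \<Rightarrow> bool" where
  "real_borel_measure m \<longleftrightarrow>
     (\<forall>A :: nat \<Rightarrow> 'a set. range A \<subseteq> sets borel \<longrightarrow> disjoint_family A \<longrightarrow>
        (\<lambda>n. m (A n)) sums m (\<Union>n. A n))"

definition total_variation :: "('a::topological_space set \<Rightarrow> real) \<Rightarrow> 'a set \<Rightarrow> ennreal" where
  "total_variation m E =
     (SUP P \<in> {P. finite P \<and> P \<subseteq> sets borel \<and> partition_on E P}. \<Sum>A\<in>P. ennreal \<bar>m A\<bar>)"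

definition regular_real_borel_measure :: "('a::topological_space set \<Rightarrow> real) \<Rightarrow> bool" where
  "regular_real_borel_measure m \<longleftrightarrow> real_borel_measure m \<and>
     (\<forall>E \<in> sets borel.
        total_variation m E = (INF U \<in> {U. open U \<and> E \<subseteq> U}. total_variation m U) \<and>
        total_variation m E = (SUP K \<in> {K. compact K \<and> K \<subseteq> E}. total_variation m K))"

definition bounded_regular_measure :: "('a::topological_space set \<Rightarrow> real) \<Rightarrow> bool" where
  "bounded_regular_measure m \<longleftrightarrow>
     regular_real_borel_measure m \<and> total_variation m UNIV < \<infinity>"

text \<open>
  The Jordan decomposition \<open>m = m\<^sup>+ - m\<^sup>-\<close> with \<open>m\<^sup>+ = (\<bar>m\<bar> + m) / 2\<close> and \<open>m\<^sup>- = (\<bar>m\<bar> - m) / 2\<close>,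
  where \<open>\<bar>m\<bar>\<close> is the total variation; meant for \<open>m\<close> of finite total variation. The integral
  against \<open>m\<close> is the difference of the Lebesgue integrals against the two parts.
\<close>

definition positive_part :: "('a::topological_space set \<Rightarrow> real) \<Rightarrow> 'a measure" where
  "positive_part m = measure_of UNIV (sets borel)
     (\<lambda>E. ennreal ((enn2real (total_variation m E) + m E) / 2))"

definition negative_part :: "('a::topological_space set \<Rightarrow> real) \<Rightarrow> 'a measure" where
  "negative_part m = measure_of UNIV (sets borel)
     (\<lambda>E. ennreal ((enn2real (total_variation m E) - m E) / 2))"

definition signed_integral :: "('a::topological_space set \<Rightarrow> real) \<Rightarrow> ('a \<Rightarrow> complex) \<Rightarrow> complex" where
  "signed_integral m f = integral\<^sup>L (positive_part m) f - integral\<^sup>L (negative_part m) f"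

definition haar_measure :: "'a::{topological_ab_group_add, t2_space} measure \<Rightarrow> bool" where
  "haar_measure H \<longleftrightarrow> sets H = sets borel \<and>
     emeasure H UNIV \<noteq> 0 \<and>
     (\<forall>x. \<forall>E \<in> sets borel. emeasure H ((\<lambda>y. x + y) ` E) = emeasure H E) \<and>
     (\<forall>K. compact K \<longrightarrow> emeasure H K < \<infinity>) \<and>
     (\<forall>E \<in> sets borel. emeasure H E = (INF U \<in> {U. open U \<and> E \<subseteq> U}. emeasure H U)) \<and>
     (\<forall>U. open U \<longrightarrow> emeasure H U = (SUP K \<in> {K. compact K \<and> K \<subseteq> U}. emeasure H K))"

text \<open>
  Below, \<open>\<le>\<close> on \<^typ>\<open>complex\<close> is the order of \<^theory>\<open>HOL-Library.Complex_Order\<close>; thus \<open>0 \<le> z\<close> says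
  that \<open>z\<close> is real and nonnegative.
\<close>

definition positive_definite :: "('a::ab_group_add \<Rightarrow> complex) \<Rightarrow> bool" where
  "positive_definite f \<longleftrightarrow>
     (\<forall>(n::nat) (c :: nat \<Rightarrow> complex) (x :: nat \<Rightarrow> 'a).
        0 \<le> (\<Sum>j<n. \<Sum>k<n. c j * cnj (c k) * f (x j - x k)))"

definition doubly_positive :: "('a::ab_group_add \<Rightarrow> complex) \<Rightarrow> bool" where
  "doubly_positive f \<longleftrightarrow> positive_definite f \<and> (\<forall>x. 0 \<le> f x)"

definition Cc :: "('a::topological_space \<Rightarrow> complex) set" where
  "Cc = {u. continuous_on UNIV u \<and> compact (closure {x. u x \<noteq> 0})}"

definition involution :: "('a::ab_group_add \<Rightarrow> complex) \<Rightarrow> 'a \<Rightarrow> complex" where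
  "involution u x = cnj (u (- x))"

definition convolution ::
    "'a::ab_group_add measure \<Rightarrow> ('a \<Rightarrow> complex) \<Rightarrow> ('a \<Rightarrow> complex) \<Rightarrow> 'a \<Rightarrow> complex" where
  "convolution H u v x = (LINT y|H. u (x - y) * v y)"

definition positive_type ::
    "'a::{topological_ab_group_add, t2_space} measure \<Rightarrow> ('a set \<Rightarrow> real) \<Rightarrow> bool" where
  "positive_type H m \<longleftrightarrow>
     (\<forall>u \<in> Cc. 0 \<le> signed_integral m (convolution H u (involution u)))"

definition nonnegative_measure :: "('a::topological_space set \<Rightarrow> real) \<Rightarrow> bool" where
  "nonnegative_measure m \<longleftrightarrow> (\<forall>E \<in> sets borel. 0 \<le> m E)"

definition odd_measure :: "('a::{topological_ab_group_add, t2_space} set \<Rightarrow> real) \<Rightarrow> bool" where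
  "odd_measure m \<longleftrightarrow> (\<forall>E \<in> sets borel. m (uminus ` E) = - m E)"

end

theory Submission
  imports Defs
begin

text \<open>
  Write \<open>\<rho> = C\<mu> - \<nu>\<close>. If \<open>\<rho>\<close> is nonnegative on doubly positive functions, then
  \<open>q h = inf {\<integral>f d\<rho> | f positive definite, f \<ge> h}\<close> is a finite sublinear functional on the bounded
  continuous functions: the constant \<open>1\<close> is positive definite and lies in the interior of the cone
  of nonnegative functions. A linear functional below \<open>q\<close> is nonnegative on nonnegative functions
  and at most \<open>\<rho>\<close> on positive definite ones, so the Riesz theorem turns it into a measure \<open>\<sigma> \<ge> 0\<close>; the
  even part of \<open>\<rho> - \<sigma>\<close> is of positive type and its odd part is \<open>\<omega>\<close>. Mass that the functional loses at
  infinity does no harm, as positive type is tested on compactly supported functions only.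

  Conversely, a measure \<open>\<tau>\<close> of positive type has nonnegative integral against every continuous positive
  definite \<open>f\<close>. For \<open>f\<close> multiplied by a correlation \<open>p x = \<integral>v (y - x) v y dy\<close> this is the positivity
  of the trace of a product of two positive semidefinite matrices, and by amenability \<open>p\<close> can be
  taken close to \<open>1\<close> on compact sets. No Fourier transform and no Fubini theorem are needed, which is
  convenient as \<open>G\<close> need not be \<open>\<sigma>\<close>-compact or second countable.
\<close>

text \<open>Positive definite and nonnegative functions form two cones, and the theorem says that
  the dual cone of their intersection is the sum of the two dual cones, up to odd measures, which
  annihilate every real positive definite function because such a function is even. For general
  cones the sum is only dense in that dual; the order unit \<open>1\<close> makes it exact, since
  Hahn-Banach then produces the summand itself and not a limit. A second obstacle lies in the
  definitions. The integral against a signed measure goes through its Jordan decomposition, which is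
  not additive, so that even linearity in the measure has to be proved; this is done by comparing
  bounded functionals on indicators. Likewise regularity is stated for the total variation, and is
  traded for a bound of \<open>\<bar>m B\<bar>\<close> on all Borel subsets \<open>B\<close> of a
  difference \<open>U - K\<close>, a form that survives linear combinations and reflection.\<close>

lemma ennreal_SUP_approx:
  fixes f :: "'i \<Rightarrow> ennreal"
  assumes "A \<noteq> {}" "(SUP a\<in>A. f a) < top" "0 < e"
  shows "\<exists>a\<in>A. (SUP a\<in>A. f a) \<le> f a + ennreal e"
proof (rule ccontr)
  assume "\<not> ?thesis"
  then have "(SUP a\<in>A. f a + ennreal e) \<le> (SUP a\<in>A. f a)" by (intro SUP_least) (auto simp: not_le)
  then have "(SUP a\<in>A. f a) + ennreal e \<le> (SUP a\<in>A. f a)"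
    by (simp add: ennreal_SUP_add_left[OF assms(1)])
  then show False using assms(2,3)
    by (cases "SUP a\<in>A. f a") (auto simp: ennreal_plus[symmetric] ennreal_le_iff simp del: ennreal_plus)
qed

lemma nonneg_if_approx:
  fixes x c :: real
  assumes c: "0 \<le> c" and approx: "\<And>e. 0 < e \<Longrightarrow> - (c * e) \<le> x"
  shows "0 \<le> x"
proof (rule field_le_epsilon)
  fix e :: real assume e: "0 < e"
  \<comment> \<open>Dividing by \<open>c + 1\<close> and not by \<open>c\<close> covers
    \<open>c = 0\<close>.\<close>
  have "- (c * (e / (c + 1))) \<le> x" using c e by (intro approx divide_pos_pos) auto
  moreover have "c * (e / (c + 1)) \<le> (c + 1) * (e / (c + 1))"
    using c e by (intro mult_right_mono) simp_all
  moreover have "(c + 1) * (e / (c + 1)) = e" using c by simp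
  ultimately show "0 \<le> x + e" by linarith
qed

lemma zero_if_abs_le_inverse:
  fixes x c :: real
  assumes "\<And>n. \<bar>x\<bar> \<le> c * (1 / real (Suc n))"
  shows "x = 0"
proof -
  have "(\<lambda>n. c * (1 / real (Suc n))) \<longlonglongrightarrow> c * 0"
    by (intro tendsto_mult tendsto_const LIMSEQ_Suc[OF lim_1_over_n])
  then have "\<bar>x\<bar> \<le> c * 0" using assms by (intro LIMSEQ_le_const) auto
  then show ?thesis by simp
qed

section \<open>Finite additivity of signed Borel measures\<close>

lemma real_borel_measure_empty:
  assumes "real_borel_measure m" shows "m {} = 0"
proof -
  have "(\<lambda>n::nat. m {}) sums m (\<Union>n::nat. {})"
    using assms[unfolded real_borel_measure_def, rule_format, of "\<lambda>_. {}"]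
    by (simp add: disjoint_family_on_def)
  then have "(\<lambda>n::nat. m {}) \<longlonglongrightarrow> 0" using sums_summable summable_LIMSEQ_zero by blast
  then show ?thesis by (simp add: LIMSEQ_const_iff)
qed

lemma real_borel_measure_sums:
  assumes "real_borel_measure m" "range A \<subseteq> sets borel" "disjoint_family A"
  shows "(\<lambda>n::nat. m (A n)) sums m (\<Union>n. A n)"
  using assms unfolding real_borel_measure_def by blast

lemma real_borel_measure_Un:
  assumes m: "real_borel_measure m" and A: "A \<in> sets borel" "B \<in> sets borel" "A \<inter> B = {}"
  shows "m (A \<union> B) = m A + m B"
proof -
  have "(\<lambda>n. m (binaryset A B n)) sums m (\<Union>n. binaryset A B n)"
    using A by (intro real_borel_measure_sums[OF m])
      (auto simp: range_binaryset_eq disjoint_family_on_def binaryset_def)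
  moreover have "(\<lambda>n. m (binaryset A B n)) sums (m A + m B)"
    using binaryset_sums[of m A B] real_borel_measure_empty[OF m] by simp
  ultimately show ?thesis using sums_unique2 by (simp add: UN_binaryset_eq)
qed

lemma real_borel_measure_UN:
  assumes m: "real_borel_measure m" and "finite I" "\<And>i. i \<in> I \<Longrightarrow> A i \<in> sets borel"
    "disjoint_family_on A I"
  shows "m (\<Union>i\<in>I. A i) = (\<Sum>i\<in>I. m (A i))"
  using assms(2-4)
proof (induction I)
  case empty
  then show ?case using real_borel_measure_empty[OF m] by simp
next
  case (insert x F)
  have "A x \<inter> (\<Union>i\<in>F. A i) = {}" using insert by (auto simp: disjoint_family_on_def)
  then have "m (A x \<union> (\<Union>i\<in>F. A i)) = m (A x) + m (\<Union>i\<in>F. A i)"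
    using insert by (intro real_borel_measure_Un[OF m]) auto
  then show ?case using insert by (simp add: disjoint_family_on_def)
qed

lemma real_borel_measure_Diff:
  assumes m: "real_borel_measure m" and A: "A \<in> sets borel" "B \<in> sets borel" "A \<subseteq> B"
  shows "m (B - A) = m B - m A"
  using real_borel_measure_Un[OF m, of A "B - A"] A by (simp add: Un_absorb1)

lemma real_borel_measure_lincomb:
  assumes "real_borel_measure m" "real_borel_measure n"
  shows "real_borel_measure (\<lambda>E. a * m E + b * n E)"
  using assms unfolding real_borel_measure_def by (auto intro!: sums_add sums_mult)

lemma real_borel_measure_Union:
  assumes m: "real_borel_measure m" and "finite P" "P \<subseteq> sets borel" "disjoint P"
  shows "m (\<Union>P) = (\<Sum>A\<in>P. m A)"
  using real_borel_measure_UN[OF m assms(2), of "\<lambda>x. x"] assms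
  by (auto simp: disjoint_family_on_disjoint_image pairwise_def disjnt_def disjoint_family_on_def)

subsection \<open>Total variation\<close>

abbreviation variation :: "('a::topological_space set \<Rightarrow> real) \<Rightarrow> 'a set \<Rightarrow> real" where
  "variation m E \<equiv> enn2real (total_variation m E)"

lemma total_variation_upper:
  assumes "finite P" "P \<subseteq> sets borel" "partition_on E P"
  shows "(\<Sum>A\<in>P. ennreal \<bar>m A\<bar>) \<le> total_variation m E"
  unfolding total_variation_def using assms by (intro SUP_upper) auto

text \<open>Blocks of a partition are nonempty and distinct, while an indexed family may list the
  empty set several times. Such indices are dropped, which costs nothing as
  \<open>m {} = 0\<close>.\<close>

lemma total_variation_upper_family:
  assumes "finite I" "\<And>i. i \<in> I \<Longrightarrow> A i \<in> sets borel" "disjoint_family_on A I"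
    "(\<Union>i\<in>I. A i) = E" "m {} = 0"
  shows "(\<Sum>i\<in>I. ennreal \<bar>m (A i)\<bar>) \<le> total_variation m E"
proof -
  let ?J = "{i\<in>I. A i \<noteq> {}}"
  have inj: "inj_on A ?J"
    using assms(3) by (fastforce simp: inj_on_def disjoint_family_on_def)
  have "(\<Sum>i\<in>I. ennreal \<bar>m (A i)\<bar>) = (\<Sum>i\<in>?J. ennreal \<bar>m (A i)\<bar>)"
    using assms by (intro sum.mono_neutral_right) auto
  also have "\<dots> = (\<Sum>B\<in>A ` ?J. ennreal \<bar>m B\<bar>)"
    using inj by (simp add: sum.reindex)
  also have "\<dots> \<le> total_variation m E"
  proof (rule total_variation_upper)
    show "partition_on E (A ` ?J)"
      using assms(3,4) by (fastforce simp: partition_on_def disjoint_def disjoint_family_on_def)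
  qed (use assms in auto)
  finally show ?thesis .
qed

lemma total_variation_ge:
  assumes "m {} = 0" "E \<in> sets borel"
  shows "ennreal \<bar>m E\<bar> \<le> total_variation m E"
  using total_variation_upper_family[of "{0::nat}" "\<lambda>_. E" E m] assms
  by (simp add: disjoint_family_on_def)

lemma total_variation_empty:
  fixes m :: "'a::topological_space set \<Rightarrow> real"
  shows "m {} = 0 \<Longrightarrow> total_variation m {} = 0"
proof -
  have "{P. finite P \<and> P \<subseteq> sets (borel::'a measure) \<and> partition_on {} P} = {{}}"
    by (auto simp: partition_on_empty)
  then show ?thesis by (simp add: total_variation_def)
qed

lemma total_variation_superadd:
  assumes m: "m {} = 0" and AB: "A \<in> sets borel" "B \<in> sets borel" "A \<inter> B = {}"
  shows "total_variation m A + total_variation m B \<le> total_variation m (A \<union> B)"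
proof -
  let ?S = "\<lambda>E. {P. finite P \<and> P \<subseteq> sets borel \<and> partition_on E P}"
  \<comment> \<open>Moving a summand into a supremum requires a nonempty index set; for
    \<open>E = {}\<close> the only partition is the empty one.\<close>
  have ne: "?S E \<noteq> {}" if "E \<in> sets borel" for E :: "'a set"
  proof (cases "E = {}")
    case True
    then have "{} \<in> ?S E" by (simp add: partition_on_empty)
    then show ?thesis by blast
  next
    case False
    then have "{E} \<in> ?S E" using that by (simp add: partition_on_space)
    then show ?thesis by blast
  qed
  have "total_variation m A + total_variation m B =
     (SUP P\<in>?S A. SUP Q\<in>?S B. (\<Sum>A\<in>P. ennreal \<bar>m A\<bar>) + (\<Sum>A\<in>Q. ennreal \<bar>m A\<bar>))"
    unfolding total_variation_def ennreal_SUP_add_left[OF ne[OF AB(1)], symmetric]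
      ennreal_SUP_add_right[OF ne[OF AB(2)], symmetric] ..
  also have "\<dots> \<le> total_variation m (A \<union> B)"
  proof (intro SUP_least)
    fix P Q assume P: "P \<in> ?S A" and Q: "Q \<in> ?S B"
    have dis: "P \<inter> Q = {}"
    proof (rule ccontr)
      assume "P \<inter> Q \<noteq> {}"
      then obtain X where X: "X \<in> P" "X \<in> Q" by blast
      then have "X \<subseteq> A" "X \<subseteq> B" "X \<noteq> {}" using P Q unfolding partition_on_def by auto
      then show False using AB(3) by blast
    qed
    have "(\<Sum>A\<in>P. ennreal \<bar>m A\<bar>) + (\<Sum>A\<in>Q. ennreal \<bar>m A\<bar>) = (\<Sum>A\<in>P \<union> Q. ennreal \<bar>m A\<bar>)"
      using P Q dis by (intro sum.union_disjoint[symmetric]) auto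
    also have "\<dots> \<le> total_variation m (A \<union> B)"
    proof (rule total_variation_upper)
      show "partition_on (A \<union> B) (P \<union> Q)"
        using P Q AB(3) unfolding partition_on_def by (auto intro!: disjoint_union)
    qed (use P Q in auto)
    finally show "(\<Sum>A\<in>P. ennreal \<bar>m A\<bar>) + (\<Sum>A\<in>Q. ennreal \<bar>m A\<bar>) \<le> total_variation m (A \<union> B)" .
  qed
  finally show ?thesis .
qed

lemma total_variation_mono:
  assumes "m {} = 0" "A \<in> sets borel" "B \<in> sets borel" "A \<subseteq> B"
  shows "total_variation m A \<le> total_variation m B"
proof -
  have "total_variation m A + total_variation m (B - A) \<le> total_variation m B"
    using total_variation_superadd[of m A "B - A"] assms by (simp add: Un_absorb1)
  then show ?thesis by (rule order_trans[OF add_increasing2[OF zero_le order_refl]])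
qed

text \<open>Every block \<open>B\<close> of a partition of the union is cut along the sets
  \<open>A n\<close>. The pieces inside a fixed \<open>A n\<close>, empty ones aside, partition it,
  so exchanging the two sums gives the bound.\<close>

lemma total_variation_subadd:
  fixes A :: "nat \<Rightarrow> 'a::topological_space set"
  assumes m: "real_borel_measure m" and A: "range A \<subseteq> sets borel" "disjoint_family A"
  shows "total_variation m (\<Union>n. A n) \<le> (\<Sum>n. total_variation m (A n))"
  unfolding total_variation_def[of m "\<Union>n. A n"]
proof (intro SUP_least, clarify)
  fix P assume P: "finite P" "P \<subseteq> sets borel" "partition_on (\<Union>n. A n) P"
  have 1: "ennreal \<bar>m B\<bar> \<le> (\<Sum>n. ennreal \<bar>m (B \<inter> A n)\<bar>)" if "B \<in> P" for B
  proof (cases "summable (\<lambda>n. \<bar>m (B \<inter> A n)\<bar>)")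
    case True
    have "(\<lambda>n. m (B \<inter> A n)) sums m (\<Union>n. B \<inter> A n)"
      using A P(2) that by (intro real_borel_measure_sums[OF m]) (auto simp: disjoint_family_on_def)
    moreover have "(\<Union>n. B \<inter> A n) = B" using P(3) that unfolding partition_on_def by blast
    ultimately have "\<bar>m B\<bar> \<le> (\<Sum>n. \<bar>m (B \<inter> A n)\<bar>)"
      using summable_rabs[OF True] by (metis sums_unique)
    then have "ennreal \<bar>m B\<bar> \<le> ennreal (\<Sum>n. \<bar>m (B \<inter> A n)\<bar>)" by (rule ennreal_leI)
    also have "\<dots> = (\<Sum>n. ennreal \<bar>m (B \<inter> A n)\<bar>)" by (rule suminf_ennreal2[OF abs_ge_zero True, symmetric])
    finally show ?thesis .
  next
    \<comment> \<open>Without absolute summability the right-hand side is infinite and there is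
      nothing to show.\<close>
    case False
    then have "(\<Sum>n. ennreal \<bar>m (B \<inter> A n)\<bar>) = \<infinity>"
      using summable_suminf_not_top[of "\<lambda>n. \<bar>m (B \<inter> A n)\<bar>", OF abs_ge_zero]
      unfolding infinity_ennreal_def by blast
    show ?thesis unfolding \<open>_ = \<infinity>\<close> by simp
  qed
  have "(\<Sum>B\<in>P. ennreal \<bar>m B\<bar>) \<le> (\<Sum>B\<in>P. \<Sum>n. ennreal \<bar>m (B \<inter> A n)\<bar>)"
    by (intro sum_mono 1)
  also have "\<dots> = (\<Sum>n. \<Sum>B\<in>P. ennreal \<bar>m (B \<inter> A n)\<bar>)"
    by (subst suminf_sum) auto
  also have "\<dots> \<le> (\<Sum>n. total_variation m (A n))"
  proof (intro suminf_le)
    fix n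
    show "(\<Sum>B\<in>P. ennreal \<bar>m (B \<inter> A n)\<bar>) \<le> total_variation m (A n)"
    proof (rule total_variation_upper_family)
      show "disjoint_family_on (\<lambda>B. B \<inter> A n) P"
        unfolding disjoint_family_on_def
        using disjointD[OF partition_onD2[OF P(3)]] by blast
      show "(\<Union>B\<in>P. B \<inter> A n) = A n"
        using partition_onD1[OF P(3)] by blast
    qed (use P A real_borel_measure_empty[OF m] in auto)
  qed auto
  finally show "(\<Sum>B\<in>P. ennreal \<bar>m B\<bar>) \<le> (\<Sum>n. total_variation m (A n))" .
qed

lemma total_variation_countably_additive:
  fixes A :: "nat \<Rightarrow> 'a::topological_space set"
  assumes m: "real_borel_measure m" and A: "range A \<subseteq> sets borel" "disjoint_family A"
  shows "(\<Sum>n. total_variation m (A n)) = total_variation m (\<Union>n. A n)"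
proof (rule antisym[OF _ total_variation_subadd[OF assms]])
  note m0 = real_borel_measure_empty[OF m]
  have "(\<Sum>i<n. total_variation m (A i)) \<le> total_variation m (\<Union>i<n. A i)" for n
  proof (induction n)
    case 0 then show ?case by simp
  next
    case (Suc n)
    have "(\<Sum>i<Suc n. total_variation m (A i)) \<le> total_variation m (\<Union>i<n. A i) + total_variation m (A n)"
      using Suc by (simp add: add_right_mono)
    also have "\<dots> \<le> total_variation m ((\<Union>i<n. A i) \<union> A n)"
    proof (rule total_variation_superadd, rule m0)
      show "(\<Union>i<n. A i) \<inter> A n = {}"
      proof -
        have "A i \<inter> A n = {}" if "i < n" for i
          using A(2) that unfolding disjoint_family_on_def by simp
        then show ?thesis by blast
      qed
    qed (use A in auto)
    also have "(\<Union>i<n. A i) \<union> A n = (\<Union>i<Suc n. A i)" by (auto simp: less_Suc_eq)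
    finally show ?case .
  qed
  moreover have "total_variation m (\<Union>i<n. A i) \<le> total_variation m (\<Union>n. A n)" for n
    using A m0 by (intro total_variation_mono) auto
  ultimately have "(\<Sum>i<n. total_variation m (A i)) \<le> total_variation m (\<Union>n. A n)" for n
    using order_trans by blast
  then show "(\<Sum>n. total_variation m (A n)) \<le> total_variation m (\<Union>n. A n)"
    by (intro suminf_le_const) auto
qed

text \<open>Grouping the blocks of a partition by the sign of \<open>m\<close> leaves two sets of
  absolute measure at most \<open>c\<close>, whence the factor 2. This replaces the Hahn
  decomposition: bounds for \<open>m\<close> on subsets control its total variation.\<close>

lemma total_variation_le:
  assumes m: "real_borel_measure m" and D: "D \<in> sets borel"
    and c: "\<And>B. B \<in> sets borel \<Longrightarrow> B \<subseteq> D \<Longrightarrow> \<bar>m B\<bar> \<le> c"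
  shows "total_variation m D \<le> ennreal (2 * c)"
  unfolding total_variation_def
proof (intro SUP_least, clarify)
  fix P assume P: "finite P" "P \<subseteq> sets borel" "partition_on D P"
  let ?P = "{A\<in>P. 0 \<le> m A}" let ?N = "{A\<in>P. \<not> 0 \<le> m A}"
  have s: "sum m Q = m (\<Union>Q)" "\<Union>Q \<in> sets borel" "\<Union>Q \<subseteq> D" if Q: "Q \<subseteq> P" for Q
  proof -
    have "finite Q" "Q \<subseteq> sets borel" using Q P finite_subset by auto
    moreover have "disjoint Q" using Q P(3) unfolding partition_on_def by (meson pairwise_subset)
    ultimately show "sum m Q = m (\<Union>Q)" "\<Union>Q \<in> sets borel"
      using real_borel_measure_Union[OF m] by auto
    show "\<Union>Q \<subseteq> D" using Q P(3) unfolding partition_on_def by auto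
  qed
  have "(\<Sum>A\<in>P. \<bar>m A\<bar>) = (\<Sum>A\<in>?P. \<bar>m A\<bar>) + (\<Sum>A\<in>?N. \<bar>m A\<bar>)"
    using P(1) by (subst sum.union_disjoint[symmetric]) (auto intro!: sum.cong)
  also have "\<dots> = sum m ?P - sum m ?N"
    by (simp add: sum_negf[symmetric])
  also have "\<dots> = m (\<Union>?P) - m (\<Union>?N)" using s by auto
  also have "\<dots> \<le> 2 * c" using c[OF s(2,3), of ?P] c[OF s(2,3), of ?N] by auto
  finally have "(\<Sum>A\<in>P. \<bar>m A\<bar>) \<le> 2 * c" .
  then show "(\<Sum>A\<in>P. ennreal \<bar>m A\<bar>) \<le> ennreal (2 * c)"
    by (simp add: ennreal_leI)
qed

text \<open>\<open>measure_of\<close> yields the null measure unless its argument is positive and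
  countably additive, so nothing is known about \<open>positive_part\<close> and
  \<open>negative_part\<close> before this check.\<close>

lemma real_borel_measure_emeasure:
  fixes p :: "'a::topological_space set \<Rightarrow> real"
  assumes p: "real_borel_measure p" and nn: "\<And>E. E \<in> sets borel \<Longrightarrow> 0 \<le> p E"
    and E: "E \<in> sets borel"
  shows "emeasure (measure_of UNIV (sets borel) (\<lambda>E. ennreal (p E))) E = ennreal (p E)"
proof (rule emeasure_measure_of_sigma)
  show "sigma_algebra UNIV (sets (borel::'a measure))"
    using sets.sigma_algebra_axioms[of "borel::'a measure"] by simp
  show "positive (sets borel) (\<lambda>E. ennreal (p E))"
    using real_borel_measure_empty[OF p] by (simp add: positive_def)
  show "countably_additive (sets borel) (\<lambda>E. ennreal (p E))"
  proof (rule countably_additiveI)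
    fix A :: "nat \<Rightarrow> 'a set" assume A: "range A \<subseteq> sets borel" "disjoint_family A"
    have s: "(\<lambda>n. p (A n)) sums p (\<Union>n. A n)" by (rule real_borel_measure_sums[OF p A])
    have "0 \<le> p (A n)" for n using nn A by auto
    then show "(\<Sum>n. ennreal (p (A n))) = ennreal (p (\<Union>n. A n))"
      unfolding sums_unique[OF s] by (rule suminf_ennreal2[OF _ sums_summable[OF s]])
  qed
qed (rule E)

subsection \<open>Jordan decomposition and integration\<close>

text \<open>Integration rests on countable additivity and finite variation alone; regularity enters
  later, through approximation by compact sets.\<close>

definition finite_variation :: "('a::topological_space set \<Rightarrow> real) \<Rightarrow> bool" where
  "finite_variation m \<longleftrightarrow> real_borel_measure m \<and> total_variation m UNIV < \<infinity>"

lemma total_variation_finite: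
  assumes "finite_variation m" "E \<in> sets borel"
  shows "total_variation m E < \<infinity>" "total_variation m E = ennreal (variation m E)"
proof -
  show "total_variation m E < \<infinity>"
    using order_le_less_trans[OF total_variation_mono[of m E UNIV]] assms real_borel_measure_empty[of m]
    unfolding finite_variation_def by simp
  then show "total_variation m E = ennreal (variation m E)"
    by (simp add: less_top)
qed

lemma real_borel_measure_total_variation:
  assumes m: "finite_variation m"
  shows "real_borel_measure (\<lambda>E. variation m E)"
  unfolding real_borel_measure_def
proof (intro allI impI)
  fix A :: "nat \<Rightarrow> 'a set" assume A: "range A \<subseteq> sets borel" "disjoint_family A"
  let ?t = "\<lambda>E. variation m E"
  have U: "(\<Union>n. A n) \<in> sets borel" using A by auto
  have eq: "total_variation m (A n) = ennreal (?t (A n))" for n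
    using total_variation_finite(2)[OF m] A by auto
  have s: "(\<Sum>n. ennreal (?t (A n))) = total_variation m (\<Union>n. A n)"
    using total_variation_countably_additive[OF _ A, of m] m eq unfolding finite_variation_def by simp
  then have sm: "summable (\<lambda>n. ?t (A n))"
    using total_variation_finite(1)[OF m U]
    by (intro summable_suminf_not_top) (auto simp: less_top)
  have "ennreal (\<Sum>n. ?t (A n)) = (\<Sum>n. ennreal (?t (A n)))"
    by (rule suminf_ennreal2[OF enn2real_nonneg sm, symmetric])
  also note s
  also note total_variation_finite(2)[OF m U]
  finally have "(\<Sum>n. ?t (A n)) = ?t (\<Union>n. A n)"
    by (subst (asm) ennreal_inj) (auto intro!: suminf_nonneg sm)
  then show "(\<lambda>n. ?t (A n)) sums ?t (\<Union>n. A n)" using summable_sums[OF sm] by simp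
qed

lemma abs_le_total_variation:
  assumes "finite_variation m" "E \<in> sets borel"
  shows "\<bar>m E\<bar> \<le> variation m E"
  using total_variation_ge[of m E] real_borel_measure_empty[of m] assms total_variation_finite[OF assms]
  unfolding finite_variation_def by (metis enn2real_nonneg ennreal_le_iff)

lemma total_variation_real_le:
  assumes m: "finite_variation m" and D: "D \<in> sets borel"
    and c: "\<And>B. B \<in> sets borel \<Longrightarrow> B \<subseteq> D \<Longrightarrow> \<bar>m B\<bar> \<le> c"
  shows "variation m D \<le> 2 * c"
proof -
  have "0 \<le> c" using c[of "{}"] by auto
  then show ?thesis using total_variation_le[of m D c] assms unfolding finite_variation_def
    by (simp add: enn2real_leI)
qed

lemma sets_positive_part [simp, measurable_cong]: "sets (positive_part m) = sets borel"
  and space_positive_part [simp]: "space (positive_part m) = UNIV"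
  and sets_negative_part [simp, measurable_cong]: "sets (negative_part m) = sets borel"
  and space_negative_part [simp]: "space (negative_part m) = UNIV"
  using sets.sigma_sets_eq[of "borel::'a measure"]
  unfolding positive_part_def negative_part_def by auto

lemma emeasure_positive_part:
  assumes m: "finite_variation m" and E: "E \<in> sets borel"
  shows "emeasure (positive_part m) E = ennreal ((variation m E + m E) / 2)"
  unfolding positive_part_def
proof (rule real_borel_measure_emeasure[OF _ _ E])
  show "real_borel_measure (\<lambda>E. (variation m E + m E) / 2)"
    using real_borel_measure_lincomb[OF real_borel_measure_total_variation[OF m], of m "1/2" "1/2"] m
    unfolding finite_variation_def by (simp add: add_divide_distrib)
qed (use abs_le_total_variation[OF m] in fastforce)

lemma emeasure_negative_part:
  assumes m: "finite_variation m" and E: "E \<in> sets borel"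
  shows "emeasure (negative_part m) E = ennreal ((variation m E - m E) / 2)"
  unfolding negative_part_def
proof (rule real_borel_measure_emeasure[OF _ _ E])
  show "real_borel_measure (\<lambda>E. (variation m E - m E) / 2)"
    using real_borel_measure_lincomb[OF real_borel_measure_total_variation[OF m], of m "1/2" "-1/2"] m
    unfolding finite_variation_def by (simp add: diff_divide_distrib)
qed (use abs_le_total_variation[OF m] in fastforce)

lemma measure_parts:
  assumes m: "finite_variation m" and E: "E \<in> sets borel"
  shows "measure (positive_part m) E = (variation m E + m E) / 2"
    "measure (negative_part m) E = (variation m E - m E) / 2"
  using abs_le_total_variation[OF m E] emeasure_positive_part[OF m E] emeasure_negative_part[OF m E]
  unfolding measure_def by auto

lemma finite_measure_parts:
  assumes m: "finite_variation m"
  shows "finite_measure (positive_part m)" "finite_measure (negative_part m)"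
  using emeasure_positive_part[OF m, of UNIV] emeasure_negative_part[OF m, of UNIV]
  by (auto intro!: finite_measureI)

section \<open>Bounded Borel functions and linearity of the signed integral\<close>

definition bdd_borel :: "('a::topological_space \<Rightarrow> real) set" where
  "bdd_borel = {f. f \<in> borel_measurable borel \<and> (\<exists>B. \<forall>x. \<bar>f x\<bar> \<le> B)}"

lemma bdd_borelI: "f \<in> borel_measurable borel \<Longrightarrow> (\<And>x. \<bar>f x\<bar> \<le> B) \<Longrightarrow> f \<in> bdd_borel"
  unfolding bdd_borel_def by blast

lemma bdd_borel_measurable: "f \<in> bdd_borel \<Longrightarrow> f \<in> borel_measurable borel"
  unfolding bdd_borel_def by blast

lemma bdd_borel_add:
  assumes "f \<in> bdd_borel" "g \<in> bdd_borel" shows "(\<lambda>x. f x + g x) \<in> bdd_borel"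
proof -
  obtain B C where "\<forall>x. \<bar>f x\<bar> \<le> B" "\<forall>x. \<bar>g x\<bar> \<le> C" using assms unfolding bdd_borel_def by blast
  then have "\<bar>f x + g x\<bar> \<le> B + C" for x by (meson abs_triangle_ineq add_mono order_trans)
  then show ?thesis
    by (rule bdd_borelI[OF borel_measurable_add[OF assms[THEN bdd_borel_measurable]]])
qed

lemma bdd_borel_mult:
  assumes "f \<in> bdd_borel" "g \<in> bdd_borel" shows "(\<lambda>x. f x * g x) \<in> bdd_borel"
proof -
  obtain B C where BC: "\<forall>x. \<bar>f x\<bar> \<le> B" "\<forall>x. \<bar>g x\<bar> \<le> C" using assms unfolding bdd_borel_def by blast
  then have "\<bar>f x * g x\<bar> \<le> B * C" for x
    unfolding abs_mult by (meson abs_ge_zero mult_mono order_trans)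
  then show ?thesis
    by (rule bdd_borelI[OF borel_measurable_times[OF assms[THEN bdd_borel_measurable]]])
qed

lemma bdd_borel_const: "(\<lambda>x. c) \<in> bdd_borel"
  by (intro bdd_borelI[of _ "\<bar>c\<bar>"]) auto

lemma bdd_borel_cmult: "f \<in> bdd_borel \<Longrightarrow> (\<lambda>x. c * f x) \<in> bdd_borel"
  by (intro bdd_borel_mult bdd_borel_const)

lemma bdd_borel_minus: "f \<in> bdd_borel \<Longrightarrow> (\<lambda>x. - f x) \<in> bdd_borel"
  using bdd_borel_cmult[of f "-1"] by simp

lemma bdd_borel_diff:
  assumes "f \<in> bdd_borel" "g \<in> bdd_borel" shows "(\<lambda>x. f x - g x) \<in> bdd_borel"
  using bdd_borel_add[OF assms(1) bdd_borel_minus[OF assms(2)]] by simp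

lemma bdd_borel_indicator: "E \<in> sets borel \<Longrightarrow> indicator E \<in> bdd_borel"
  by (intro bdd_borelI[of _ 1]) (auto simp: indicator_def)

lemma bdd_borel_sum: "(\<And>i. i \<in> I \<Longrightarrow> f i \<in> bdd_borel) \<Longrightarrow> (\<lambda>x. \<Sum>i\<in>I. f i x) \<in> bdd_borel"
proof (induction I rule: infinite_finite_induct)
  case (insert i I)
  then show ?case by (simp add: bdd_borel_add)
qed (auto simp: bdd_borel_const)

lemma bdd_borel_integrable:
  assumes "finite_measure M" "sets M = sets borel" "f \<in> bdd_borel"
  shows "integrable M f"
proof -
  obtain B where "\<forall>x. \<bar>f x\<bar> \<le> B" using assms unfolding bdd_borel_def by blast
  moreover have "f \<in> borel_measurable M"
    using bdd_borel_measurable[OF assms(3)] measurable_cong_sets[OF assms(2) refl] by blast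
  ultimately show ?thesis by (intro finite_measure.integrable_const_bound[OF assms(1), of f B]) simp_all
qed

text \<open>A bounded Borel function is a uniform limit of simple functions, on which
  \<open>\<Phi>\<close> vanishes by linearity, and the bound carries this to the limit. Identities
  between integrals against different measures thereby reduce to identities on Borel sets.\<close>

lemma functional_zero:
  fixes \<Phi> :: "('a::topological_space \<Rightarrow> real) \<Rightarrow> real"
  assumes add: "\<And>f g. f \<in> bdd_borel \<Longrightarrow> g \<in> bdd_borel \<Longrightarrow> \<Phi> (\<lambda>x. f x + g x) = \<Phi> f + \<Phi> g"
    and scale: "\<And>c f. f \<in> bdd_borel \<Longrightarrow> \<Phi> (\<lambda>x. c * f x) = c * \<Phi> f"
    and bound: "\<And>f B. f \<in> bdd_borel \<Longrightarrow> (\<And>x. \<bar>f x\<bar> \<le> B) \<Longrightarrow> \<bar>\<Phi> f\<bar> \<le> c * B"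
    and ind: "\<And>E. E \<in> sets borel \<Longrightarrow> \<Phi> (indicator E) = 0"
    and f: "f \<in> bdd_borel"
  shows "\<Phi> f = 0"
proof -
  obtain B where B: "\<And>x. \<bar>f x\<bar> \<le> B" using f unfolding bdd_borel_def by blast
  have fm[measurable]: "f \<in> borel_measurable borel" by (rule bdd_borel_measurable[OF f])
  have "\<bar>\<Phi> f\<bar> \<le> c * (1 / real (Suc n))" for n
  proof -
    let ?N = "real (Suc n)"
    define E where "E k = {x. \<lfloor>?N * f x\<rfloor> = k}" for k :: int
    \<comment> \<open>Boundedness of \<open>f\<close> leaves finitely many values for the floor of
      \<open>?N * f x\<close>, so \<open>s\<close>, which is this floor divided by
      \<open>?N\<close>, is a finite sum.\<close>
    define K where "K = {\<lfloor>?N * (- B)\<rfloor> .. \<lfloor>?N * B\<rfloor>}"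
    define s where "s x = (\<Sum>k\<in>K. (k / ?N) * indicator (E k) x)" for x
    have E[measurable]: "E k \<in> sets borel" for k
    proof -
      have "E k = {x\<in>space borel. \<lfloor>?N * f x\<rfloor> = k}" by (simp add: E_def)
      also have "\<dots> \<in> sets borel" by measurable
      finally show ?thesis .
    qed
    have s1: "(\<lambda>x. (k / ?N) * indicator (E k) x) \<in> bdd_borel" for k :: int
      by (intro bdd_borel_cmult bdd_borel_indicator E)
    have s_bdd: "s \<in> bdd_borel" unfolding s_def by (intro bdd_borel_sum s1)
    have "\<Phi> (\<lambda>x. \<Sum>k\<in>J. (k / ?N) * indicator (E k) x) = 0" if "finite J" for J :: "int set"
      using that
    proof induction
      case empty
      then show ?case using scale[OF bdd_borel_const, of 0 1] by simp
    next
      case (insert k J)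
      have "\<Phi> (\<lambda>x. (k / ?N) * indicator (E k) x) = 0"
        by (simp only: scale[OF bdd_borel_indicator[OF E]] ind[OF E] mult_zero_right)
      moreover have "(\<lambda>x. \<Sum>k\<in>J. (k / ?N) * indicator (E k) x) \<in> bdd_borel"
        by (rule bdd_borel_sum, rule s1)
      ultimately show ?case using insert add[OF s1[of k]] by simp
    qed
    then have \<Phi>s: "\<Phi> s = 0" unfolding s_def K_def by simp
    have s_eq: "s x = \<lfloor>?N * f x\<rfloor> / ?N" for x
    proof -
      have "\<lfloor>?N * f x\<rfloor> \<in> K"
      proof -
        have "- B \<le> f x" "f x \<le> B" using B[of x] by auto
        then have "?N * (- B) \<le> ?N * f x" "?N * f x \<le> ?N * B" by (intro mult_left_mono; simp)+
        then show ?thesis unfolding K_def atLeastAtMost_iff by (intro conjI floor_mono)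
      qed
      then show ?thesis unfolding s_def E_def
        by (subst sum.remove[of K "\<lfloor>?N * f x\<rfloor>"]) (auto simp: K_def indicator_def)
    qed
    have "\<bar>f x - s x\<bar> \<le> 1 / ?N" for x
    proof -
      have "\<bar>?N * f x - \<lfloor>?N * f x\<rfloor>\<bar> \<le> 1" by linarith
      moreover have "f x - s x = (?N * f x - \<lfloor>?N * f x\<rfloor>) / ?N" unfolding s_eq by (simp add: field_simps)
      ultimately show ?thesis by (simp add: abs_divide divide_right_mono)
    qed
    then have "\<bar>\<Phi> (\<lambda>x. f x - s x)\<bar> \<le> c * (1 / ?N)"
      by (intro bound bdd_borel_diff f s_bdd)
    moreover have "\<Phi> f = \<Phi> (\<lambda>x. f x - s x)"
      using add[OF bdd_borel_diff[OF f s_bdd] s_bdd] \<Phi>s by simp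
    ultimately show ?thesis by simp
  qed
  then show ?thesis by (rule zero_if_abs_le_inverse)
qed

text \<open>The real counterpart of \<open>signed_integral\<close>; complex integrals occur only
  where the theorem and \<open>positive_type\<close> demand them.\<close>

definition sint :: "('a::topological_space set \<Rightarrow> real) \<Rightarrow> ('a \<Rightarrow> real) \<Rightarrow> real" where
  "sint m f = integral\<^sup>L (positive_part m) f - integral\<^sup>L (negative_part m) f"

lemma signed_integral_of_real: "signed_integral m (\<lambda>x. complex_of_real (f x)) = of_real (sint m f)"
  unfolding signed_integral_def sint_def by simp

lemma integral_Complex:
  assumes "integrable M f" "integrable M g"
  shows "(LINT x|M. Complex (f x) (g x)) = Complex (integral\<^sup>L M f) (integral\<^sup>L M g)"
proof -
  have "(LINT x|M. complex_of_real (f x) + \<i> * complex_of_real (g x)) =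
      of_real (integral\<^sup>L M f) + \<i> * of_real (integral\<^sup>L M g)"
    using assms by (subst Bochner_Integration.integral_add) (auto simp del: Re_complex_of_real)
  then show ?thesis by (simp add: Complex_eq)
qed

lemma signed_integral_Complex:
  assumes m: "finite_variation m" and f: "f \<in> bdd_borel" "g \<in> bdd_borel"
  shows "signed_integral m (\<lambda>x. Complex (f x) (g x)) = Complex (sint m f) (sint m g)"
proof -
  have "(LINT x|M. Complex (f x) (g x)) = Complex (integral\<^sup>L M f) (integral\<^sup>L M g)"
    if "finite_measure M" "sets M = sets borel" for M
    by (intro integral_Complex bdd_borel_integrable[OF that] f)
  from this[OF finite_measure_parts(1)[OF m]] this[OF finite_measure_parts(2)[OF m]]
  show ?thesis unfolding signed_integral_def sint_def by (simp add: complex_eq_iff)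
qed

lemma sint_add:
  assumes "finite_variation m" "f \<in> bdd_borel" "g \<in> bdd_borel"
  shows "sint m (\<lambda>x. f x + g x) = sint m f + sint m g"
  using bdd_borel_integrable[OF finite_measure_parts(1)[OF assms(1)] sets_positive_part]
    bdd_borel_integrable[OF finite_measure_parts(2)[OF assms(1)] sets_negative_part] assms(2,3)
  unfolding sint_def by (simp add: Bochner_Integration.integral_add)

lemma sint_cmult: "sint m (\<lambda>x. c * f x) = c * sint m f"
  unfolding sint_def by (simp add: right_diff_distrib)

lemma sint_diff:
  assumes "finite_variation m" "f \<in> bdd_borel" "g \<in> bdd_borel"
  shows "sint m (\<lambda>x. f x - g x) = sint m f - sint m g"
  using sint_add[OF assms(1,2) bdd_borel_minus[OF assms(3)]] sint_cmult[of m "-1" g] by simp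

lemma sint_sum:
  assumes "finite_variation m" "\<And>i. i \<in> I \<Longrightarrow> f i \<in> bdd_borel"
  shows "sint m (\<lambda>x. \<Sum>i\<in>I. f i x) = (\<Sum>i\<in>I. sint m (f i))"
  using assms(2)
proof (induction I rule: infinite_finite_induct)
  case (insert i I)
  then show ?case by (simp add: sint_add[OF assms(1)] bdd_borel_sum)
qed (simp_all add: sint_def)

text \<open>The hypothesis on \<open>f\<close> is at once a bound and a support condition, so that
  the estimate applies to a tail carried by a set of small measure.\<close>

lemma integral_abs_le_on:
  assumes M: "finite_measure M" "sets M = sets borel" and f: "f \<in> bdd_borel" and E: "E \<in> sets borel"
    and B: "\<And>x. \<bar>f x\<bar> \<le> B * indicator E x"
  shows "\<bar>integral\<^sup>L M f\<bar> \<le> measure M E * B"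
proof -
  have sp: "space M = UNIV" using sets_eq_imp_space_eq[OF M(2)] by simp
  have "\<bar>integral\<^sup>L M f\<bar> \<le> (LINT x|M. \<bar>f x\<bar>)" by (rule integral_abs_bound)
  also have "\<dots> \<le> (LINT x|M. B * indicator E x)"
  proof (rule integral_mono)
    show "integrable M (\<lambda>x. \<bar>f x\<bar>)" by (rule integrable_abs[OF bdd_borel_integrable[OF M f]])
    show "integrable M (\<lambda>x. B * indicator E x)"
      by (rule bdd_borel_integrable[OF M bdd_borel_cmult[OF bdd_borel_indicator[OF E]]])
  qed (rule B)
  also have "\<dots> = measure M E * B" by (simp add: sp mult.commute)
  finally show ?thesis .
qed

lemma sint_abs_le_on:
  assumes m: "finite_variation m" and f: "f \<in> bdd_borel" and E: "E \<in> sets borel"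
    and B: "\<And>x. \<bar>f x\<bar> \<le> B * indicator E x"
  shows "\<bar>sint m f\<bar> \<le> variation m E * B"
proof -
  have "\<bar>sint m f\<bar> \<le> measure (positive_part m) E * B + measure (negative_part m) E * B"
    unfolding sint_def
    using integral_abs_le_on[OF finite_measure_parts(1)[OF m] sets_positive_part f E B]
      integral_abs_le_on[OF finite_measure_parts(2)[OF m] sets_negative_part f E B] by linarith
  also have "\<dots> = variation m E * B"
    unfolding distrib_right[symmetric] measure_parts[OF m E] by (simp add: field_simps)
  finally show ?thesis .
qed

lemma sint_abs_le:
  assumes "finite_variation m" "f \<in> bdd_borel" "\<And>x. \<bar>f x\<bar> \<le> B"
  shows "\<bar>sint m f\<bar> \<le> variation m UNIV * B"
  by (rule sint_abs_le_on[OF assms(1,2)]) (simp_all add: assms(3))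

lemma sint_indicator:
  assumes m: "finite_variation m" and E: "E \<in> sets borel"
  shows "sint m (indicator E) = m E"
proof -
  have "sint m (indicator E) = measure (positive_part m) E - measure (negative_part m) E"
    using E by (simp add: sint_def)
  then show ?thesis unfolding measure_parts[OF assms] by (simp add: field_simps)
qed

text \<open>The Jordan decomposition of a combination is not the combination of the decompositions,
  so the two functionals are compared on indicators. The measure \<open>k\<close> is kept apart from
  the formula because set functions matter on Borel sets only.\<close>

lemma sint_lincomb:
  assumes m: "finite_variation m" "finite_variation n" "finite_variation k"
    and eq: "\<And>E. E \<in> sets borel \<Longrightarrow> k E = a * m E + b * n E" and f: "f \<in> bdd_borel"
  shows "sint k f = a * sint m f + b * sint n f"
proof -
  let ?t = "\<lambda>m. variation m (UNIV :: 'a set)"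
  have "sint k f - (a * sint m f + b * sint n f) = 0"
  proof (rule functional_zero[where c = "?t k + (\<bar>a\<bar> * ?t m + \<bar>b\<bar> * ?t n)", OF _ _ _ _ f])
    fix f :: "'a \<Rightarrow> real" and B assume f: "f \<in> bdd_borel" "\<And>x. \<bar>f x\<bar> \<le> B"
    have "\<bar>a * sint m f\<bar> \<le> \<bar>a\<bar> * (?t m * B)" "\<bar>b * sint n f\<bar> \<le> \<bar>b\<bar> * (?t n * B)"
      unfolding abs_mult using sint_abs_le[OF _ f] m by (auto intro!: mult_left_mono)
    then show "\<bar>sint k f - (a * sint m f + b * sint n f)\<bar> \<le> (?t k + (\<bar>a\<bar> * ?t m + \<bar>b\<bar> * ?t n)) * B"
      using sint_abs_le[OF m(3) f] by (simp add: algebra_simps)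
  qed (auto simp: sint_add m sint_cmult sint_indicator eq algebra_simps)
  then show ?thesis by simp
qed

text \<open>For a set function that comes from a measure \<open>M\<close>, such as the Riesz
  measure, \<open>sint\<close> still sees the Jordan decomposition and not \<open>M\<close>;
  indicators show that this makes no difference.\<close>

lemma sint_eq_integral:
  assumes m: "finite_variation m" and M: "finite_measure M" "sets M = sets borel"
    and eq: "\<And>E. E \<in> sets borel \<Longrightarrow> m E = measure M E" and f: "f \<in> bdd_borel"
  shows "sint m f = integral\<^sup>L M f"
proof -
  let ?t = "variation m (UNIV :: 'a set)"
  note int = bdd_borel_integrable[OF M]
  have "sint m f - integral\<^sup>L M f = 0"
  proof (rule functional_zero[where c = "?t + measure M UNIV", OF _ _ _ _ f])
    fix f :: "'a \<Rightarrow> real" and B assume f: "f \<in> bdd_borel" "\<And>x. \<bar>f x\<bar> \<le> B"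
    show "\<bar>sint m f - integral\<^sup>L M f\<bar> \<le> (?t + measure M UNIV) * B"
    proof -
      have "\<bar>integral\<^sup>L M f\<bar> \<le> measure M UNIV * B"
        by (rule integral_abs_le_on[OF M f(1)]) (simp_all add: f(2))
      then show ?thesis using sint_abs_le[OF m f] by (simp add: algebra_simps)
    qed
  next
    fix E :: "'a set" assume "E \<in> sets borel"
    then show "sint m (indicator E) - integral\<^sup>L M (indicator E) = 0"
      using M(2) sets_eq_imp_space_eq[OF M(2)] sint_indicator[OF m] eq by simp
  qed (auto simp: sint_add m sint_cmult int algebra_simps)
  then show ?thesis by simp
qed

text \<open>For nonnegative \<open>m\<close> the sums over partitions of the space all equal
  \<open>m UNIV\<close>, so the total variation has no more mass than \<open>m\<close> and the
  negative part is null.\<close>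

lemma sint_nonneg:
  assumes m: "finite_variation m" and nn: "nonnegative_measure m" and f: "\<And>x. 0 \<le> f x"
  shows "0 \<le> sint m f"
proof -
  have b: "m B \<le> m UNIV" if "B \<in> sets borel" for B
    using real_borel_measure_Diff[of m B UNIV] m nn that
    unfolding finite_variation_def nonnegative_measure_def by (metis Diff_UNIV sets.compl_sets space_borel sets.top top_greatest diff_ge_0_iff_ge)
  have "total_variation m UNIV \<le> ennreal (m UNIV)"
    unfolding total_variation_def
  proof (intro SUP_least, clarify)
    fix P :: "'a set set" assume P: "finite P" "P \<subseteq> sets borel" "partition_on UNIV P"
    have "(\<Sum>A\<in>P. \<bar>m A\<bar>) = (\<Sum>A\<in>P. m A)"
      using nn P(2) unfolding nonnegative_measure_def by (intro sum.cong) auto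
    also have "\<dots> = m UNIV"
      using real_borel_measure_Union[of m P] m P unfolding finite_variation_def partition_on_def by simp
    finally show "(\<Sum>A\<in>P. ennreal \<bar>m A\<bar>) \<le> ennreal (m UNIV)" by simp
  qed
  then have "variation m UNIV \<le> m UNIV"
    using nn unfolding nonnegative_measure_def by (simp add: enn2real_leI)
  then have "emeasure (negative_part m) UNIV = 0"
    by (simp add: emeasure_negative_part[OF m] ennreal_eq_0_iff)
  then have "AE x in negative_part m. f x = 0"
    by (intro AE_I[of _ _ UNIV]) auto
  then have "integral\<^sup>L (negative_part m) f = 0" by (rule integral_eq_zero_AE)
  then show ?thesis unfolding sint_def using f by (simp add: integral_nonneg_AE)
qed

section \<open>Regularity, linear combinations and reflection of bounded measures\<close>

lemma signed_measure_boundedI: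
  assumes "finite_variation m" "E \<in> sets borel"
  shows "\<bar>m E\<bar> \<le> variation m UNIV"
proof -
  have "total_variation m E \<le> total_variation m UNIV"
    using assms real_borel_measure_empty[of m] unfolding finite_variation_def
    by (intro total_variation_mono) auto
  then have "variation m E \<le> variation m UNIV"
    using assms unfolding finite_variation_def by (intro enn2real_mono) auto
  then show ?thesis using abs_le_total_variation[OF assms] by linarith
qed

lemma bounded_regular_measureD:
  assumes "bounded_regular_measure m"
  shows "finite_variation m"
  using assms unfolding bounded_regular_measure_def regular_real_borel_measure_def finite_variation_def by auto

text \<open>Outer and inner regularity, each used up to \<open>e/2\<close>, squeeze \<open>E\<close>
  between \<open>K\<close> and \<open>U\<close> with total variation at most \<open>e\<close> on
  \<open>U - K\<close>. The conclusion speaks of the values \<open>m B\<close> because these, unlike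
  the total variation, depend linearly on \<open>m\<close>.\<close>

lemma bounded_regular_measure_approx:
  fixes m :: "'a::t2_space set \<Rightarrow> real"
  assumes m: "bounded_regular_measure m" and E: "E \<in> sets borel" and e: "e > 0"
  obtains K U where "compact K" "open U" "K \<subseteq> E" "E \<subseteq> U"
    "\<And>B. B \<in> sets borel \<Longrightarrow> B \<subseteq> U - K \<Longrightarrow> \<bar>m B\<bar> \<le> e"
proof -
  note fv = bounded_regular_measureD[OF m]
  let ?t = "\<lambda>E. variation m E"
  note tf = total_variation_finite[OF fv]
  have reg: "total_variation m E = (INF U \<in> {U. open U \<and> E \<subseteq> U}. total_variation m U)"
    "total_variation m E = (SUP K \<in> {K. compact K \<and> K \<subseteq> E}. total_variation m K)"
    using m E unfolding bounded_regular_measure_def regular_real_borel_measure_def by blast+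
  have "(INF U \<in> {U. open U \<and> E \<subseteq> U}. total_variation m U) < total_variation m E + ennreal (e/2)"
    using reg(1) tf[OF E] e by (metis ennreal_add_left_cancel_less ennreal_less_zero_iff half_gt_zero infinity_ennreal_def add.right_neutral less_top)
  then obtain U where U: "open U" "E \<subseteq> U" "total_variation m U < total_variation m E + ennreal (e/2)"
    unfolding INF_less_iff by auto
  obtain K where K: "compact K" "K \<subseteq> E" "total_variation m E \<le> total_variation m K + ennreal (e/2)"
  proof -
    have "\<exists>K\<in>{K. compact K \<and> K \<subseteq> E}. total_variation m E \<le> total_variation m K + ennreal (e/2)"
      unfolding reg(2) by (rule ennreal_SUP_approx) (use tf(1)[OF E] e in \<open>auto simp: reg(2)[symmetric] intro: exI[of _ "{}"]\<close>)
    then show ?thesis using that by auto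
  qed
  have KB: "K \<in> sets borel" "U \<in> sets borel" using K U by (auto intro: borel_compact)
  have "ennreal (?t U) < ennreal (?t E + e/2)"
    using U(3) tf(2)[OF E] tf(2)[OF KB(2)] e by (simp add: ennreal_plus)
  then have tU: "?t U < ?t E + e/2" by (simp add: ennreal_less_iff)
  have "ennreal (?t E) \<le> ennreal (?t K + e/2)"
    using K(3) tf(2)[OF E] tf(2)[OF KB(1)] e by (simp add: ennreal_plus)
  then have tK: "?t E \<le> ?t K + e/2" using e by (subst (asm) ennreal_le_iff) (simp_all add: add_nonneg_nonneg)
  have "?t (U - K) = ?t U - ?t K"
    using real_borel_measure_Diff[OF real_borel_measure_total_variation[OF fv] KB] K U by auto
  then have UK: "?t (U - K) \<le> e" using tU tK by linarith
  show thesis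
  proof (rule that[OF K(1) U(1) K(2) U(2)])
    fix B assume B: "B \<in> sets borel" "B \<subseteq> U - K"
    have "?t B \<le> ?t (U - K)"
      using total_variation_mono[of m B "U - K"] B KB tf(1)[of "U - K"] fv real_borel_measure_empty[of m]
      unfolding finite_variation_def by (intro enn2real_mono) auto
    then show "\<bar>m B\<bar> \<le> e" using abs_le_total_variation[OF fv B(1)] UK by linarith
  qed
qed

text \<open>Converse of \<open>bounded_regular_measure_approx\<close>: smallness of \<open>m\<close>
  on the Borel subsets of \<open>U - K\<close> bounds the variation there, and subadditivity bounds
  the variation of \<open>U\<close> by that of \<open>K\<close> plus the error.\<close>

lemma bounded_regular_measureI:
  fixes m :: "'a::t2_space set \<Rightarrow> real"
  assumes m: "real_borel_measure m" and c: "\<And>E. E \<in> sets borel \<Longrightarrow> \<bar>m E\<bar> \<le> c"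
    and reg: "\<And>E e. E \<in> sets borel \<Longrightarrow> e > 0 \<Longrightarrow> \<exists>K U. compact K \<and> open U \<and> K \<subseteq> E \<and> E \<subseteq> U \<and>
      (\<forall>B \<in> sets borel. B \<subseteq> U - K \<longrightarrow> \<bar>m B\<bar> \<le> e)"
  shows "bounded_regular_measure m"
proof -
  have tvU: "total_variation m UNIV \<le> ennreal (2 * c)"
    by (rule total_variation_le[OF m]) (auto intro: c)
  then have fin: "total_variation m UNIV < \<infinity>" by (auto simp: order_le_less_trans)
  have m0: "m {} = 0" by (rule real_borel_measure_empty[OF m])
  note mono = total_variation_mono[of m, OF m0]
  have "total_variation m E = (INF U \<in> {U. open U \<and> E \<subseteq> U}. total_variation m U) \<and>
        total_variation m E = (SUP K \<in> {K. compact K \<and> K \<subseteq> E}. total_variation m K)"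
    if E: "E \<in> sets borel" for E
  proof -
    have *: "\<exists>K U. compact K \<and> open U \<and> K \<subseteq> E \<and> E \<subseteq> U \<and>
      total_variation m U \<le> total_variation m K + ennreal e" if e: "e > 0" for e
    proof -
      \<comment> \<open>The bound \<open>e/2\<close> compensates the factor 2 of
        \<open>total_variation_le\<close>.\<close>
      obtain K U where KU: "compact K" "open U" "K \<subseteq> E" "E \<subseteq> U"
        "\<forall>B\<in>sets borel. B \<subseteq> U - K \<longrightarrow> \<bar>m B\<bar> \<le> e/2"
        using reg[OF E half_gt_zero[OF e]] by metis
      have KB: "K \<in> sets borel" "U \<in> sets borel" using KU by (auto intro: borel_compact)
      have "total_variation m (U - K) \<le> ennreal (2 * (e/2))"
      proof (rule total_variation_le[OF m])
        show "U - K \<in> sets borel" using KB by simp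
      qed (use KU(5) in blast)
      moreover have "total_variation m U \<le> total_variation m K + total_variation m (U - K)"
      proof -
        have "total_variation m (\<Union>n. binaryset K (U - K) n) \<le> (\<Sum>n. total_variation m (binaryset K (U - K) n))"
        proof (rule total_variation_subadd[OF m])
          show "range (binaryset K (U - K)) \<subseteq> sets borel"
            using KB by (simp add: range_binaryset_eq)
          show "disjoint_family (binaryset K (U - K))"
            by (auto simp: disjoint_family_on_def binaryset_def)
        qed
        also have "(\<Union>n. binaryset K (U - K) n) = U"
          using KU(3,4) by (simp add: UN_binaryset_eq Un_absorb1)
        also have "(\<Sum>n. total_variation m (binaryset K (U - K) n)) = total_variation m K + total_variation m (U - K)"
          by (rule suminf_binaryset_eq) (rule total_variation_empty, rule m0)
        finally show ?thesis .
      qed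
      ultimately have "total_variation m U \<le> total_variation m K + ennreal e"
        by (simp add: add_left_mono order_trans)
      then show ?thesis using KU by blast
    qed
    have fE: "total_variation m E < top" using mono[of E UNIV] E fin by (simp add: order_le_less_trans)
    show ?thesis
    proof (intro conjI antisym)
      show "total_variation m E \<le> (INF U \<in> {U. open U \<and> E \<subseteq> U}. total_variation m U)"
        using E by (intro INF_greatest mono) auto
      show "(SUP K \<in> {K. compact K \<and> K \<subseteq> E}. total_variation m K) \<le> total_variation m E"
        using E by (intro SUP_least mono) (auto intro: borel_compact)
      show "(INF U \<in> {U. open U \<and> E \<subseteq> U}. total_variation m U) \<le> total_variation m E" (is "?I \<le> _")
      proof (rule ennreal_le_epsilon)
        fix e :: real assume "0 < e"
        with * obtain K U where KU: "compact K" "open U" "K \<subseteq> E" "E \<subseteq> U"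
          "total_variation m U \<le> total_variation m K + ennreal e" by metis
        have "?I \<le> total_variation m U" using KU(2,4) by (intro INF_lower) simp
        moreover have "total_variation m K \<le> total_variation m E"
          using KU(1,3) E by (intro mono) (auto intro: borel_compact)
        ultimately show "?I \<le> total_variation m E + ennreal e"
          using KU(5) by (meson add_right_mono order_trans)
      qed
      show "total_variation m E \<le> (SUP K \<in> {K. compact K \<and> K \<subseteq> E}. total_variation m K)" (is "_ \<le> ?S")
      proof (rule ennreal_le_epsilon)
        fix e :: real assume "0 < e"
        with * obtain K U where KU: "compact K" "open U" "K \<subseteq> E" "E \<subseteq> U"
          "total_variation m U \<le> total_variation m K + ennreal e" by metis
        have "total_variation m E \<le> total_variation m U" using KU(2,4) E by (intro mono) auto
        moreover have "total_variation m K \<le> ?S" using KU(1,3) by (intro SUP_upper) simp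
        ultimately show "total_variation m E \<le> ?S + ennreal e"
          using KU(5) by (meson add_right_mono order_trans)
      qed
    qed
  qed
  then show ?thesis unfolding bounded_regular_measure_def regular_real_borel_measure_def
    using m fin by blast
qed

lemma bounded_regular_measure_lincomb:
  fixes m n :: "'a::t2_space set \<Rightarrow> real"
  assumes m: "bounded_regular_measure m" and n: "bounded_regular_measure n"
  shows "bounded_regular_measure (\<lambda>E. a * m E + b * n E)"
proof (rule bounded_regular_measureI)
  note fv = bounded_regular_measureD[OF m] bounded_regular_measureD[OF n]
  show "real_borel_measure (\<lambda>E. a * m E + b * n E)"
    using fv unfolding finite_variation_def by (intro real_borel_measure_lincomb) auto
  have tri: "\<bar>a * m E + b * n E\<bar> \<le> \<bar>a\<bar> * s + \<bar>b\<bar> * t" if "\<bar>m E\<bar> \<le> s" "\<bar>n E\<bar> \<le> t" for E s t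
  proof -
    have "\<bar>a * m E + b * n E\<bar> \<le> \<bar>a\<bar> * \<bar>m E\<bar> + \<bar>b\<bar> * \<bar>n E\<bar>" by (metis abs_mult abs_triangle_ineq)
    also have "\<dots> \<le> \<bar>a\<bar> * s + \<bar>b\<bar> * t" using that by (intro add_mono mult_left_mono) auto
    finally show ?thesis .
  qed
  show "\<bar>a * m E + b * n E\<bar> \<le> \<bar>a\<bar> * variation m UNIV + \<bar>b\<bar> * variation n UNIV"
    if "E \<in> sets borel" for E
    using signed_measure_boundedI[OF fv(1) that] signed_measure_boundedI[OF fv(2) that] by (rule tri)
  fix E :: "'a set" and e :: real assume E: "E \<in> sets borel" and e: "e > 0"
  \<comment> \<open>The summand 1 keeps the denominator positive for
    \<open>a = b = 0\<close>.\<close>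
  let ?d = "e / (\<bar>a\<bar> + \<bar>b\<bar> + 1)"
  have d: "?d > 0" using e by (simp add: add_nonneg_pos)
  have de: "\<bar>a\<bar> * ?d + \<bar>b\<bar> * ?d \<le> e"
  proof -
    have "\<bar>a\<bar> * ?d + \<bar>b\<bar> * ?d = (\<bar>a\<bar> + \<bar>b\<bar>) * ?d" by (rule distrib_right[symmetric])
    also have "\<dots> \<le> (\<bar>a\<bar> + \<bar>b\<bar> + 1) * ?d" using d by (intro mult_right_mono) auto
    also have "\<dots> = e" using e by (simp add: add_nonneg_pos less_imp_neq[symmetric])
    finally show ?thesis .
  qed
  obtain K U where KU: "compact K" "open U" "K \<subseteq> E" "E \<subseteq> U"
    "\<And>B. B \<in> sets borel \<Longrightarrow> B \<subseteq> U - K \<Longrightarrow> \<bar>m B\<bar> \<le> ?d"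
    using bounded_regular_measure_approx[OF m E d] by metis
  obtain K' U' where KU': "compact K'" "open U'" "K' \<subseteq> E" "E \<subseteq> U'"
    "\<And>B. B \<in> sets borel \<Longrightarrow> B \<subseteq> U' - K' \<Longrightarrow> \<bar>n B\<bar> \<le> ?d"
    using bounded_regular_measure_approx[OF n E d] by metis
  show "\<exists>K U. compact K \<and> open U \<and> K \<subseteq> E \<and> E \<subseteq> U \<and>
      (\<forall>B \<in> sets borel. B \<subseteq> U - K \<longrightarrow> \<bar>a * m B + b * n B\<bar> \<le> e)"
  proof (intro exI conjI ballI impI)
    fix B assume B: "B \<in> sets borel" "B \<subseteq> (U \<inter> U') - (K \<union> K')"
    have "\<bar>m B\<bar> \<le> ?d" "\<bar>n B\<bar> \<le> ?d" using B by (intro KU KU'; blast)+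
    from tri[OF this] de show "\<bar>a * m B + b * n B\<bar> \<le> e" by linarith
  qed (use KU KU' in auto)
qed

text \<open>As a preimage under a continuous map the reflected set is visibly Borel or open when
  \<open>E\<close> is.\<close>

lemma uminus_image_eq_vimage: "uminus ` E = uminus -` (E :: 'a::group_add set)"
  by (auto simp: image_iff) (metis minus_minus)

lemma borel_uminus_image:
  fixes E :: "'a::{topological_ab_group_add,t2_space} set"
  assumes "E \<in> sets borel" shows "uminus ` E \<in> sets borel"
proof -
  have "(uminus :: 'a \<Rightarrow> 'a) \<in> borel_measurable borel"
    by (intro borel_measurable_continuous_onI continuous_intros)
  then show ?thesis using measurable_sets[of uminus borel borel E] assms
    by (simp add: uminus_image_eq_vimage)
qed

lemma bounded_regular_measure_reflect:
  fixes m :: "'a::{topological_ab_group_add,t2_space} set \<Rightarrow> real"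
  assumes m: "bounded_regular_measure m"
  shows "bounded_regular_measure (\<lambda>E. m (uminus ` E))"
proof (rule bounded_regular_measureI)
  note fv = bounded_regular_measureD[OF m]
  show "real_borel_measure (\<lambda>E. m (uminus ` E))"
    unfolding real_borel_measure_def
  proof (intro allI impI)
    fix A :: "nat \<Rightarrow> 'a set" assume A: "range A \<subseteq> sets borel" "disjoint_family A"
    have "range (\<lambda>n. uminus ` A n) \<subseteq> sets borel" using A(1) borel_uminus_image by blast
    moreover have "disjoint_family (\<lambda>n. uminus ` A n)"
      using A(2) unfolding disjoint_family_on_def uminus_image_eq_vimage by blast
    ultimately have "(\<lambda>n. m (uminus ` A n)) sums m (\<Union>n. uminus ` A n)"
      using fv unfolding finite_variation_def by (intro real_borel_measure_sums) auto
    then show "(\<lambda>n. m (uminus ` A n)) sums m (uminus ` (\<Union>n. A n))" by (simp add: image_UN)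
  qed
  show "\<bar>m (uminus ` E)\<bar> \<le> variation m UNIV" if "E \<in> sets borel" for E
    by (rule signed_measure_boundedI[OF fv borel_uminus_image[OF that]])
  fix E :: "'a set" and e :: real assume E: "E \<in> sets borel" and e: "e > 0"
  obtain K U where KU: "compact K" "open U" "K \<subseteq> uminus ` E" "uminus ` E \<subseteq> U"
    "\<And>B. B \<in> sets borel \<Longrightarrow> B \<subseteq> U - K \<Longrightarrow> \<bar>m B\<bar> \<le> e"
    using bounded_regular_measure_approx[OF m borel_uminus_image[OF E] e] by metis
  have "compact (uminus ` K)" by (intro compact_continuous_image continuous_intros KU)
  moreover have "open (uminus ` U)" unfolding uminus_image_eq_vimage
    by (intro open_vimage KU continuous_intros)
  moreover have "uminus ` K \<subseteq> E" using KU(3) by force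
  moreover have "E \<subseteq> uminus ` U" using KU(4) by force
  moreover have "\<bar>m (uminus ` B)\<bar> \<le> e" if "B \<in> sets borel" "B \<subseteq> uminus ` U - uminus ` K" for B
    using that borel_uminus_image by (intro KU(5)) auto
  ultimately show "\<exists>K U. compact K \<and> open U \<and> K \<subseteq> E \<and> E \<subseteq> U \<and>
      (\<forall>B \<in> sets borel. B \<subseteq> U - K \<longrightarrow> \<bar>m (uminus ` B)\<bar> \<le> e)"
    by (intro exI[of _ "uminus ` K"] exI[of _ "uminus ` U"] conjI ballI impI) simp_all
qed

text \<open>On the indicator of \<open>E\<close> both sides give the measure of the reflected set,
  and \<open>functional_zero\<close> extends this to bounded Borel functions.\<close>

lemma sint_reflect:
  fixes m :: "'a::{topological_ab_group_add,t2_space} set \<Rightarrow> real"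
  assumes m: "bounded_regular_measure m" and f: "f \<in> bdd_borel"
  shows "sint (\<lambda>E. m (uminus ` E)) f = sint m (\<lambda>x. f (- x))"
proof -
  let ?n = "\<lambda>E. m (uminus ` E)"
  let ?t = "\<lambda>m. variation m (UNIV :: 'a set)"
  note fm = bounded_regular_measureD[OF m]
  note fn = bounded_regular_measureD[OF bounded_regular_measure_reflect[OF m]]
  have r: "(\<lambda>x. f (- x)) \<in> bdd_borel" if f: "f \<in> bdd_borel" for f :: "'a \<Rightarrow> real"
  proof -
    obtain B where "\<And>x. \<bar>f x\<bar> \<le> B" using f unfolding bdd_borel_def by blast
    moreover have "(uminus :: 'a \<Rightarrow> 'a) \<in> borel_measurable borel"
      by (intro borel_measurable_continuous_onI continuous_intros)
    then have "(\<lambda>x. f (- x)) \<in> borel_measurable borel"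
      using bdd_borel_measurable[OF f] by (rule measurable_compose)
    ultimately show ?thesis by (intro bdd_borelI)
  qed
  have "sint ?n f - sint m (\<lambda>x. f (- x)) = 0"
  proof (rule functional_zero[where c = "?t ?n + ?t m", OF _ _ _ _ f])
    fix f :: "'a \<Rightarrow> real" and B assume f: "f \<in> bdd_borel" "\<And>x. \<bar>f x\<bar> \<le> B"
    show "\<bar>sint ?n f - sint m (\<lambda>x. f (- x))\<bar> \<le> (?t ?n + ?t m) * B"
      using sint_abs_le[OF fn f] sint_abs_le[OF fm r[OF f(1)] f(2)] by (simp add: algebra_simps)
  next
    fix E :: "'a set" assume E: "E \<in> sets borel"
    have "(\<lambda>x. indicator E (- x) :: real) = indicator (uminus ` E)"
      by (auto simp: uminus_image_eq_vimage indicator_def)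
    then show "sint ?n (indicator E) - sint m (\<lambda>x. indicator E (- x)) = 0"
      using sint_indicator[OF fn E] sint_indicator[OF fm borel_uminus_image[OF E]] by simp
  qed (auto simp: sint_add[OF fn] sint_add[OF fm] r sint_cmult algebra_simps)
  then show ?thesis by simp
qed

subsection \<open>Continuous functions with compact support\<close>

text \<open>Vanishing off some compact set replaces the compact closure of the support in
  \<open>Cc\<close>, so that sums need only a union of compact sets. In a Hausdorff space the two
  conditions agree.\<close>

definition Ccr :: "('a::topological_space \<Rightarrow> real) set" where
  "Ccr = {f. continuous_on UNIV f \<and> (\<exists>K. compact K \<and> (\<forall>x. x \<notin> K \<longrightarrow> f x = 0))}"

lemma CcrI: "continuous_on UNIV f \<Longrightarrow> compact K \<Longrightarrow> (\<And>x. x \<notin> K \<Longrightarrow> f x = 0) \<Longrightarrow> f \<in> Ccr"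
  unfolding Ccr_def by blast

lemma CcrE:
  assumes "f \<in> Ccr"
  obtains K where "compact K" "\<And>x. x \<notin> K \<Longrightarrow> f x = 0"
  using assms unfolding Ccr_def by blast

lemma Ccr_continuous: "f \<in> Ccr \<Longrightarrow> continuous_on UNIV f"
  unfolding Ccr_def by blast

text \<open>The usual way to membership: truncations, absolute values, square roots and products all
  vanish where the original function does.\<close>

lemma Ccr_dominated:
  assumes "g \<in> Ccr" "continuous_on UNIV f" "\<And>x. g x = 0 \<Longrightarrow> f x = 0"
  shows "f \<in> Ccr"
  using assms unfolding Ccr_def by blast

lemma Ccr_zero: "(\<lambda>x. 0) \<in> Ccr"
  by (rule CcrI[of _ "{}"]) auto

lemma Ccr_add:
  assumes "f \<in> Ccr" "g \<in> Ccr" shows "(\<lambda>x. f x + g x) \<in> Ccr"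
proof -
  obtain K where K: "compact K" "\<And>x. x \<notin> K \<Longrightarrow> f x = 0" using CcrE[OF assms(1)] by blast
  obtain L where L: "compact L" "\<And>x. x \<notin> L \<Longrightarrow> g x = 0" using CcrE[OF assms(2)] by blast
  show ?thesis
  proof (rule CcrI)
    show "compact (K \<union> L)" using K L by blast
    show "continuous_on UNIV (\<lambda>x. f x + g x)" by (intro continuous_on_add Ccr_continuous assms)
  qed (use K L in simp)
qed

lemma Ccr_mult:
  assumes "f \<in> Ccr" "continuous_on UNIV g" shows "(\<lambda>x. g x * f x) \<in> Ccr"
  by (rule Ccr_dominated[OF assms(1) continuous_on_mult[OF assms(2) Ccr_continuous[OF assms(1)]]]) simp

lemma Ccr_cmult: "f \<in> Ccr \<Longrightarrow> (\<lambda>x. c * f x) \<in> Ccr"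
  by (rule Ccr_mult) auto

lemma Ccr_minus: "f \<in> Ccr \<Longrightarrow> (\<lambda>x. - f x) \<in> Ccr"
  using Ccr_cmult[of f "-1"] by simp

lemma Ccr_diff: "f \<in> Ccr \<Longrightarrow> g \<in> Ccr \<Longrightarrow> (\<lambda>x. f x - g x) \<in> Ccr"
  using Ccr_add[OF _ Ccr_minus] by fastforce

lemma Ccr_sum: "(\<And>i. i \<in> I \<Longrightarrow> f i \<in> Ccr) \<Longrightarrow> (\<lambda>x. \<Sum>i\<in>I. f i x) \<in> Ccr"
proof (induction I rule: infinite_finite_induct)
  case (insert i I)
  then show ?case by (simp add: Ccr_add)
qed (auto simp: Ccr_zero)

lemma Ccr_bounded:
  assumes "f \<in> Ccr" obtains B where "0 \<le> B" "\<And>x. \<bar>f x\<bar> \<le> B"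
proof -
  obtain K where K: "compact K" "\<And>x. x \<notin> K \<Longrightarrow> f x = 0" using CcrE[OF assms] by blast
  have "compact (f ` K)"
    using Ccr_continuous[OF assms] by (intro compact_continuous_image K) (rule continuous_on_subset, auto)
  then obtain B where B: "\<And>x. x \<in> K \<Longrightarrow> \<bar>f x\<bar> \<le> B" "0 < B"
    using bounded_pos[of "f ` K"] compact_imp_bounded by (auto simp: real_norm_def)
  then have "\<bar>f x\<bar> \<le> B" for x using K(2)[of x] by (cases "x \<in> K") auto
  then show ?thesis using that[of B] B(2) by simp
qed

lemma Ccr_bdd_borel: "f \<in> Ccr \<Longrightarrow> f \<in> bdd_borel"
  by (rule Ccr_bounded, assumption, rule bdd_borelI[OF borel_measurable_continuous_onI[OF Ccr_continuous]])

lemma Ccr_compact_superlevel: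
  fixes f :: "'a::topological_space \<Rightarrow> real"
  assumes "f \<in> Ccr" "0 < d" shows "compact {x. d \<le> f x}"
proof -
  obtain K where K: "compact K" "\<And>x. x \<notin> K \<Longrightarrow> f x = 0" using CcrE[OF assms(1)] by blast
  have "closed {x. d \<le> f x}" by (intro closed_Collect_le continuous_on_const Ccr_continuous assms)
  then have "compact (K \<inter> {x. d \<le> f x})" by (rule compact_Int_closed[OF K(1)])
  moreover have "K \<inter> {x. d \<le> f x} = {x. d \<le> f x}" using K(2) assms(2) by force
  ultimately show ?thesis by simp
qed

text \<open>A locally compact Hausdorff space is completely regular. Separating \<open>x\<close>
  from the complement of \<open>U \<inter> V\<close>, with \<open>V\<close> inside a compact set,
  yields compact support.\<close>

lemma Urysohn_point:
  fixes U :: "'a::t2_space set"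
  assumes lc: "locally_compact_space (euclidean :: 'a topology)" and U: "open U" "x \<in> U"
  obtains \<psi> where "\<psi> \<in> Ccr" "\<psi> x = 1" "\<And>y. 0 \<le> \<psi> y" "\<And>y. \<psi> y \<le> 1" "\<And>y. y \<notin> U \<Longrightarrow> \<psi> y = 0"
proof -
  have "Hausdorff_space (euclidean :: 'a topology)"
    unfolding Hausdorff_space_def using hausdorff by (simp add: disjnt_def) blast
  then have cr: "completely_regular_space (euclidean :: 'a topology)"
    using locally_compact_regular_imp_completely_regular_space lc by blast
  obtain V K where V: "open V" "compact K" "x \<in> V" "V \<subseteq> K"
    using lc unfolding locally_compact_space_def by simp metis
  obtain f :: "'a \<Rightarrow> real" where f: "continuous_map euclidean (top_of_set {0..1}) f" "f x = 0" "f ` (- (U \<inter> V)) \<subseteq> {1}"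
    using cr[unfolded completely_regular_space_def, rule_format, of "- (U \<inter> V)" x] U V by auto
  then have c: "continuous_on UNIV f" "\<And>y. f y \<in> {0..1}"
    unfolding continuous_map_in_subtopology by auto
  have "f y = 1" if "y \<notin> U \<inter> V" for y using f(3) that by auto
  then show ?thesis
    using c f(2) V
    by (intro that[of "\<lambda>y. 1 - f y"] CcrI[of _ K]) (auto intro!: continuous_intros)
qed

text \<open>Each bump keeps a point \<open>s\<close> as its index, so that later sums can refer to
  the neighbourhood \<open>U s\<close> off which it vanishes.\<close>

lemma partition_of_unity:
  fixes S :: "'a::t2_space set"
  assumes lc: "locally_compact_space (euclidean :: 'a topology)" and S: "compact S"
    and U: "\<And>s. s \<in> S \<Longrightarrow> open (U s)" "\<And>s. s \<in> S \<Longrightarrow> s \<in> U s"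
  obtains F \<phi> where "finite F" "F \<subseteq> S" "\<And>s. s \<in> F \<Longrightarrow> \<phi> s \<in> Ccr"
    "\<And>s x. s \<in> F \<Longrightarrow> 0 \<le> \<phi> s x" "\<And>s x. s \<in> F \<Longrightarrow> x \<notin> U s \<Longrightarrow> \<phi> s x = 0"
    "\<And>x. (\<Sum>s\<in>F. \<phi> s x) \<le> (1::real)" "\<And>x. x \<in> S \<Longrightarrow> (\<Sum>s\<in>F. \<phi> s x) = 1"
proof -
  have "\<exists>\<psi>. \<psi> \<in> Ccr \<and> \<psi> s = 1 \<and> (\<forall>y. 0 \<le> \<psi> y) \<and> (\<forall>y. y \<notin> U s \<longrightarrow> \<psi> y = 0)" if "s \<in> S" for s
    by (rule Urysohn_point[OF lc U(1)[OF that] U(2)[OF that]]) blast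
  then obtain \<psi> where \<psi>: "\<And>s. s \<in> S \<Longrightarrow> \<psi> s \<in> Ccr" "\<And>s. s \<in> S \<Longrightarrow> \<psi> s s = 1"
    "\<And>s y. s \<in> S \<Longrightarrow> 0 \<le> \<psi> s y" "\<And>s y. s \<in> S \<Longrightarrow> y \<notin> U s \<Longrightarrow> \<psi> s y = (0::real)" by metis
  have op: "open {x. 1/2 < \<psi> s x}" if "s \<in> S" for s
    by (intro open_Collect_less continuous_on_const Ccr_continuous \<psi> that)
  have cov: "S \<subseteq> (\<Union>s\<in>S. {x. 1/2 < \<psi> s x})"
  proof
    fix s assume "s \<in> S"
    then have "s \<in> {x. 1/2 < \<psi> s x}" using \<psi>(2) by simp
    then show "s \<in> (\<Union>s\<in>S. {x. 1/2 < \<psi> s x})" using \<open>s \<in> S\<close> by blast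
  qed
  obtain F where F: "F \<subseteq> S" "finite F" "S \<subseteq> (\<Union>s\<in>F. {x. 1/2 < \<psi> s x})"
    using compactE_image[OF S op cov] by blast
  define q where "q x = (\<Sum>s\<in>F. \<psi> s x)" for x
  \<comment> \<open>The maximum with 1/2 keeps the denominator positive everywhere and changes
    nothing on \<open>S\<close>, where \<open>q\<close> is at least 1/2.\<close>
  define \<phi> where "\<phi> s x = \<psi> s x / max (q x) (1/2)" for s x
  have q0: "0 \<le> q x" for x unfolding q_def using \<psi>(3) F by (intro sum_nonneg) auto
  have qS: "1/2 \<le> q x" if "x \<in> S" for x
  proof -
    obtain s where s: "s \<in> F" "1/2 < \<psi> s x" using F(3) \<open>x \<in> S\<close> by auto
    have "\<psi> s x \<le> q x" unfolding q_def using \<psi>(3) F s by (intro member_le_sum) auto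
    then show ?thesis using s by simp
  qed
  have qc: "continuous_on UNIV q" unfolding q_def
    using \<psi>(1) F by (intro continuous_on_sum Ccr_continuous) auto
  have sum\<phi>: "(\<Sum>s\<in>F. \<phi> s x) = q x / max (q x) (1/2)" for x
    unfolding \<phi>_def sum_divide_distrib[symmetric] q_def ..
  show ?thesis
  proof (rule that[OF F(2) F(1), of \<phi>])
    fix s assume s: "s \<in> F"
    have "continuous_on UNIV (\<phi> s)" unfolding \<phi>_def
      using qc Ccr_continuous[OF \<psi>(1)] s F by (intro continuous_intros) auto
    then show "\<phi> s \<in> Ccr"
      using \<psi>(1)[of s] s F(1) by (rule_tac Ccr_dominated[of "\<psi> s"]) (auto simp: \<phi>_def)
  next
    show "(\<Sum>s\<in>F. \<phi> s x) \<le> 1" for x unfolding sum\<phi> by (simp add: divide_le_eq)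
    show "(\<Sum>s\<in>F. \<phi> s x) = 1" if "x \<in> S" for x unfolding sum\<phi> using qS[OF that] by (simp add: max_def)
  next
    fix s x assume s: "s \<in> F"
    then show "0 \<le> \<phi> s x" unfolding \<phi>_def using \<psi>(3) F(1) by (intro divide_nonneg_pos) auto
    show "x \<notin> U s \<Longrightarrow> \<phi> s x = 0" unfolding \<phi>_def using \<psi>(4)[of s x] s F(1) by auto
  qed
qed

lemma Urysohn_compact:
  fixes S :: "'a::t2_space set"
  assumes lc: "locally_compact_space (euclidean :: 'a topology)" and S: "compact S" "open U" "S \<subseteq> U"
  obtains \<phi> :: "'a \<Rightarrow> real" where "\<phi> \<in> Ccr" "\<And>x. 0 \<le> \<phi> x" "\<And>x. \<phi> x \<le> 1" "\<And>x. x \<in> S \<Longrightarrow> \<phi> x = 1" "\<And>x. x \<notin> U \<Longrightarrow> \<phi> x = 0"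
proof (rule partition_of_unity[OF lc S(1), of "\<lambda>_. U"])
  fix F and \<phi> :: "'a \<Rightarrow> 'a \<Rightarrow> real"
  assume a: "finite F" "F \<subseteq> S" "\<And>s. s \<in> F \<Longrightarrow> \<phi> s \<in> Ccr"
    "\<And>s x. s \<in> F \<Longrightarrow> 0 \<le> \<phi> s x" "\<And>s x. s \<in> F \<Longrightarrow> x \<notin> U \<Longrightarrow> \<phi> s x = 0"
    "\<And>x. (\<Sum>s\<in>F. \<phi> s x) \<le> 1" "\<And>x. x \<in> S \<Longrightarrow> (\<Sum>s\<in>F. \<phi> s x) = 1"
  show thesis
    by (rule that[of "\<lambda>x. \<Sum>s\<in>F. \<phi> s x"]) (use a in \<open>auto intro!: Ccr_sum sum_nonneg\<close>)
qed (use S in auto)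

subsection \<open>The Riesz representation theorem for bounded positive functionals\<close>

text \<open>The bound \<open>b\<close> keeps all quantities finite: the outer measure is at most
  \<open>b\<close>, and cutting a function off at height \<open>d\<close> costs at most
  \<open>d * b\<close>.\<close>

locale positive_functional =
  fixes L :: "('a::t2_space \<Rightarrow> real) \<Rightarrow> real" and b :: real
  assumes lc: "locally_compact_space (euclidean :: 'a topology)"
    and L_add: "\<And>f g. f \<in> Ccr \<Longrightarrow> g \<in> Ccr \<Longrightarrow> L (\<lambda>x. f x + g x) = L f + L g"
    and L_cmult: "\<And>f c. f \<in> Ccr \<Longrightarrow> L (\<lambda>x. c * f x) = c * L f"
    and L_nonneg: "\<And>f. f \<in> Ccr \<Longrightarrow> (\<And>x. 0 \<le> f x) \<Longrightarrow> 0 \<le> L f"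
    and L_bound: "\<And>f. f \<in> Ccr \<Longrightarrow> (\<And>x. f x \<le> 1) \<Longrightarrow> L f \<le> b"
begin

lemma L_zero: "L (\<lambda>x. 0) = 0"
  using L_cmult[OF Ccr_zero, of 0] by simp

lemma L_diff: "f \<in> Ccr \<Longrightarrow> g \<in> Ccr \<Longrightarrow> L (\<lambda>x. f x - g x) = L f - L g"
  using L_add[of f "\<lambda>x. - g x"] L_cmult[of g "-1"] Ccr_minus[of g] by simp

lemma L_mono: "f \<in> Ccr \<Longrightarrow> g \<in> Ccr \<Longrightarrow> (\<And>x. f x \<le> g x) \<Longrightarrow> L f \<le> L g"
  using L_nonneg[OF Ccr_diff[of g f]] L_diff[of g f] by simp

lemma L_sum: "(\<And>i. i \<in> I \<Longrightarrow> f i \<in> Ccr) \<Longrightarrow> L (\<lambda>x. \<Sum>i\<in>I. f i x) = (\<Sum>i\<in>I. L (f i))"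
proof (induction I rule: infinite_finite_induct)
  case (insert i I)
  then show ?case by (simp add: L_add Ccr_sum)
qed (auto simp: L_zero)

lemma b_nonneg: "0 \<le> b"
  using L_bound[OF Ccr_zero] L_zero by simp

lemma L_le:
  assumes "f \<in> Ccr" "\<And>x. f x \<le> d" "0 < d" shows "L f \<le> d * b"
proof -
  have "L (\<lambda>x. (1/d) * f x) \<le> b"
    using assms by (intro L_bound Ccr_cmult) (auto simp: divide_le_eq)
  then have "1 / d * L f \<le> b" by (simp only: L_cmult[OF assms(1)])
  then show ?thesis using assms(3) by (simp add: field_simps)
qed

text \<open>The test functions of the Riesz construction. They vanish off \<open>U\<close>, but
  their supports may touch its boundary; \<open>truncate\<close> provides the compact subset of
  \<open>U\<close> that the arguments require.\<close>

definition below :: "'a set \<Rightarrow> ('a \<Rightarrow> real) set" where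
  "below U = {f \<in> Ccr. (\<forall>x. 0 \<le> f x \<and> f x \<le> 1) \<and> (\<forall>x. x \<notin> U \<longrightarrow> f x = 0)}"

lemma belowI: "f \<in> Ccr \<Longrightarrow> (\<And>x. 0 \<le> f x) \<Longrightarrow> (\<And>x. f x \<le> 1) \<Longrightarrow> (\<And>x. x \<notin> U \<Longrightarrow> f x = 0) \<Longrightarrow> f \<in> below U"
  unfolding below_def by blast

lemma belowD:
  assumes "f \<in> below U"
  shows "f \<in> Ccr" "0 \<le> f x" "f x \<le> 1" "x \<notin> U \<Longrightarrow> f x = 0"
  using assms unfolding below_def by auto

lemma below_mono: "U \<subseteq> V \<Longrightarrow> below U \<subseteq> below V"
  unfolding below_def by blast

lemma below_zero: "(\<lambda>x. 0) \<in> below U"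
  by (intro belowI Ccr_zero) auto

text \<open>Removing the part of \<open>f\<close> below height \<open>d\<close> leaves a function
  carried by the compact set where \<open>d \<le> f\<close>. The removed part is at most
  \<open>d\<close>, so \<open>L\<close> sees at most \<open>d * b\<close> of it.\<close>

lemma truncate:
  assumes f: "f \<in> below U" and d: "0 < d"
  defines "g \<equiv> (\<lambda>x. max (f x - d) 0)"
  shows "g \<in> below U" "L f \<le> L g + d * b" "compact {x. d \<le> f x}" "{x. d \<le> f x} \<subseteq> U"
    "\<And>x. x \<notin> {x. d \<le> f x} \<Longrightarrow> g x = 0"
proof -
  note fb = belowD[OF f]
  have gC: "g \<in> Ccr" unfolding g_def
    using d by (intro Ccr_dominated[OF fb(1)] continuous_intros Ccr_continuous[OF fb(1)]) auto
  show "g \<in> below U"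
  proof (rule belowI[OF gC])
    show "g x \<le> 1" for x using fb(3)[of x] d by (simp add: g_def)
  qed (use fb(4) d in \<open>simp_all add: g_def\<close>)
  have "L (\<lambda>x. f x - g x) \<le> d * b"
    using d by (intro L_le Ccr_diff fb gC) (auto simp: g_def)
  then show "L f \<le> L g + d * b" using L_diff[OF fb(1) gC] by simp
  show "compact {x. d \<le> f x}" by (rule Ccr_compact_superlevel[OF fb(1) d])
  show "{x. d \<le> f x} \<subseteq> U" using fb(4) d by force
qed (auto simp: g_def)

definition lam :: "'a set \<Rightarrow> ennreal" where
  "lam U = (SUP f\<in>below U. ennreal (L f))"

lemma lam_upper: "f \<in> below U \<Longrightarrow> ennreal (L f) \<le> lam U"
  unfolding lam_def by (rule SUP_upper)

lemma lam_mono: "U \<subseteq> V \<Longrightarrow> lam U \<le> lam V"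
  unfolding lam_def by (intro SUP_subset_mono below_mono) auto

lemma lam_le: "lam U \<le> ennreal b"
  unfolding lam_def by (intro SUP_least ennreal_leI L_bound) (auto dest: belowD)

lemma L_below_nonneg: "f \<in> below U \<Longrightarrow> 0 \<le> L f"
  by (rule L_nonneg) (auto dest: belowD)

lemma lam_empty: "lam {} = 0"
proof -
  have "below {} = {\<lambda>x. 0}" using below_zero belowD(4) by fastforce
  then show ?thesis by (simp add: lam_def L_zero)
qed

lemma ennreal_le_approx:
  fixes x y :: ennreal
  assumes "\<And>d. 0 < d \<Longrightarrow> x \<le> y + ennreal (d * b)"
  shows "x \<le> y"
proof (rule ennreal_le_epsilon)
  fix e :: real assume e: "0 < e"
  then have "0 < e / (b + 1)" using b_nonneg by simp
  from assms[OF this] have "x \<le> y + ennreal (e / (b + 1) * b)" .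
  also have "e / (b + 1) * b \<le> e" using b_nonneg e by (simp add: field_simps)
  finally show "x \<le> y + ennreal e" by (simp add: add_left_mono ennreal_leI)
qed

text \<open>A truncated test function is carried by a compact set inside the union, and a partition
  of unity on that set distributes it among finitely many of the sets \<open>U n\<close>.\<close>

lemma lam_subadditive:
  fixes U :: "nat \<Rightarrow> 'a set"
  assumes U: "\<And>n. open (U n)"
  shows "lam (\<Union>n. U n) \<le> (\<Sum>n. lam (U n))"
  unfolding lam_def[of "\<Union>n. U n"]
proof (rule SUP_least)
  fix f assume f: "f \<in> below (\<Union>n. U n)"
  show "ennreal (L f) \<le> (\<Sum>n. lam (U n))"
  proof (rule ennreal_le_approx)
    fix d :: real assume d: "0 < d"
    define g where "g = (\<lambda>x. max (f x - d) 0)"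
    let ?K = "{x. d \<le> f x}"
    note t = truncate[OF f d, folded g_def]
    note gb = belowD[OF t(1)]
    have t5: "g x = 0" if "x \<notin> ?K" for x using that by (simp add: g_def)
    have "\<forall>s\<in>?K. \<exists>n. s \<in> U n" using t(4) by blast
    then obtain n where n: "\<And>s. s \<in> ?K \<Longrightarrow> s \<in> U (n s)" by metis
    obtain F \<phi> where F: "finite F" "F \<subseteq> ?K" "\<And>s. s \<in> F \<Longrightarrow> \<phi> s \<in> Ccr"
      "\<And>s x. s \<in> F \<Longrightarrow> 0 \<le> \<phi> s x" "\<And>s x. s \<in> F \<Longrightarrow> x \<notin> U (n s) \<Longrightarrow> \<phi> s x = 0"
      "\<And>x. (\<Sum>s\<in>F. \<phi> s x) \<le> (1::real)" "\<And>x. x \<in> ?K \<Longrightarrow> (\<Sum>s\<in>F. \<phi> s x) = 1"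
    proof (rule partition_of_unity[OF lc t(3), of "\<lambda>s. U (n s)"])
      show "open (U (n s))" for s by (rule U)
      show "s \<in> U (n s)" if "s \<in> ?K" for s by (rule n[OF that])
    qed (rule that; assumption)
    \<comment> \<open>Several points of \<open>F\<close> may use the same \<open>U k\<close>; their
      bumps are added up, so that \<open>lam (U k)\<close> is charged only once.\<close>
    define h where "h k = (\<lambda>x. \<Sum>s\<in>{s\<in>F. n s = k}. g x * \<phi> s x)" for k
    have hC: "h k \<in> Ccr" for k unfolding h_def
      using F(3) by (intro Ccr_sum Ccr_mult Ccr_continuous[OF gb(1)]) simp
    have sum_le: "(\<Sum>s\<in>{s\<in>F. n s = k}. \<phi> s x) \<le> 1" for k x
    proof -
      have "(\<Sum>s\<in>{s\<in>F. n s = k}. \<phi> s x) \<le> (\<Sum>s\<in>F. \<phi> s x)"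
        using F(4) by (intro sum_mono2[OF F(1)]) auto
      then show ?thesis using F(6)[of x] by linarith
    qed
    have h: "h k \<in> below (U k)" for k
    proof (rule belowI[OF hC])
      show "0 \<le> h k x" for x unfolding h_def using gb(2) F(4) by (intro sum_nonneg mult_nonneg_nonneg) auto
      have "h k x = g x * (\<Sum>s\<in>{s\<in>F. n s = k}. \<phi> s x)" for x unfolding h_def by (simp add: sum_distrib_left)
      moreover have "0 \<le> (\<Sum>s\<in>{s\<in>F. n s = k}. \<phi> s x)" for x using F(4) by (intro sum_nonneg) simp
      ultimately show "h k x \<le> 1" for x
        using mult_le_one[OF gb(3) _ sum_le[where k = k and x = x], of x] by simp
      show "h k x = 0" if "x \<notin> U k" for x unfolding h_def using F(5) that by (intro sum.neutral) auto
    qed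
    have "g x = (\<Sum>k\<in>n ` F. h k x)" for x
    proof -
      have "g x = g x * (\<Sum>s\<in>F. \<phi> s x)" using t5[of x] F(7)[of x] by (cases "x \<in> ?K") simp_all
      also have "\<dots> = (\<Sum>k\<in>n ` F. h k x)"
        unfolding h_def by (simp add: sum_distrib_left sum.image_gen[OF F(1), of _ n])
      finally show ?thesis .
    qed
    then have "g = (\<lambda>x. \<Sum>k\<in>n ` F. h k x)" by (rule ext)
    then have "L g = (\<Sum>k\<in>n ` F. L (h k))" using L_sum[of "n ` F" h] hC by simp
    then have "ennreal (L g) = (\<Sum>k\<in>n ` F. ennreal (L (h k)))"
      using L_below_nonneg[OF h] by simp
    also have "\<dots> \<le> (\<Sum>k\<in>n ` F. lam (U k))" by (intro sum_mono lam_upper h)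
    also have "\<dots> \<le> (\<Sum>k. lam (U k))" using F(1) by (intro sum_le_suminf) auto
    finally have "ennreal (L g) \<le> (\<Sum>k. lam (U k))" .
    moreover have "ennreal (L f) \<le> ennreal (L g) + ennreal (d * b)"
      using t(2) L_below_nonneg[OF t(1)] d b_nonneg
      by (simp add: ennreal_plus[symmetric] ennreal_leI del: ennreal_plus)
    ultimately show "ennreal (L f) \<le> (\<Sum>n. lam (U n)) + ennreal (d * b)"
      by (meson add_right_mono order_trans)
  qed
qed

definition mu :: "'a set \<Rightarrow> ennreal" where
  "mu E = (INF U\<in>{U. open U \<and> E \<subseteq> U}. lam U)"

lemma mu_lower: "open U \<Longrightarrow> E \<subseteq> U \<Longrightarrow> mu E \<le> lam U"
  unfolding mu_def by (intro INF_lower) auto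

lemma mu_mono: "A \<subseteq> B \<Longrightarrow> mu A \<le> mu B"
  unfolding mu_def by (intro INF_superset_mono) auto

lemma mu_open: "open U \<Longrightarrow> mu U = lam U"
  by (intro antisym mu_lower) (auto simp: mu_def intro!: INF_greatest lam_mono)

lemma mu_le: "mu E \<le> ennreal b"
  using order_trans[OF mu_lower[of UNIV E] lam_le] by simp

lemma mu_approx:
  assumes "0 < e" obtains U where "open U" "E \<subseteq> U" "lam U \<le> mu E + ennreal e"
proof -
  have "mu E < top" using mu_le[of E] by (simp add: order_le_less_trans)
  then have "mu E < mu E + ennreal e" using assms by (cases "mu E") (auto simp: ennreal_plus[symmetric] ennreal_less_iff simp del: ennreal_plus)
  then obtain U where "open U" "E \<subseteq> U" "lam U < mu E + ennreal e"
    unfolding mu_def INF_less_iff by auto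
  then show ?thesis using that less_imp_le by blast
qed

lemma mu_subadditive: "mu (\<Union>n::nat. A n) \<le> (\<Sum>n. mu (A n))"
proof (rule ennreal_le_epsilon)
  fix e :: real assume e: "0 < e"
  have "\<exists>U. open U \<and> A n \<subseteq> U \<and> lam U \<le> mu (A n) + ennreal (e * (1/2)^Suc n)" for n
    by (rule mu_approx[of "e * (1/2)^Suc n" "A n"]) (use e in auto)
  then obtain U where U: "\<And>n. open (U n)" "\<And>n. A n \<subseteq> U n" "\<And>n. lam (U n) \<le> mu (A n) + ennreal (e * (1/2)^Suc n)"
    by metis
  have "mu (\<Union>n. A n) \<le> lam (\<Union>n. U n)" using U(1,2) by (intro mu_lower) auto
  also have "\<dots> \<le> (\<Sum>n. lam (U n))" by (rule lam_subadditive[OF U(1)])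
  also have "\<dots> \<le> (\<Sum>n. mu (A n) + ennreal (e * (1/2)^Suc n))" by (intro suminf_le U(3)) auto
  also have "\<dots> = (\<Sum>n. mu (A n)) + (\<Sum>n. ennreal (e * (1/2)^Suc n))" by (rule suminf_add[symmetric]) auto
  also have "(\<Sum>n. ennreal (e * (1/2)^Suc n)) = ennreal e"
  proof -
    have s: "(\<lambda>n. e * (1/2)^Suc n) sums (e * 1)" by (rule sums_mult[OF power_half_series])
    have "0 \<le> e * (1/2)^Suc n" for n using e by simp
    from suminf_ennreal_eq[OF this s] show ?thesis by (simp only: mult_1_right)
  qed
  finally show "mu (\<Union>n. A n) \<le> (\<Sum>n. mu (A n)) + ennreal e" .
qed

lemma mu_empty: "mu {} = 0"
  using mu_open[of "{}"] lam_empty by simp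

lemma outer_measure_space_mu: "outer_measure_space (Pow UNIV) mu"
  unfolding outer_measure_space_def positive_def increasing_def countably_subadditive_def
  using mu_mono mu_subadditive mu_empty by auto

text \<open>After \<open>E\<close> is enlarged to an open \<open>V\<close>, a test function on
  \<open>U \<inter> V\<close> is truncated to have a compact carrier \<open>?K\<close>. A test
  function on \<open>V - ?K\<close>, a set that contains the part of \<open>V\<close> outside
  \<open>U\<close>, can be added to it without leaving \<open>below V\<close>.\<close>

lemma open_caratheodory:
  assumes U: "open U" shows "mu (U \<inter> E) + mu (- U \<inter> E) \<le> mu E"
proof (rule ennreal_le_epsilon)
  fix e :: real assume "0 < e"
  then obtain V where V: "open V" "E \<subseteq> V" "lam V \<le> mu E + ennreal e" by (rule mu_approx)
  have "lam (U \<inter> V) + mu (- U \<inter> V) \<le> lam V"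
  proof -
    have "ennreal (L f) + mu (- U \<inter> V) \<le> lam V" if f: "f \<in> below (U \<inter> V)" for f
    proof (rule ennreal_le_approx)
      fix d :: real assume d: "0 < d"
      define g where "g = (\<lambda>x. max (f x - d) 0)"
      let ?K = "{x. d \<le> f x}"
      note t = truncate[OF f d, folded g_def]
      note gb = belowD[OF t(1)]
      have W: "open (V - ?K)" using V(1) compact_imp_closed[OF t(3)] by (rule open_Diff)
      have "ennreal (L f) + ennreal (L h) \<le> lam V + ennreal (d * b)" if h: "h \<in> below (V - ?K)" for h
      proof -
        note hb = belowD[OF h]
        have "(\<lambda>x. g x + h x) \<in> below V"
        proof (rule belowI)
          show "(\<lambda>x. g x + h x) \<in> Ccr" by (intro Ccr_add gb hb)
          show "0 \<le> g x + h x" for x using gb(2) hb(2) by (simp add: add_nonneg_nonneg)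
          \<comment> \<open>On \<open>?K\<close> the function \<open>h\<close> vanishes, off
            \<open>?K\<close> the function \<open>g\<close> does.\<close>
          show "g x + h x \<le> 1" for x
            using gb(3)[of x] hb(3)[of x] hb(4)[of x] by (cases "x \<in> ?K") (auto simp: g_def)
          show "g x + h x = 0" if "x \<notin> V" for x
            using gb(4)[of x] hb(4)[of x] that by auto
        qed
        then have "ennreal (L g + L h) \<le> lam V" using lam_upper L_add[OF gb(1) hb(1)] by metis
        then have "ennreal (L g + L h) + ennreal (d * b) \<le> lam V + ennreal (d * b)" by (rule add_right_mono)
        moreover have "ennreal (L f) + ennreal (L h) \<le> ennreal (L g + L h) + ennreal (d * b)"
          using t(2) L_below_nonneg[OF f] L_below_nonneg[OF t(1)] L_below_nonneg[OF h] d b_nonneg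
          by (simp add: ennreal_plus[symmetric] ennreal_leI del: ennreal_plus)
        ultimately show ?thesis by (rule order_trans[rotated])
      qed
      then have "(SUP h\<in>below (V - ?K). ennreal (L f) + ennreal (L h)) \<le> lam V + ennreal (d * b)"
        by (rule SUP_least)
      moreover have "below (V - ?K) \<noteq> {}" using below_zero by blast
      ultimately have "ennreal (L f) + lam (V - ?K) \<le> lam V + ennreal (d * b)"
        unfolding lam_def by (simp add: ennreal_SUP_add_right)
      moreover have "mu (- U \<inter> V) \<le> lam (V - ?K)"
        using t(4) by (intro mu_lower W) auto
      ultimately show "ennreal (L f) + mu (- U \<inter> V) \<le> lam V + ennreal (d * b)"
        by (meson add_left_mono order_trans)
    qed
    then have "(SUP f\<in>below (U \<inter> V). ennreal (L f) + mu (- U \<inter> V)) \<le> lam V" by (rule SUP_least)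
    moreover have "below (U \<inter> V) \<noteq> {}" using below_zero by blast
    ultimately show ?thesis unfolding lam_def by (simp add: ennreal_SUP_add_left)
  qed
  moreover have "mu (U \<inter> E) \<le> lam (U \<inter> V)" using U V by (intro mu_lower) auto
  moreover have "mu (- U \<inter> E) \<le> mu (- U \<inter> V)" using V by (intro mu_mono) auto
  ultimately show "mu (U \<inter> E) + mu (- U \<inter> E) \<le> mu E + ennreal e"
    using V(3) by (meson add_mono order_trans)
qed

text \<open>Caratheodory's theorem makes \<open>mu\<close> a measure on the sets that split every
  set additively; these contain the open sets, hence all Borel sets.\<close>

lemma measure_space_mu: "measure_space UNIV (sets borel) mu"
proof -
  let ?S = "lambda_system UNIV (Pow UNIV) mu"
  have ms: "measure_space UNIV ?S mu"
    by (rule sigma_algebra.caratheodory_lemma[OF sigma_algebra_Pow outer_measure_space_mu])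
  then have sa: "sigma_algebra UNIV ?S" unfolding measure_space_def by simp
  have op: "U \<in> ?S" if U: "open U" for U
  proof -
    have "mu E \<le> mu (U \<inter> E) + mu (- U \<inter> E)" for E
    proof -
      have "mu (\<Union>n. binaryset (U \<inter> E) (- U \<inter> E) n) \<le> (\<Sum>n. mu (binaryset (U \<inter> E) (- U \<inter> E) n))"
        by (rule mu_subadditive)
      also have "\<dots> = mu (U \<inter> E) + mu (- U \<inter> E)" by (rule suminf_binaryset_eq) (rule mu_empty)
      also have "(\<Union>n. binaryset (U \<inter> E) (- U \<inter> E) n) = E" by (auto simp: UN_binaryset_eq)
      finally show ?thesis .
    qed
    then show ?thesis using open_caratheodory[OF U]
      unfolding lambda_system_def Compl_eq_Diff_UNIV by (auto intro: antisym)
  qed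
  have "sets borel \<subseteq> ?S" unfolding borel_def
    using sigma_algebra.sigma_sets_subset[OF sa, of "{S. open S}"] op by (auto simp: sets_measure_of)
  then show ?thesis
    using measure_down[OF ms] sets.sigma_algebra_axioms[of "borel :: 'a measure"] by simp
qed

definition riesz :: "'a measure" where "riesz = measure_of UNIV (sets borel) mu"

lemma sets_riesz [simp, measurable_cong]: "sets riesz = sets borel"
  and space_riesz [simp]: "space riesz = UNIV"
  using sets.sigma_sets_eq[of "borel::'a measure"] unfolding riesz_def by auto

lemma emeasure_riesz: "E \<in> sets borel \<Longrightarrow> emeasure riesz E = mu E"
  unfolding riesz_def using measure_space_mu
  by (intro emeasure_measure_of_sigma) (auto simp: measure_space_def)

lemma finite_measure_riesz: "finite_measure riesz"
  using mu_le[of UNIV] by (intro finite_measureI) (auto simp: emeasure_riesz top_unique)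

text \<open>Outer approximations \<open>U\<close> of \<open>E\<close> and \<open>W\<close> of its
  complement, with a compact \<open>K\<close> that carries almost all mass, give the compact set
  \<open>K - W\<close>. Each of the three errors is at most \<open>e/3\<close>.\<close>

lemma riesz_regular:
  assumes E: "E \<in> sets borel" and e: "0 < e"
  shows "\<exists>K U. compact K \<and> open U \<and> K \<subseteq> E \<and> E \<subseteq> U \<and> measure riesz (U - K) \<le> e"
proof -
  interpret finite_measure riesz by (rule finite_measure_riesz)
  let ?m = "measure riesz"
  have em: "mu A = ennreal (?m A)" if "A \<in> sets borel" for A
    using emeasure_riesz[OF that] emeasure_eq_measure[of A] by simp
  have outer: "\<exists>U. open U \<and> A \<subseteq> U \<and> ?m (U - A) \<le> e / 3" if A: "A \<in> sets borel" for A
  proof -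
    obtain U where U: "open U" "A \<subseteq> U" "lam U \<le> mu A + ennreal (e/3)"
      by (rule mu_approx[of "e/3" A]) (use e in auto)
    have "lam U = ennreal (?m U)" using em[of U] mu_open[OF U(1)] U(1) by simp
    then have "ennreal (?m U) \<le> ennreal (?m A + e/3)"
      using U(3) e unfolding em[OF A] by (simp add: ennreal_plus)
    then have "?m U \<le> ?m A + e/3" using e by (subst (asm) ennreal_le_iff) (simp_all add: add_nonneg_nonneg)
    then have "?m (U - A) \<le> e/3" using U A by (subst finite_measure_Diff) auto
    then show ?thesis using U by blast
  qed
  obtain U where U: "open U" "E \<subseteq> U" "?m (U - E) \<le> e/3" using outer[OF E] by blast
  obtain W where W: "open W" "- E \<subseteq> W" "?m (W - (- E)) \<le> e/3" using outer[of "- E"] E by auto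
  obtain K where K: "compact K" "?m (- K) \<le> e/3"
  proof -
    have "\<exists>f\<in>below UNIV. lam UNIV \<le> ennreal (L f) + ennreal (e/3)"
      unfolding lam_def
    proof (rule ennreal_SUP_approx)
      show "below UNIV \<noteq> {}" using below_zero by blast
      show "(SUP f\<in>below UNIV. ennreal (L f)) < top"
        using lam_le[of UNIV] unfolding lam_def by (simp add: order_le_less_trans)
    qed (use e in simp)
    then obtain f where f: "f \<in> below UNIV" "lam UNIV \<le> ennreal (L f) + ennreal (e/3)" by blast
    note fb = belowD[OF f(1)]
    obtain K where K: "compact K" "\<And>x. x \<notin> K \<Longrightarrow> f x = 0" using CcrE[OF fb(1)] by blast
    have Ko: "open (- K)" using compact_imp_closed[OF K(1)] by (simp add: open_Compl)
    \<comment> \<open>\<open>L f\<close> is within \<open>e/3\<close> of the total mass, and a test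
      function on \<open>- K\<close> can be added to \<open>f\<close>, so it can only use up the
      remainder.\<close>
    have "lam (- K) \<le> ennreal (e/3)" unfolding lam_def
    proof (rule SUP_least)
      fix g assume g: "g \<in> below (- K)"
      note gb = belowD[OF g]
      have "(\<lambda>x. f x + g x) \<in> below UNIV"
      proof (rule belowI)
        show "f x + g x \<le> 1" for x
          using fb(3)[of x] gb(3)[of x] K(2)[of x] gb(4)[of x] by (cases "x \<in> K") auto
      qed (use fb gb in \<open>auto intro: Ccr_add\<close>)
      then have "ennreal (L f + L g) \<le> lam UNIV" using lam_upper L_add[OF fb(1) gb(1)] by metis
      also note f(2)
      finally have "ennreal (L f + L g) \<le> ennreal (L f + e/3)"
        using L_below_nonneg[OF f(1)] e by (simp add: ennreal_plus)
      then have "L f + L g \<le> L f + e/3"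
        using L_below_nonneg[OF f(1)] e by (subst (asm) ennreal_le_iff) (simp_all add: add_nonneg_nonneg)
      then show "ennreal (L g) \<le> ennreal (e/3)" by (intro ennreal_leI) simp
    qed
    then have "?m (- K) \<le> e/3" using em[of "- K"] mu_open[OF Ko] Ko e by (simp add: ennreal_le_iff)
    then show ?thesis using that K(1) by blast
  qed
  have B: "U \<in> sets borel" "W \<in> sets borel" "K \<in> sets borel" using U W K by (auto intro: borel_compact)
  have "?m (U - (K - W)) \<le> ?m ((U - E) \<union> ((W - (- E)) \<union> - K))"
    using E B U(2) W(2) by (intro finite_measure_mono) auto
  also have "\<dots> \<le> ?m (U - E) + ?m ((W - (- E)) \<union> - K)"
    using E B by (intro measure_Un_le) auto
  also have "\<dots> \<le> ?m (U - E) + (?m (W - (- E)) + ?m (- K))"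
    using E B by (intro add_left_mono measure_Un_le) auto
  also have "\<dots> \<le> e" using U(3) W(3) K(2) by simp
  finally have "?m (U - (K - W)) \<le> e" .
  moreover have "compact (K - W)" using K(1) W(1) by (rule compact_diff)
  moreover have "K - W \<subseteq> E" using W(2) by blast
  ultimately show ?thesis using U by blast
qed

text \<open>\<open>f\<close> is cut into \<open>Suc n\<close> horizontal slices of equal height. The
  functional and the integral of a slice both lie between the measures of two consecutive superlevel
  sets, and these gaps telescope.\<close>

lemma integral_riesz_unit:
  assumes f: "f \<in> Ccr" "\<And>x. 0 \<le> f x" "\<And>x. f x \<le> 1"
  shows "L f = integral\<^sup>L riesz f"
proof -
  interpret finite_measure riesz by (rule finite_measure_riesz)
  let ?m = "measure riesz"
  have int: "integrable riesz g" if "g \<in> Ccr" for g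
    by (rule bdd_borel_integrable[OF finite_measure_riesz sets_riesz Ccr_bdd_borel[OF that]])
  have em: "lam A = ennreal (?m A)" if "open A" for A
    using emeasure_riesz[of A] emeasure_eq_measure[of A] mu_open[OF that] that by simp
  have up: "L g \<le> ?m U" if "open U" "g \<in> below U" for g U
    using lam_upper[OF that(2)] em[OF that(1)] L_below_nonneg[OF that(2)] by (simp add: ennreal_le_iff)
  have lo: "?m U \<le> L g" if "open U" "g \<in> Ccr" "\<And>x. 0 \<le> g x" "\<And>x. x \<in> U \<Longrightarrow> 1 \<le> g x" for g U
  proof -
    have "lam U \<le> ennreal (L g)" unfolding lam_def
    proof (intro SUP_least ennreal_leI L_mono)
      fix h x assume h: "h \<in> below U"
      show "h x \<le> g x"
        using belowD(3)[OF h, of x] belowD(4)[OF h, of x] that(3)[of x] that(4)[of x]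
        by (cases "x \<in> U") auto
    qed (use that belowD in auto)
    then show ?thesis using em[OF that(1)] L_nonneg[OF that(2,3)] by (simp add: ennreal_le_iff)
  qed
  have "\<bar>L f - integral\<^sup>L riesz f\<bar> \<le> ?m UNIV * (1 / real (Suc n))" for n
  proof -
    let ?N = "real (Suc n)"
    define U where "U i = {x. real i / ?N < f x}" for i
    have U: "open (U i)" for i unfolding U_def
      by (intro open_Collect_less continuous_on_const Ccr_continuous f)
    \<comment> \<open>The \<open>i\<close>-th slice, rescaled to height 1: zero off
      \<open>U i\<close> and one on \<open>U (Suc i)\<close>.\<close>
    define h where "h i x = min (max (?N * f x - real i) 0) 1" for i x
    have h: "h i \<in> Ccr" for i
      unfolding h_def by (intro Ccr_dominated[OF f(1)] continuous_intros Ccr_continuous[OF f(1)]) auto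
    have h01: "0 \<le> h i x" "h i x \<le> 1" for i x by (auto simp: h_def)
    have hU: "h i x = 0" if "x \<notin> U i" for i x
      using that by (simp add: U_def h_def not_less field_simps)
    have hU': "h i x = 1" if "x \<in> U (Suc i)" for i x
      using that by (simp add: U_def h_def field_simps)
    have sum_h: "(\<Sum>i<k. h i x) = min (?N * f x) (real k)" for k x
    proof (induction k)
      case 0 then show ?case using f(2)[of x] by simp
    next
      case (Suc k) then show ?case by (simp add: h_def min_def max_def)
    qed
    have f_eq: "f x = (1 / ?N) * (\<Sum>i<Suc n. h i x)" for x
    proof -
      have "?N * f x \<le> ?N * 1" using f(3)[of x] by (intro mult_left_mono) auto
      then show ?thesis unfolding sum_h by (simp add: min_def)
    qed
    have "L f = L (\<lambda>x. (1 / ?N) * (\<Sum>i<Suc n. h i x))" using f_eq by presburger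
    also have "\<dots> = (1 / ?N) * (\<Sum>i<Suc n. L (h i))"
      by (simp only: L_cmult[OF Ccr_sum[OF h]] L_sum[OF h])
    finally have Lf: "L f = (1 / ?N) * (\<Sum>i<Suc n. L (h i))" .
    have "integral\<^sup>L riesz f = integral\<^sup>L riesz (\<lambda>x. (1 / ?N) * (\<Sum>i<Suc n. h i x))" using f_eq by presburger
    also have "\<dots> = (1 / ?N) * (\<Sum>i<Suc n. integral\<^sup>L riesz (h i))"
      using int[OF h] by (simp only: integral_mult_right_zero Bochner_Integration.integral_sum)
    finally have If: "integral\<^sup>L riesz f = (1 / ?N) * (\<Sum>i<Suc n. integral\<^sup>L riesz (h i))" .
    have ind: "integrable riesz (indicator (U i) :: 'a \<Rightarrow> real)" "integral\<^sup>L riesz (indicator (U i)) = ?m (U i)" for i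
      using U[of i] by (auto simp: integrable_indicator_iff emeasure_eq_measure)
    have "\<bar>L (h i) - integral\<^sup>L riesz (h i)\<bar> \<le> ?m (U i) - ?m (U (Suc i))" for i
    proof -
      have "L (h i) \<le> ?m (U i)" using h h01 hU by (intro up U belowI) auto
      moreover have "?m (U (Suc i)) \<le> L (h i)" using h01 hU' by (intro lo U h) auto
      moreover have "integral\<^sup>L riesz (h i) \<le> integral\<^sup>L riesz (indicator (U i))"
        using h01 hU by (intro integral_mono int h ind) (auto simp: indicator_def)
      moreover have "integral\<^sup>L riesz (indicator (U (Suc i))) \<le> integral\<^sup>L riesz (h i)"
        using h01 hU' by (intro integral_mono int h ind) (auto simp: indicator_def)
      ultimately show ?thesis unfolding ind by linarith
    qed
    then have "(\<Sum>i<Suc n. \<bar>L (h i) - integral\<^sup>L riesz (h i)\<bar>) \<le> (\<Sum>i<Suc n. ?m (U i) - ?m (U (Suc i)))"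
      by (intro sum_mono) blast
    also have "\<dots> = ?m (U 0) - ?m (U (Suc n))" by (rule sum_lessThan_telescope')
    also have "\<dots> \<le> ?m UNIV"
    proof -
      have "?m (U 0) \<le> ?m UNIV" by (rule finite_measure_mono) auto
      then show ?thesis using measure_nonneg[of riesz "U (Suc n)"] by linarith
    qed
    finally have s: "(\<Sum>i<Suc n. \<bar>L (h i) - integral\<^sup>L riesz (h i)\<bar>) \<le> ?m UNIV" .
    have "L f - integral\<^sup>L riesz f = (1 / ?N) * (\<Sum>i<Suc n. L (h i) - integral\<^sup>L riesz (h i))"
      unfolding Lf If by (simp only: sum_subtractf right_diff_distrib)
    then have "\<bar>L f - integral\<^sup>L riesz f\<bar> = (1 / ?N) * \<bar>\<Sum>i<Suc n. L (h i) - integral\<^sup>L riesz (h i)\<bar>"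
      by (simp only: abs_mult abs_of_nonneg[of "1 / ?N"] of_nat_0_le_iff zero_le_divide_1_iff)
    also have "\<dots> \<le> (1 / ?N) * ?m UNIV"
      using order_trans[OF sum_abs s] by (intro mult_left_mono) auto
    finally show ?thesis by (simp only: mult.commute)
  qed
  then have "L f - integral\<^sup>L riesz f = 0" by (rule zero_if_abs_le_inverse)
  then show ?thesis by simp
qed

lemma integral_riesz:
  assumes f: "f \<in> Ccr" shows "L f = integral\<^sup>L riesz f"
proof -
  interpret finite_measure riesz by (rule finite_measure_riesz)
  have int: "integrable riesz g" if "g \<in> Ccr" for g
    by (rule bdd_borel_integrable[OF finite_measure_riesz sets_riesz Ccr_bdd_borel[OF that]])
  have nn: "L g = integral\<^sup>L riesz g" if g: "g \<in> Ccr" "\<And>x. 0 \<le> g x" for g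
  proof -
    obtain B where B: "0 \<le> B" "\<And>x. \<bar>g x\<bar> \<le> B" using Ccr_bounded[OF g(1)] by blast
    \<comment> \<open>Dividing by \<open>B + 1\<close> brings \<open>g\<close> into the unit range
      even if \<open>B = 0\<close>.\<close>
    have gB: "g x \<le> B + 1" for x using B(2)[of x] by simp
    have "L (\<lambda>x. (1 / (B + 1)) * g x) = integral\<^sup>L riesz (\<lambda>x. (1 / (B + 1)) * g x)"
      using g B(1) gB by (intro integral_riesz_unit Ccr_cmult) (auto simp: divide_le_eq)
    then have "(1 / (B + 1)) * L g = (1 / (B + 1)) * integral\<^sup>L riesz g"
      by (simp only: L_cmult[OF g(1)] integral_mult_right_zero)
    then show ?thesis using B(1) by simp
  qed
  have p: "(\<lambda>x. max (f x) 0) \<in> Ccr" "(\<lambda>x. max (- f x) 0) \<in> Ccr"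
    by (intro Ccr_dominated[OF f] continuous_intros Ccr_continuous[OF f]; simp)+
  have "f = (\<lambda>x. max (f x) 0 - max (- f x) 0)" by (auto simp: max_def)
  then have "L f = L (\<lambda>x. max (f x) 0 - max (- f x) 0)" by (rule arg_cong)
  also have "\<dots> = (LINT x|riesz. max (f x) 0) - (LINT x|riesz. max (- f x) 0)"
    unfolding L_diff[OF p] by (intro arg_cong2[of _ _ _ _ "(-)"] nn p) auto
  also have "\<dots> = (LINT x|riesz. max (f x) 0 - max (- f x) 0)"
    by (rule Bochner_Integration.integral_diff[symmetric]; rule int; rule p)
  also have "\<dots> = integral\<^sup>L riesz f" by (rule Bochner_Integration.integral_cong) auto
  finally show ?thesis .
qed

end

theorem Riesz_representation:
  fixes L :: "('a::t2_space \<Rightarrow> real) \<Rightarrow> real"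
  assumes "positive_functional L b"
  obtains s where "bounded_regular_measure s" "nonnegative_measure s" "\<And>f. f \<in> Ccr \<Longrightarrow> sint s f = L f"
proof -
  interpret positive_functional L b by (rule assms)
  interpret finite_measure riesz by (rule finite_measure_riesz)
  let ?s = "measure riesz"
  have breg: "bounded_regular_measure ?s"
  proof (rule bounded_regular_measureI)
    show "real_borel_measure ?s" unfolding real_borel_measure_def
      using finite_measure_UNION by simp
    show "\<bar>?s E\<bar> \<le> ?s UNIV" if "E \<in> sets borel" for E
      using finite_measure_mono[of E UNIV] by simp
    fix E :: "'a set" and e :: real assume "E \<in> sets borel" "0 < e"
    then obtain K U where KU: "compact K" "open U" "K \<subseteq> E" "E \<subseteq> U" "?s (U - K) \<le> e"
      using riesz_regular by metis
    have "U - K \<in> sets riesz" using KU by (auto intro: borel_compact sets.Diff)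
    then have "\<bar>?s B\<bar> \<le> e" if "B \<in> sets borel" "B \<subseteq> U - K" for B
      using finite_measure_mono[of B "U - K"] that KU by simp
    then show "\<exists>K U. compact K \<and> open U \<and> K \<subseteq> E \<and> E \<subseteq> U \<and>
      (\<forall>B \<in> sets borel. B \<subseteq> U - K \<longrightarrow> \<bar>?s B\<bar> \<le> e)" using KU by blast
  qed
  show ?thesis
  proof (rule that[OF breg])
    show "nonnegative_measure ?s" by (simp add: nonnegative_measure_def)
    show "sint ?s f = L f" if "f \<in> Ccr" for f
      unfolding integral_riesz[OF that]
      by (rule sint_eq_integral[OF bounded_regular_measureD[OF breg] finite_measure_riesz sets_riesz refl
        Ccr_bdd_borel[OF that]])
  qed
qed

subsection \<open>The Hahn--Banach theorem\<close>

definition sublinear :: "('v::real_vector \<Rightarrow> real) \<Rightarrow> bool" where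
  "sublinear p \<longleftrightarrow> (\<forall>x y. p (x + y) \<le> p x + p y) \<and> (\<forall>t x. 0 < t \<longrightarrow> p (t *\<^sub>R x) = t * p x)"

text \<open>Homogeneity as an inequality is enough: the reverse comes from the same inequality for
  \<open>1/t\<close>.\<close>

lemma sublinearI:
  assumes "\<And>x y. p (x + y) \<le> p x + p y" "\<And>t x. 0 < t \<Longrightarrow> p (t *\<^sub>R x) \<le> t * p x"
  shows "sublinear p"
proof -
  have "t * p x \<le> p (t *\<^sub>R x)" if "0 < t" for t x
  proof -
    have "p ((1/t) *\<^sub>R (t *\<^sub>R x)) \<le> (1/t) * p (t *\<^sub>R x)" using that by (intro assms) simp
    then show ?thesis using that by (simp add: field_simps)
  qed
  then show ?thesis unfolding sublinear_def using assms by (meson antisym)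
qed

lemma sublinear_add: "sublinear p \<Longrightarrow> p (x + y) \<le> p x + p y"
  unfolding sublinear_def by blast

lemma sublinear_scale: "sublinear p \<Longrightarrow> 0 < t \<Longrightarrow> p (t *\<^sub>R x) = t * p x"
  unfolding sublinear_def by blast

lemma sublinear_zero: "sublinear p \<Longrightarrow> p 0 = 0"
  using sublinear_scale[of p 2 0] by simp

lemma sublinear_minus: "sublinear p \<Longrightarrow> - p (- x) \<le> p x"
  using sublinear_add[of p x "- x"] sublinear_zero[of p] by simp

text \<open>The infimum is finite since \<open>p x\<close> is at least \<open>- p (- x)\<close>,
  hence at least \<open>- q (- x)\<close>. Subadditivity needs the chain: two members are replaced
  by the smaller one.\<close>

lemma sublinear_chain_Inf:
  fixes C :: "('v::real_vector \<Rightarrow> real) set"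
  assumes ne: "C \<noteq> {}" and C: "\<And>p. p \<in> C \<Longrightarrow> sublinear p \<and> p \<le> q"
    and chain: "\<And>p p'. p \<in> C \<Longrightarrow> p' \<in> C \<Longrightarrow> p \<le> p' \<or> p' \<le> p"
  shows "sublinear (\<lambda>x. INF p\<in>C. p x)" "\<And>p. p \<in> C \<Longrightarrow> (\<lambda>x. INF p\<in>C. p x) \<le> p"
proof -
  let ?u = "\<lambda>x. INF p\<in>C. p x"
  have bdd: "bdd_below ((\<lambda>p. p x) ` C)" for x
  proof (rule bdd_belowI2)
    fix p assume p: "p \<in> C"
    have "- q (- x) \<le> - p (- x)" using C[OF p] by (simp add: le_fun_def)
    also have "\<dots> \<le> p x" using C[OF p] sublinear_minus by blast
    finally show "- q (- x) \<le> p x" .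
  qed
  have lower: "?u x \<le> p x" if "p \<in> C" for p x by (rule cINF_lower[OF bdd that])
  then show "?u \<le> p" if "p \<in> C" for p using that by (simp add: le_fun_def)
  show "sublinear ?u"
  proof (rule sublinearI)
    fix x y
    have 1: "?u (x + y) \<le> p1 x + p2 y" if p: "p1 \<in> C" "p2 \<in> C" for p1 p2
    proof -
      obtain p where p': "p \<in> C" "p \<le> p1" "p \<le> p2" using chain[OF p] p by blast
      have "?u (x + y) \<le> p (x + y)" by (rule lower[OF p'(1)])
      also have "\<dots> \<le> p x + p y" using C[OF p'(1)] sublinear_add by blast
      also have "\<dots> \<le> p1 x + p2 y" using p'(2,3) by (simp add: le_fun_def add_mono)
      finally show ?thesis .
    qed
    have "?u (x + y) - p1 x \<le> ?u y" if "p1 \<in> C" for p1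
      using 1[OF that] by (intro cINF_greatest ne) (simp add: algebra_simps)
    then have "?u (x + y) - ?u y \<le> p1 x" if "p1 \<in> C" for p1 using that by (simp add: algebra_simps)
    then have "?u (x + y) - ?u y \<le> ?u x" by (intro cINF_greatest ne)
    then show "?u (x + y) \<le> ?u x + ?u y" by simp
  next
    fix t :: real and x assume t: "0 < t"
    have "?u (t *\<^sub>R x) / t \<le> p x" if "p \<in> C" for p
      using lower[OF that, of "t *\<^sub>R x"] C[OF that] t by (simp add: sublinear_scale divide_le_eq mult.commute)
    then have "?u (t *\<^sub>R x) / t \<le> ?u x" by (intro cINF_greatest ne)
    then show "?u (t *\<^sub>R x) \<le> t * ?u x" using t by (simp add: divide_le_eq mult.commute)
  qed
qed

text \<open>Lowering \<open>p\<close> along the ray of \<open>y\<close> gives a sublinear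
  functional, the infimum over \<open>t \<ge> 0\<close> of
  \<open>p (x + t *\<^sub>R y) - t * p y\<close>. Minimality makes it equal to \<open>p\<close>, and
  \<open>t = 1\<close> is the claim.\<close>

lemma minimal_sublinear_superadditive:
  fixes p :: "'v::real_vector \<Rightarrow> real"
  assumes p: "sublinear p" and min: "\<And>p'. sublinear p' \<Longrightarrow> p' \<le> p \<Longrightarrow> p' = p"
  shows "p x + p y \<le> p (x + y)"
proof -
  define p' where "p' x = (INF t\<in>{0..}. p (x + t *\<^sub>R y) - t * p y)" for x
  have sc: "p (t *\<^sub>R y) = t * p y" if "0 \<le> t" for t
    using that sublinear_scale[OF p, of t y] sublinear_zero[OF p] by (cases "t = 0") auto
  have bdd: "bdd_below ((\<lambda>t. p (x + t *\<^sub>R y) - t * p y) ` {0..})" for x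
  proof (rule bdd_belowI2)
    fix t :: real assume "t \<in> {0..}"
    then have "t * p y = p (- x + (x + t *\<^sub>R y))" by (simp add: sc)
    also have "\<dots> \<le> p (- x) + p (x + t *\<^sub>R y)" by (rule sublinear_add[OF p])
    finally show "- p (- x) \<le> p (x + t *\<^sub>R y) - t * p y" by simp
  qed
  have lower: "p' x \<le> p (x + t *\<^sub>R y) - t * p y" if "0 \<le> t" for x t
    unfolding p'_def using that by (intro cINF_lower[OF bdd]) simp
  have "sublinear p'"
  proof (rule sublinearI)
    fix a b
    have 1: "p' (a + b) \<le> (p (a + s *\<^sub>R y) - s * p y) + (p (b + t *\<^sub>R y) - t * p y)" if "0 \<le> s" "0 \<le> t" for s t
    proof -
      have "p' (a + b) \<le> p ((a + s *\<^sub>R y) + (b + t *\<^sub>R y)) - (s + t) * p y"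
        using lower[of "s + t" "a + b"] that by (simp add: algebra_simps)
      also have "p ((a + s *\<^sub>R y) + (b + t *\<^sub>R y)) \<le> p (a + s *\<^sub>R y) + p (b + t *\<^sub>R y)"
        by (rule sublinear_add[OF p])
      finally show ?thesis by (simp add: algebra_simps)
    qed
    have "p' (a + b) - (p (a + s *\<^sub>R y) - s * p y) \<le> p' b" if "0 \<le> s" for s
      unfolding p'_def[of b] using 1[OF that] by (intro cINF_greatest) (auto simp: algebra_simps)
    then have "p' (a + b) - p' b \<le> p' a"
      unfolding p'_def[of a] by (intro cINF_greatest) (auto simp: algebra_simps)
    then show "p' (a + b) \<le> p' a + p' b" by simp
  next
    fix s :: real and x assume s: "0 < s"
    have "p' (s *\<^sub>R x) / s \<le> p (x + t *\<^sub>R y) - t * p y" if "0 \<le> t" for t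
    proof -
      have "p' (s *\<^sub>R x) \<le> p (s *\<^sub>R (x + t *\<^sub>R y)) - (s * t) * p y"
        using lower[of "s * t" "s *\<^sub>R x"] that s by (simp add: algebra_simps)
      also have "\<dots> = s * (p (x + t *\<^sub>R y) - t * p y)"
        unfolding sublinear_scale[OF p s] by (simp add: right_diff_distrib mult.assoc)
      finally show ?thesis using s by (simp add: divide_le_eq mult.commute)
    qed
    then have "p' (s *\<^sub>R x) / s \<le> p' x" unfolding p'_def[of x] by (intro cINF_greatest) auto
    then show "p' (s *\<^sub>R x) \<le> s * p' x" using s by (simp add: divide_le_eq mult.commute)
  qed
  moreover have "p' \<le> p" using lower[of 0] by (simp add: le_fun_def)
  ultimately have "p' = p" by (rule min)
  then show ?thesis using lower[of 1 x] by simp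
qed

text \<open>Zorn's lemma gives a minimal sublinear functional below \<open>q\<close>, and minimal ones are linear.\<close>

theorem Hahn_Banach_sublinear:
  fixes q :: "'v::real_vector \<Rightarrow> real"
  assumes q: "sublinear q"
  obtains f where "linear f" "\<And>x. f x \<le> q x"
proof -
  define A where "A = {p. sublinear p \<and> p \<le> q}"
  \<comment> \<open>The order is reversed, so a maximal element of \<open>r\<close> is a minimal
    functional.\<close>
  define r where "r = {(p, p'). p \<in> A \<and> p' \<in> A \<and> p' \<le> p}"
  have F: "Field r = A" unfolding r_def Field_def by auto
  have po: "Partial_order r"
    unfolding partial_order_on_def preorder_on_def refl_on_def trans_def antisym_def F
    by (auto simp: r_def)
  have "\<exists>m\<in>Field r. \<forall>a\<in>Field r. (m, a) \<in> r \<longrightarrow> a = m"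
  proof (rule Zorns_po_lemma[OF po])
    fix C assume C: "C \<in> Chains r"
    show "\<exists>u\<in>Field r. \<forall>a\<in>C. (a, u) \<in> r"
    proof (cases "C = {}")
      case True
      then show ?thesis using q unfolding F A_def by auto
    next
      case False
      have CA: "p \<in> A" if "p \<in> C" for p using C that unfolding Chains_def r_def by blast
      have ch: "p \<le> p' \<or> p' \<le> p" if "p \<in> C" "p' \<in> C" for p p'
        using C that unfolding Chains_def r_def by blast
      let ?u = "\<lambda>x. INF p\<in>C. p x"
      have u: "sublinear ?u" "\<And>p. p \<in> C \<Longrightarrow> ?u \<le> p"
        by (rule sublinear_chain_Inf[OF False, of q]; use CA ch in \<open>auto simp: A_def\<close>)+
      obtain p where p: "p \<in> C" using False by blast
      have "?u \<le> q" using u(2)[OF p] CA[OF p] unfolding A_def by (auto intro: order_trans)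
      then have uA: "?u \<in> A" using u(1) unfolding A_def by blast
      then show ?thesis unfolding F using u(2) CA by (intro bexI[of _ ?u]) (auto simp: r_def)
    qed
  qed
  then obtain p where "p \<in> A" and "\<forall>a\<in>A. (p, a) \<in> r \<longrightarrow> a = p" unfolding F by blast
  then have p: "p \<in> A" "\<And>p'. p' \<in> A \<Longrightarrow> p' \<le> p \<Longrightarrow> p' = p" unfolding r_def by auto
  have sp: "sublinear p" "p \<le> q" using p(1) unfolding A_def by auto
  have min: "p' = p" if "sublinear p'" "p' \<le> p" for p'
    using that sp(2) by (intro p(2)) (auto simp: A_def intro: order_trans)
  have add: "p (x + y) = p x + p y" for x y
    using minimal_sublinear_superadditive[OF sp(1) min] sublinear_add[OF sp(1)] by (meson antisym)
  have neg: "p (- x) = - p x" for x using add[of x "- x"] sublinear_zero[OF sp(1)] by simp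
  have "p (t *\<^sub>R x) = t * p x" for t x
  proof (cases t "0::real" rule: linorder_cases)
    case less
    then show ?thesis using sublinear_scale[OF sp(1), of "- t" x] neg[of "t *\<^sub>R x"] by simp
  qed (auto simp: sublinear_scale[OF sp(1)] sublinear_zero[OF sp(1)])
  then have "linear p" by (intro linearI) (auto simp: add)
  then show ?thesis using that sp(2) by (auto simp: le_fun_def)
qed

subsection \<open>Haar measure and correlations\<close>

text \<open>Differences serve two purposes: with one argument 0 they put \<open>W\<close> and its
  reflection inside \<open>V\<close>, and with both arguments they halve \<open>V\<close>.\<close>

lemma neighbourhood_zero_diff:
  fixes V :: "'a::topological_ab_group_add set"
  assumes "open V" "0 \<in> V"
  obtains W where "open W" "0 \<in> W" "\<And>x y. x \<in> W \<Longrightarrow> y \<in> W \<Longrightarrow> x - y \<in> V"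
proof -
  have "((\<lambda>p. fst p - snd p) \<longlongrightarrow> (0::'a) - 0) (nhds (0::'a) \<times>\<^sub>F nhds 0)"
    by (intro tendsto_diff filterlim_fst filterlim_snd)
  then have "\<forall>\<^sub>F p in nhds (0::'a) \<times>\<^sub>F nhds 0. fst p - snd p \<in> V"
    using assms by (intro topological_tendstoD) auto
  then obtain P Q where PQ: "eventually P (nhds (0::'a))" "eventually Q (nhds (0::'a))"
    "\<And>x y. P x \<Longrightarrow> Q y \<Longrightarrow> x - y \<in> V"
    unfolding eventually_prod_filter by auto
  obtain S where "open S" "0 \<in> S" "\<And>x. x \<in> S \<Longrightarrow> P x" using PQ(1) unfolding eventually_nhds by blast
  moreover obtain T where "open T" "0 \<in> T" "\<And>x. x \<in> T \<Longrightarrow> Q x" using PQ(2) unfolding eventually_nhds by blast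
  ultimately show ?thesis using PQ(3) by (intro that[of "S \<inter> T"]) auto
qed

lemma continuous_on_add_left: "continuous_on UNIV (\<lambda>y. x + y :: 'a::topological_ab_group_add)"
  by (auto simp: continuous_on_def intro!: tendsto_intros)

lemma open_translate: "open V \<Longrightarrow> open ((\<lambda>y. x + y) -` V :: 'a::topological_ab_group_add set)"
  by (rule open_vimage[OF _ continuous_on_add_left])

lemma Ccr_uniformly_continuous:
  fixes f :: "'a::{topological_ab_group_add,t2_space} \<Rightarrow> real"
  assumes f: "f \<in> Ccr" and e: "0 < e"
  obtains V where "open V" "0 \<in> V" "\<And>x z. z \<in> V \<Longrightarrow> \<bar>f (x + z) - f x\<bar> < e"
proof -
  obtain K where K: "compact K" "\<And>x. x \<notin> K \<Longrightarrow> f x = 0" using CcrE[OF f] by blast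
  have fc: "continuous_on UNIV f" by (rule Ccr_continuous[OF f])
  \<comment> \<open>Two displacements are allowed: \<open>w\<close> leads from \<open>x\<close> to a
    nearby point of \<open>K\<close>, and \<open>z\<close> is the shift whose effect is to be
    bounded.\<close>
  have "\<exists>W. open W \<and> 0 \<in> W \<and> (\<forall>w\<in>W. \<forall>z\<in>W. \<bar>f (x + w - z) - f x\<bar> < e/2)" for x
  proof -
    let ?V = "(\<lambda>y. x + y) -` {y. \<bar>f y - f x\<bar> < e/2}"
    have "open ?V"
      by (intro open_translate open_Collect_less continuous_intros fc)
    moreover have "0 \<in> ?V" using e by simp
    ultimately obtain W where W: "open W" "0 \<in> W" "\<And>w z. w \<in> W \<Longrightarrow> z \<in> W \<Longrightarrow> w - z \<in> ?V"
      using neighbourhood_zero_diff by blast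
    have "\<bar>f (x + w - z) - f x\<bar> < e/2" if "w \<in> W" "z \<in> W" for w z
      using W(3)[OF that] by (simp add: algebra_simps)
    then show ?thesis using W by blast
  qed
  then obtain W where W: "\<And>x. open (W x)" "\<And>x. 0 \<in> W x"
    "\<And>x w z. w \<in> W x \<Longrightarrow> z \<in> W x \<Longrightarrow> \<bar>f (x + w - z) - f x\<bar> < e/2" by metis
  define N where "N x = (\<lambda>y. - x + y) -` W x" for x
  have "open (N x)" for x unfolding N_def by (rule open_translate[OF W(1)])
  moreover have "K \<subseteq> (\<Union>x\<in>K. N x)" unfolding N_def using W(2) by auto
  ultimately obtain F where F: "F \<subseteq> K" "finite F" "K \<subseteq> (\<Union>x\<in>F. N x)"
    using compactE_image[OF K(1)] by metis
  define V0 where "V0 = (\<Inter>x\<in>F. W x)"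
  have V0: "open V0" "0 \<in> V0" unfolding V0_def using F(2) W(1,2) by auto
  have near: "\<bar>f (y - z) - f y\<bar> < e" if y: "y \<in> K" and z: "z \<in> V0" for y z
  proof -
    obtain x where x: "x \<in> F" "y \<in> N x" using F(3) y by blast
    then have "- x + y \<in> W x" "z \<in> W x" using z unfolding N_def V0_def by auto
    from W(3)[OF this] W(3)[OF this(1) W(2)]
    have "\<bar>f (y - z) - f x\<bar> < e/2" "\<bar>f y - f x\<bar> < e/2" by (simp_all add: diff_diff_eq)
    then show ?thesis by linarith
  qed
  obtain V where V: "open V" "0 \<in> V" "\<And>x y. x \<in> V \<Longrightarrow> y \<in> V \<Longrightarrow> x - y \<in> V0"
    using neighbourhood_zero_diff[OF V0] by blast
  \<comment> \<open>If \<open>x\<close> lies off \<open>K\<close> but \<open>x + z\<close> in it,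
    the estimate is applied at \<open>x + z\<close> with the shift back, so both signs of
    \<open>z\<close> occur.\<close>
  have sym: "z \<in> V0" "- z \<in> V0" if "z \<in> V" for z using V(3)[OF that V(2)] V(3)[OF V(2) that] by auto
  show ?thesis
  proof (rule that[OF V(1,2)])
    fix x z assume z: "z \<in> V"
    show "\<bar>f (x + z) - f x\<bar> < e"
    proof (cases "x \<in> K")
      case True
      then show ?thesis using near[OF True sym(2)[OF z]] by simp
    next
      case False
      show ?thesis
      proof (cases "x + z \<in> K")
        case True
        then show ?thesis using near[OF True sym(1)[OF z]] by simp
      next
        case False
        then show ?thesis using \<open>x \<notin> K\<close> K(2) e by simp
      qed
    qed
  qed
qed

lemma Ccr_translate:
  fixes f :: "'a::{topological_ab_group_add,t2_space} \<Rightarrow> real"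
  assumes f: "f \<in> Ccr" shows "(\<lambda>y. f (y - x)) \<in> Ccr"
proof -
  obtain K where K: "compact K" "\<And>x. x \<notin> K \<Longrightarrow> f x = 0" using CcrE[OF f] by blast
  have c: "continuous_on UNIV (\<lambda>y. y - x)" using continuous_on_add_left[of "- x"] by simp
  show ?thesis
  proof (rule CcrI)
    show "continuous_on UNIV (\<lambda>y. f (y - x))"
      by (rule continuous_on_compose2[OF Ccr_continuous[OF f] c]) auto
    show "compact ((\<lambda>y. x + y) ` K)"
      by (intro compact_continuous_image K continuous_on_subset[OF continuous_on_add_left]) auto
    show "f (y - x) = 0" if "y \<notin> (\<lambda>y. x + y) ` K" for y
    proof (rule K(2), rule notI)
      assume "y - x \<in> K"
      then have "x + (y - x) \<in> (\<lambda>y. x + y) ` K" by (rule imageI)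
      then show False using that by simp
    qed
  qed
qed

locale haar =
  fixes H :: "'a::{topological_ab_group_add,t2_space} measure"
  assumes haar: "haar_measure H"
    and lc: "locally_compact_space (euclidean :: 'a topology)"
begin

lemma sets_H [simp, measurable_cong]: "sets H = sets borel"
  using haar[unfolded haar_measure_def] by (rule conjunct1)

lemma space_H [simp]: "space H = UNIV"
  using sets_eq_imp_space_eq[OF sets_H] by simp

lemma measurable_H [simp]: "measurable H N = measurable borel N"
  by (rule measurable_cong_sets[OF sets_H refl])

lemma compact_finite: "compact K \<Longrightarrow> emeasure H K < \<infinity>"
  using haar[unfolded haar_measure_def, THEN conjunct2, THEN conjunct2, THEN conjunct2, THEN conjunct1] by simp

lemma integrable_Ccr:
  assumes f: "f \<in> Ccr" shows "integrable H f"
proof -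
  obtain K where K: "compact K" "\<And>x. x \<notin> K \<Longrightarrow> f x = 0" using CcrE[OF f] by blast
  obtain B where B: "\<And>x. \<bar>f x\<bar> \<le> B" using Ccr_bounded[OF f] by blast
  have "integrable H (\<lambda>x. B * indicator K x :: real)"
    using compact_finite[OF K(1)] borel_compact[OF K(1)]
    by (intro integrable_mult_right integrable_real_indicator) auto
  then show ?thesis
  proof (rule Bochner_Integration.integrable_bound)
    show "f \<in> borel_measurable H"
      using borel_measurable_continuous_onI[OF Ccr_continuous[OF f]] by simp
    show "AE x in H. norm (f x) \<le> norm (B * indicator K x)"
      using B K(2) by (intro always_eventually) (auto simp: indicator_def, meson abs_ge_self order_trans)
  qed
qed

lemma translation_invariant: "E \<in> sets borel \<Longrightarrow> emeasure H ((\<lambda>y. x + y) ` E) = emeasure H E"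
  using haar[unfolded haar_measure_def, THEN conjunct2, THEN conjunct2, THEN conjunct1] by simp

text \<open>Invariance on sets says that the image of \<open>H\<close> under a translation is
  \<open>H\<close> itself.\<close>

lemma integral_translate:
  assumes f: "f \<in> Ccr"
  shows "(LINT y|H. f (y - x)) = integral\<^sup>L H f"
proof -
  have m: "(\<lambda>y. - x + y) \<in> measurable H H"
    unfolding measurable_cong_sets[OF sets_H sets_H]
    by (rule borel_measurable_continuous_onI[OF continuous_on_add_left])
  have "distr H H (\<lambda>y. - x + y) = H"
  proof (rule measure_eqI)
    fix E assume "E \<in> sets (distr H H (\<lambda>y. - x + y))"
    then have E: "E \<in> sets borel" by simp
    have "(\<lambda>y. - x + y) -` E = (\<lambda>y. x + y) ` E" by (force simp: image_iff)
    then show "emeasure (distr H H (\<lambda>y. - x + y)) E = emeasure H E"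
      using E m translation_invariant[OF E, of x] by (simp add: emeasure_distr)
  qed simp
  then have "integral\<^sup>L H f = integral\<^sup>L (distr H H (\<lambda>y. - x + y)) f" by simp
  also have "\<dots> = (LINT y|H. f (- x + y))"
    using borel_measurable_continuous_onI[OF Ccr_continuous[OF f]] by (intro integral_distr[OF m]) simp
  finally show ?thesis by simp
qed

text \<open>Bilinear in \<open>u\<close> and \<open>v\<close>, so that the numbers
  \<open>sint m (corr (w i) (w j))\<close> form a matrix whose quadratic form is again the integral
  of a correlation.\<close>

definition corr :: "('a \<Rightarrow> real) \<Rightarrow> ('a \<Rightarrow> real) \<Rightarrow> 'a \<Rightarrow> real" where
  "corr u v x = (LINT y|H. u (y - x) * v y)"

lemma corr_Ccr:
  fixes u v :: "'a \<Rightarrow> real"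
  assumes "u \<in> Ccr" "v \<in> Ccr" shows "(\<lambda>y. u (y - x) * v y) \<in> Ccr"
  by (rule Ccr_mult[OF assms(2) Ccr_continuous[OF Ccr_translate[OF assms(1)]]])

lemma corr_integrable:
  assumes "u \<in> Ccr" "v \<in> Ccr" shows "integrable H (\<lambda>y. u (y - x) * v y :: real)"
  by (rule integrable_Ccr[OF corr_Ccr[OF assms]])

text \<open>The carrier is the set of differences of the two given carriers; continuity follows from
  uniform continuity of \<open>u\<close> and integrability of \<open>v\<close>.\<close>

lemma corr_in_Ccr:
  assumes u: "u \<in> Ccr" and v: "v \<in> Ccr" shows "corr u v \<in> Ccr"
proof -
  obtain K where K: "compact K" "\<And>x. x \<notin> K \<Longrightarrow> u x = 0" using CcrE[OF u] by blast
  obtain S where S: "compact S" "\<And>x. x \<notin> S \<Longrightarrow> v x = 0" using CcrE[OF v] by blast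
  have KS: "compact ((\<lambda>p. fst p - snd p) ` (S \<times> K))"
    by (intro compact_continuous_image compact_Times S K continuous_intros)
  have "corr u v x = 0" if "x \<notin> (\<lambda>p. fst p - snd p) ` (S \<times> K)" for x
  proof -
    have "u (y - x) * v y = 0" for y
    proof (rule ccontr)
      assume "u (y - x) * v y \<noteq> 0"
      then have "y \<in> S" "y - x \<in> K" using K S by auto
      then have "(\<lambda>p. fst p - snd p) (y, y - x) \<in> (\<lambda>p. fst p - snd p) ` (S \<times> K)" by (intro imageI) auto
      then show False using that by simp
    qed
    then show ?thesis unfolding corr_def by (simp only: integral_zero)
  qed
  moreover have "continuous_on UNIV (corr u v)"
    unfolding continuous_on_def
  proof (intro ballI tendstoI)
    fix x and e :: real assume "0 < e"
    let ?I = "LINT y|H. \<bar>v y\<bar>"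
    have av: "(\<lambda>y. \<bar>v y\<bar>) \<in> Ccr"
      by (rule Ccr_dominated[OF v]) (auto intro!: continuous_intros Ccr_continuous[OF v])
    have I0: "0 \<le> ?I" by (rule Bochner_Integration.integral_nonneg) simp
    \<comment> \<open>\<open>?I\<close> may vanish, hence the summand 1.\<close>
    let ?d = "e / (?I + 1)"
    have I1: "0 < ?I + 1" using I0 by linarith
    have d: "0 < ?d" using \<open>0 < e\<close> I1 by (rule divide_pos_pos)
    obtain V where V: "open V" "0 \<in> V" "\<And>x z. z \<in> V \<Longrightarrow> \<bar>u (x + z) - u x\<bar> < ?d"
      using Ccr_uniformly_continuous[OF u d] by blast
    have "open ((\<lambda>y. x - y) -` V)"
      by (intro open_vimage[OF V(1)] continuous_on_diff continuous_on_const continuous_on_id)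
    moreover have "x \<in> (\<lambda>y. x - y) -` V" using V(2) by simp
    ultimately have "\<forall>\<^sub>F x' in at x. x' \<in> (\<lambda>y. x - y) -` V"
      by (rule topological_tendstoD[OF tendsto_ident_at])
    then show "\<forall>\<^sub>F x' in at x. dist (corr u v x') (corr u v x) < e"
    proof eventually_elim
      case (elim x')
      have i: "integrable H (\<lambda>y. u (y - x') * v y - u (y - x) * v y)"
        by (intro Bochner_Integration.integrable_diff corr_integrable u v)
      have "corr u v x' - corr u v x = (LINT y|H. u (y - x') * v y - u (y - x) * v y)"
        unfolding corr_def by (rule Bochner_Integration.integral_diff[symmetric]; rule corr_integrable[OF u v])
      then have "\<bar>corr u v x' - corr u v x\<bar> \<le> (LINT y|H. \<bar>u (y - x') * v y - u (y - x) * v y\<bar>)"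
        by (simp only: integral_abs_bound)
      also have "\<dots> \<le> (LINT y|H. ?d * \<bar>v y\<bar>)"
      proof (rule integral_mono)
        show "integrable H (\<lambda>y. \<bar>u (y - x') * v y - u (y - x) * v y\<bar>)" using i by (rule integrable_abs)
        show "integrable H (\<lambda>y. ?d * \<bar>v y\<bar>)" by (intro integrable_mult_right integrable_Ccr av)
        fix y
        have "\<bar>u ((y - x) + (x - x')) - u (y - x)\<bar> < ?d" using elim by (intro V(3)) simp
        then have "\<bar>u (y - x') - u (y - x)\<bar> \<le> ?d" by simp
        then have "\<bar>u (y - x') - u (y - x)\<bar> * \<bar>v y\<bar> \<le> ?d * \<bar>v y\<bar>" by (rule mult_right_mono) simp
        then show "\<bar>u (y - x') * v y - u (y - x) * v y\<bar> \<le> ?d * \<bar>v y\<bar>"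
          by (simp only: abs_mult[symmetric] left_diff_distrib)
      qed
      also have "\<dots> = ?d * ?I" by simp
      also have "?d * ?I < ?d * (?I + 1)" using d by (intro mult_strict_left_mono) simp_all
      also have "\<dots> = e" using I1 by simp
      finally show ?case by (simp add: dist_real_def)
    qed
  qed
  ultimately show ?thesis using KS by (intro CcrI)
qed

lemma corr_swap:
  assumes "u \<in> Ccr" "v \<in> Ccr"
  shows "corr u v (- x) = corr v u x"
proof -
  have "(LINT y|H. u (y - x - - x) * v (y - x)) = (LINT y|H. u (y - - x) * v y)"
    by (rule integral_translate[OF corr_Ccr[OF assms]])
  then show ?thesis unfolding corr_def by (simp add: mult.commute)
qed

end

subsection \<open>Real positive definite functions\<close>

text \<open>Real coefficients see only the even part of \<open>f\<close>, so the symmetry that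
  complex coefficients enforce is required separately.\<close>

definition real_pd :: "('a::ab_group_add \<Rightarrow> real) \<Rightarrow> bool" where
  "real_pd f \<longleftrightarrow> (\<forall>x. f (- x) = f x) \<and>
     (\<forall>(n::nat) a x. 0 \<le> (\<Sum>j<n. \<Sum>k<n. a j * a k * f (x j - x k)))"

lemma real_pd_quadratic:
  "real_pd f \<Longrightarrow> 0 \<le> (\<Sum>j<n. \<Sum>k<n. a j * a k * f (x j - x k))" for n :: nat
  unfolding real_pd_def by blast

lemma positive_definite_of_real:
  fixes f :: "'a::ab_group_add \<Rightarrow> real"
  shows "positive_definite (\<lambda>x. of_real (f x)) \<longleftrightarrow> real_pd f"
proof
  assume pd: "positive_definite (\<lambda>x. of_real (f x))"
  show "real_pd f" unfolding real_pd_def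
  proof (intro conjI allI)
    fix x
    \<comment> \<open>With the coefficients \<open>1\<close> at \<open>0\<close> and
      \<open>\<i>\<close> at \<open>x\<close> the imaginary part of the form is
      \<open>f x - f (- x)\<close>.\<close>
    define c where "c j = (if j = 0 then 1 else \<i>)" for j :: nat
    define p :: "nat \<Rightarrow> 'a" where "p j = (if j = 0 then 0 else x)" for j
    have "0 \<le> (\<Sum>j<2. \<Sum>k<2. c j * cnj (c k) * complex_of_real (f (p j - p k)))"
      using pd unfolding positive_definite_def by blast
    then show "f (- x) = f x"
      by (simp add: c_def p_def numeral_2_eq_2 less_eq_complex_def)
  next
    fix n :: nat and a :: "nat \<Rightarrow> real" and x :: "nat \<Rightarrow> 'a"
    have "0 \<le> (\<Sum>j<n. \<Sum>k<n. complex_of_real (a j) * cnj (complex_of_real (a k)) * complex_of_real (f (x j - x k)))"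
      using pd[unfolded positive_definite_def, THEN spec[of _ n], THEN spec[of _ "\<lambda>j. complex_of_real (a j)"],
        THEN spec[of _ x]] .
    also have "\<dots> = complex_of_real (\<Sum>j<n. \<Sum>k<n. a j * a k * f (x j - x k))" by simp
    finally show "0 \<le> (\<Sum>j<n. \<Sum>k<n. a j * a k * f (x j - x k))"
      by (simp add: less_eq_complex_def)
  qed
next
  assume pd: "real_pd f"
  show "positive_definite (\<lambda>x. of_real (f x))" unfolding positive_definite_def
  proof (intro allI)
    fix n :: nat and c :: "nat \<Rightarrow> complex" and x :: "nat \<Rightarrow> 'a"
    let ?a = "\<lambda>j. Re (c j)" and ?b = "\<lambda>j. Im (c j)"
    let ?F = "\<lambda>j k. f (x j - x k)"
    let ?S = "\<Sum>j<n. \<Sum>k<n. c j * cnj (c k) * complex_of_real (?F j k)"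
    have "Re ?S = (\<Sum>j<n. \<Sum>k<n. ?a j * ?a k * ?F j k) + (\<Sum>j<n. \<Sum>k<n. ?b j * ?b k * ?F j k)"
      by (simp add: sum.distrib[symmetric] distrib_right)
    moreover have "0 \<le> (\<Sum>j<n. \<Sum>k<n. ?a j * ?a k * ?F j k)" "0 \<le> (\<Sum>j<n. \<Sum>k<n. ?b j * ?b k * ?F j k)"
      by (rule real_pd_quadratic[OF pd])+
    ultimately have "0 \<le> Re ?S" by linarith
    moreover have "Im ?S = 0"
    proof -
      have sym: "?F j k = ?F k j" for j k
        using pd unfolding real_pd_def by (metis minus_diff_eq)
      have "Im ?S = (\<Sum>j<n. \<Sum>k<n. ?b j * ?a k * ?F j k) - (\<Sum>j<n. \<Sum>k<n. ?a j * ?b k * ?F j k)"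
        by (simp add: sum_subtractf[symmetric] left_diff_distrib)
      also have "(\<Sum>j<n. \<Sum>k<n. ?a j * ?b k * ?F j k) = (\<Sum>k<n. \<Sum>j<n. ?a j * ?b k * ?F j k)"
        by (rule sum.swap)
      also have "\<dots> = (\<Sum>k<n. \<Sum>j<n. ?b k * ?a j * ?F k j)"
        by (intro sum.cong refl) (simp add: sym mult.commute)
      finally show ?thesis by simp
    qed
    ultimately show "0 \<le> ?S" by (simp add: less_eq_complex_def)
  qed
qed

lemma real_pd_even: "real_pd f \<Longrightarrow> f (- x) = f x"
  unfolding real_pd_def by blast

lemma real_pd_sum_nonneg:
  assumes pd: "real_pd f" and F: "finite F"
  shows "0 \<le> (\<Sum>s\<in>F. \<Sum>t\<in>F. a s * a t * f (s - t))"
proof -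
  obtain x :: "nat \<Rightarrow> 'a" where x: "bij_betw x {..<card F} F"
    using ex_bij_betw_nat_finite[OF F] unfolding lessThan_atLeast0 by blast
  have "(\<Sum>s\<in>F. \<Sum>t\<in>F. a s * a t * f (s - t)) =
     (\<Sum>j<card F. \<Sum>k<card F. a (x j) * a (x k) * f (x j - x k))"
    by (subst sum.reindex_bij_betw[OF x, symmetric], intro sum.cong refl sum.reindex_bij_betw[OF x, symmetric])
  then show ?thesis using pd unfolding real_pd_def by simp
qed

text \<open>The coefficients \<open>1, 1\<close> and \<open>1, -1\<close> on the points
  \<open>0, x\<close> show that \<open>f 0 + f x\<close> and \<open>f 0 - f x\<close> are
  nonnegative.\<close>

lemma real_pd_bound:
  assumes pd: "real_pd f" shows "\<bar>f x\<bar> \<le> f 0"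
proof (cases "x = 0")
  case True
  have "0 \<le> (\<Sum>s\<in>{0}. \<Sum>t\<in>{0}. 1 * 1 * f (s - t))" using real_pd_sum_nonneg[OF pd, of "{0}" "\<lambda>_. 1"] by simp
  then show ?thesis using True by simp
next
  case False
  have "0 \<le> (\<Sum>s\<in>{0,x}. \<Sum>t\<in>{0,x}. 1 * 1 * f (s - t))"
    using real_pd_sum_nonneg[OF pd, of "{0,x}" "\<lambda>_. 1"] by simp
  moreover have "0 \<le> (\<Sum>s\<in>{0,x}. \<Sum>t\<in>{0,x}. (if s = 0 then 1 else -1) * (if t = 0 then 1 else -1) * f (s - t))"
    by (rule real_pd_sum_nonneg[OF pd]) simp
  ultimately show ?thesis using False real_pd_even[OF pd, of x] by (auto simp: abs_le_iff)
qed

lemma real_pd_add: "real_pd f \<Longrightarrow> real_pd g \<Longrightarrow> real_pd (\<lambda>x. f x + g x)"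
  unfolding real_pd_def by (auto simp: distrib_left sum.distrib intro!: add_nonneg_nonneg)

lemma real_pd_cmult: "real_pd f \<Longrightarrow> 0 \<le> c \<Longrightarrow> real_pd (\<lambda>x. c * f x)"
  unfolding real_pd_def by (auto simp: mult.left_commute[of _ c] sum_distrib_left[symmetric])

lemma real_pd_const:
  assumes "0 \<le> c" shows "real_pd (\<lambda>x. c)"
proof -
  have "(\<Sum>j<n. \<Sum>k<n. a j * a k * c) = c * (\<Sum>j<n. a j) ^ 2" for n and a :: "nat \<Rightarrow> real"
    by (simp add: power2_eq_square sum_product sum_distrib_left mult.commute)
  then show ?thesis using assms unfolding real_pd_def by simp
qed

text \<open>By Cholesky elimination of one row and column at a time.\<close>

lemma psd_sum_product_nonneg:
  fixes F B :: "'i \<Rightarrow> 'i \<Rightarrow> real"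
  assumes "finite I" and "\<And>i j. F i j = F j i"
    and "\<And>a. 0 \<le> (\<Sum>i\<in>I. \<Sum>j\<in>I. a i * a j * F i j)"
    and "\<And>a. 0 \<le> (\<Sum>i\<in>I. \<Sum>j\<in>I. a i * a j * B i j)"
  shows "0 \<le> (\<Sum>i\<in>I. \<Sum>j\<in>I. F i j * B i j)"
  using assms
proof (induction I arbitrary: F)
  case empty
  then show ?case by simp
next
  case (insert k I F)
  note sym = insert.prems(1)
  have split: "(\<Sum>i\<in>insert k I. \<Sum>j\<in>insert k I. G i j) =
     G k k + (\<Sum>j\<in>I. G k j) + (\<Sum>i\<in>I. G i k) + (\<Sum>i\<in>I. \<Sum>j\<in>I. G i j)" for G :: "'i \<Rightarrow> 'i \<Rightarrow> real"
    using insert.hyps by (simp add: sum.distrib)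
  \<comment> \<open>The form of \<open>F\<close> as a quadratic polynomial in the coordinate
    \<open>s\<close> at \<open>k\<close>; its dependence on \<open>s\<close> decides both cases
    below.\<close>
  have F2: "0 \<le> s * s * F k k + 2 * s * (\<Sum>j\<in>I. a j * F k j) + (\<Sum>i\<in>I. \<Sum>j\<in>I. a i * a j * F i j)" for s a
  proof -
    let ?a = "a(k := s)"
    have "0 \<le> (\<Sum>i\<in>insert k I. \<Sum>j\<in>insert k I. ?a i * ?a j * F i j)" by (rule insert.prems(2))
    also have "\<dots> = ?a k * ?a k * F k k + (\<Sum>j\<in>I. ?a k * ?a j * F k j) + (\<Sum>i\<in>I. ?a i * ?a k * F i k)
        + (\<Sum>i\<in>I. \<Sum>j\<in>I. ?a i * ?a j * F i j)"
      by (rule split)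
    also have "(\<Sum>j\<in>I. ?a k * ?a j * F k j) = (\<Sum>j\<in>I. s * (a j * F k j))"
      using insert.hyps(2) by (intro sum.cong refl) auto
    also have "(\<Sum>i\<in>I. ?a i * ?a k * F i k) = (\<Sum>j\<in>I. s * (a j * F k j))"
    proof (intro sum.cong refl)
      fix i assume "i \<in> I"
      then have "i \<noteq> k" using insert.hyps(2) by blast
      then show "?a i * ?a k * F i k = s * (a i * F k i)" using sym[of i k] by simp
    qed
    also have "(\<Sum>i\<in>I. \<Sum>j\<in>I. ?a i * ?a j * F i j) = (\<Sum>i\<in>I. \<Sum>j\<in>I. a i * a j * F i j)"
      using insert.hyps(2) by (intro sum.cong refl) auto
    finally show ?thesis by (simp add: sum_distrib_left[symmetric])
  qed
  have B2: "0 \<le> (\<Sum>i\<in>I. \<Sum>j\<in>I. a i * a j * B i j)" for a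
  proof -
    let ?a = "a(k := 0)"
    have "0 \<le> (\<Sum>i\<in>insert k I. \<Sum>j\<in>insert k I. ?a i * ?a j * B i j)" by (rule insert.prems(3))
    also have "\<dots> = ?a k * ?a k * B k k + (\<Sum>j\<in>I. ?a k * ?a j * B k j) + (\<Sum>i\<in>I. ?a i * ?a k * B i k)
        + (\<Sum>i\<in>I. \<Sum>j\<in>I. ?a i * ?a j * B i j)"
      by (rule split)
    also have "\<dots> = (\<Sum>i\<in>I. \<Sum>j\<in>I. ?a i * ?a j * B i j)" by simp
    also have "\<dots> = (\<Sum>i\<in>I. \<Sum>j\<in>I. a i * a j * B i j)"
      using insert.hyps(2) by (intro sum.cong refl) auto
    finally show ?thesis .
  qed
  have Fkk: "0 \<le> F k k" using F2[of 1 "\<lambda>_. 0"] by simp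
  show ?case
  proof (cases "F k k = 0")
    case True
    \<comment> \<open>With a zero pivot the form is affine in \<open>s\<close>; being nonnegative
      for all \<open>s\<close>, it has no linear term.\<close>
    have z: "F k j = 0" if "j \<in> I" for j
    proof (rule ccontr)
      assume nz: "F k j \<noteq> 0"
      let ?a = "\<lambda>i. if i = j then 1 else 0 :: real"
      have 1: "(\<Sum>i\<in>I. ?a i * F k i) = F k j" using that insert.hyps(1)
        by (simp add: if_distrib[of "\<lambda>z. z * _"] cong: if_cong)
      have "0 \<le> 2 * s * F k j + (\<Sum>i\<in>I. \<Sum>l\<in>I. ?a i * ?a l * F i l)" for s
        using F2[of s ?a] True unfolding 1 by simp
      then have "0 \<le> 2 * s * F k j + X" if "X = (\<Sum>i\<in>I. \<Sum>l\<in>I. ?a i * ?a l * F i l)" for s X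
        using that by blast
      \<comment> \<open>For this \<open>s\<close> the right-hand side is -1.\<close>
      from this[OF refl, of "(- (\<Sum>i\<in>I. \<Sum>l\<in>I. ?a i * ?a l * F i l) - 1) / (2 * F k j)"] nz
      show False by (simp only: mult.assoc[symmetric] times_divide_eq_right mult_divide_mult_cancel_right) (simp add: field_simps)
    qed
    have "(\<Sum>i\<in>insert k I. \<Sum>j\<in>insert k I. F i j * B i j) = (\<Sum>i\<in>I. \<Sum>j\<in>I. F i j * B i j)"
      unfolding split using z True trans[OF sym z] by simp
    moreover have "0 \<le> (\<Sum>i\<in>I. \<Sum>j\<in>I. F i j * B i j)"
    proof (rule insert.IH[OF sym _ B2])
      show "0 \<le> (\<Sum>i\<in>I. \<Sum>j\<in>I. a i * a j * F i j)" for a using F2[of 0 a] by simp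
    qed
    ultimately show ?thesis by simp
  next
    case False
    then have pos: "0 < F k k" using Fkk by simp
    \<comment> \<open>The Schur complement of the pivot: row and column \<open>k\<close> vanish, and
      the part subtracted has rank one.\<close>
    define F' where "F' i j = F i j - F i k * F j k / F k k" for i j
    have F'k: "F' k j = 0" "F' j k = 0" for j using pos sym[of j k] unfolding F'_def by simp_all
    have F'psd: "0 \<le> (\<Sum>i\<in>I. \<Sum>j\<in>I. a i * a j * F' i j)" for a
    proof -
      let ?s = "\<Sum>j\<in>I. a j * F k j"
      have "(\<Sum>i\<in>I. \<Sum>j\<in>I. a i * a j * F' i j) =
        (\<Sum>i\<in>I. \<Sum>j\<in>I. a i * a j * F i j) - (\<Sum>i\<in>I. \<Sum>j\<in>I. (a i * F k i) * (a j * F k j)) / F k k"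
        unfolding F'_def sum_divide_distrib sum_subtractf[symmetric]
      proof (intro sum.cong refl)
        fix i j
        show "a i * a j * (F i j - F i k * F j k / F k k) = a i * a j * F i j - a i * F k i * (a j * F k j) / F k k"
          unfolding sym[of i k] sym[of j k] by (simp add: algebra_simps)
      qed
      also have "(\<Sum>i\<in>I. \<Sum>j\<in>I. (a i * F k i) * (a j * F k j)) = ?s * ?s" by (rule sum_product[symmetric])
      finally have "(\<Sum>i\<in>I. \<Sum>j\<in>I. a i * a j * F' i j) = (\<Sum>i\<in>I. \<Sum>j\<in>I. a i * a j * F i j) - ?s * ?s / F k k" .
      \<comment> \<open>The value \<open>- ?s / F k k\<close> minimises the polynomial in
        \<open>F2\<close>, and the minimum is the form of \<open>F'\<close>.\<close>
      moreover have "(- ?s / F k k) * (- ?s / F k k) * F k k + 2 * (- ?s / F k k) * ?s = - (?s * ?s / F k k)"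
        using pos by (simp add: field_simps)
      ultimately show ?thesis using F2[of "- ?s / F k k" a] by linarith
    qed
    have "(\<Sum>i\<in>insert k I. \<Sum>j\<in>insert k I. F i j * B i j) =
      (\<Sum>i\<in>insert k I. \<Sum>j\<in>insert k I. F' i j * B i j) +
      (\<Sum>i\<in>insert k I. \<Sum>j\<in>insert k I. F i k * F j k * B i j) / F k k"
      unfolding sum_divide_distrib sum.distrib[symmetric] F'_def
      by (intro sum.cong refl) (simp add: algebra_simps)
    moreover have "(\<Sum>i\<in>insert k I. \<Sum>j\<in>insert k I. F' i j * B i j) = (\<Sum>i\<in>I. \<Sum>j\<in>I. F' i j * B i j)"
      unfolding split by (simp add: F'k)
    moreover have "0 \<le> (\<Sum>i\<in>I. \<Sum>j\<in>I. F' i j * B i j)"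
      by (rule insert.IH[OF _ F'psd B2]) (simp add: F'_def sym mult.commute)
    \<comment> \<open>The rank-one part contributes the quadratic form of \<open>B\<close> at the
      vector \<open>F i k\<close>.\<close>
    moreover have "0 \<le> (\<Sum>i\<in>insert k I. \<Sum>j\<in>insert k I. F i k * F j k * B i j)"
      by (rule insert.prems(3))
    ultimately show ?thesis using pos by simp
  qed
qed

section \<open>Correlations as positive definite functions, and localisation\<close>

context haar begin

lemma corr_sum:
  assumes w: "\<And>i. i \<in> I \<Longrightarrow> w i \<in> Ccr" and "finite I"
  shows "corr (\<lambda>y. \<Sum>i\<in>I. c i * w i y) (\<lambda>y. \<Sum>i\<in>I. c i * w i y) x =
    (\<Sum>i\<in>I. \<Sum>j\<in>I. c i * c j * corr (w i) (w j) x)"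
proof -
  have "(\<Sum>i\<in>I. c i * w i (y - x)) * (\<Sum>i\<in>I. c i * w i y) =
    (\<Sum>i\<in>I. \<Sum>j\<in>I. c i * c j * (w i (y - x) * w j y))" for y
    unfolding sum_product by (intro sum.cong refl) (simp add: algebra_simps)
  then have "corr (\<lambda>y. \<Sum>i\<in>I. c i * w i y) (\<lambda>y. \<Sum>i\<in>I. c i * w i y) x =
    (LINT y|H. (\<Sum>i\<in>I. \<Sum>j\<in>I. c i * c j * (w i (y - x) * w j y)))"
    unfolding corr_def by simp
  also have "\<dots> = (\<Sum>i\<in>I. (LINT y|H. (\<Sum>j\<in>I. c i * c j * (w i (y - x) * w j y))))"
    using w by (intro Bochner_Integration.integral_sum Bochner_Integration.integrable_sum
        integrable_mult_right corr_integrable)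
  also have "\<dots> = (\<Sum>i\<in>I. \<Sum>j\<in>I. LINT y|H. c i * c j * (w i (y - x) * w j y))"
    using w by (intro sum.cong refl Bochner_Integration.integral_sum
        integrable_mult_right corr_integrable)
  finally show ?thesis unfolding corr_def by simp
qed

text \<open>By translation invariance the quadratic form is the integral of the square of
  \<open>\<Sum>j<n. a j * u (y - x j)\<close>.\<close>

lemma corr_real_pd:
  assumes u: "u \<in> Ccr" shows "real_pd (corr u u)"
  unfolding real_pd_def
proof (intro conjI allI)
  show "corr u u (- x) = corr u u x" for x by (rule corr_swap[OF u u])
  fix n :: nat and a :: "nat \<Rightarrow> real" and x :: "nat \<Rightarrow> 'a"
  have t: "(\<lambda>y. u (y - p) * u (y - q)) \<in> Ccr" for p q
    by (rule Ccr_mult[OF Ccr_translate[OF u] Ccr_continuous[OF Ccr_translate[OF u]]])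
  have c: "corr u u (p - q) = (LINT y|H. u (y - p) * u (y - q))" for p q
    using integral_translate[OF corr_Ccr[OF u u, of "p - q"], of q] unfolding corr_def
    by (simp add: algebra_simps)
  have "(\<Sum>j<n. \<Sum>k<n. a j * a k * corr u u (x j - x k)) =
    (\<Sum>j<n. \<Sum>k<n. LINT y|H. a j * a k * (u (y - x j) * u (y - x k)))"
    unfolding c by simp
  also have "\<dots> = (\<Sum>j<n. (LINT y|H. (\<Sum>k<n. a j * a k * (u (y - x j) * u (y - x k)))))"
    by (intro sum.cong refl Bochner_Integration.integral_sum[symmetric] integrable_mult_right integrable_Ccr t)
  also have "\<dots> = (LINT y|H. (\<Sum>j<n. \<Sum>k<n. a j * a k * (u (y - x j) * u (y - x k))))"
    by (intro Bochner_Integration.integral_sum[symmetric] Bochner_Integration.integrable_sum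
        integrable_mult_right integrable_Ccr t)
  also have "\<dots> = (LINT y|H. (\<Sum>j<n. a j * u (y - x j)) * (\<Sum>j<n. a j * u (y - x j)))"
    unfolding sum_product by (intro Bochner_Integration.integral_cong sum.cong refl) (simp add: algebra_simps)
  also have "0 \<le> \<dots>" by (intro Bochner_Integration.integral_nonneg zero_le_square)
  finally show "0 \<le> (\<Sum>j<n. \<Sum>k<n. a j * a k * corr u u (x j - x k))" .
qed

text \<open>Multiplying by a correlation \<open>corr v v\<close> localises \<open>f\<close>: on the support of \<open>v\<close> the kernel
  \<open>f (s - t)\<close> is uniformly close to a finite-rank kernel, and the Schur-type lemma applies.\<close>

lemma localized_positivity:
  assumes m: "finite_variation m" and pos: "\<And>w. w \<in> Ccr \<Longrightarrow> 0 \<le> sint m (corr w w)"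
    and f: "continuous_on UNIV f" "real_pd f" and v: "v \<in> Ccr" "\<And>x. 0 \<le> v x"
  shows "0 \<le> sint m (\<lambda>x. f x * corr v v x)"
proof -
  obtain S where S: "compact S" "\<And>x. x \<notin> S \<Longrightarrow> v x = 0" using CcrE[OF v(1)] by blast
  have cC: "corr v v \<in> Ccr" by (rule corr_in_Ccr[OF v(1) v(1)])
  obtain M where M: "0 \<le> M" "\<And>x. \<bar>corr v v x\<bar> \<le> M" using Ccr_bounded[OF cC] by blast
  let ?t = "variation m UNIV"
  have approx: "- (?t * (e * M)) \<le> sint m (\<lambda>x. f x * corr v v x)" if e: "0 < e" for e
  proof -
    let ?D = "(\<lambda>p. fst p - snd p) ` (S \<times> S)"
    have "compact ?D" by (intro compact_continuous_image compact_Times S continuous_intros)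
    \<comment> \<open>Uniform continuity is at hand for compactly supported functions only, so
      \<open>f\<close> is cut off by \<open>\<psi>\<close>; the differences to be compared lie in
      \<open>?D\<close>, where \<open>\<psi>\<close> is 1.\<close>
    then obtain \<psi> :: "'a \<Rightarrow> real" where \<psi>: "\<psi> \<in> Ccr" "\<And>x. x \<in> ?D \<Longrightarrow> \<psi> x = 1"
      using Urysohn_compact[OF lc _ open_UNIV] by (metis subset_UNIV)
    have f\<psi>: "(\<lambda>x. f x * \<psi> x) \<in> Ccr" by (rule Ccr_mult[OF \<psi>(1) f(1)])
    obtain V where V: "open V" "0 \<in> V" "\<And>x z. z \<in> V \<Longrightarrow> \<bar>f (x + z) * \<psi> (x + z) - f x * \<psi> x\<bar> < e"
      using Ccr_uniformly_continuous[OF f\<psi> e] by metis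
    obtain W where W: "open W" "0 \<in> W" "\<And>x y. x \<in> W \<Longrightarrow> y \<in> W \<Longrightarrow> x - y \<in> V"
      using neighbourhood_zero_diff[OF V(1,2)] by metis
    define U where "U s = (\<lambda>y. - s + y) -` W" for s
    obtain F \<phi> where F: "finite F" "F \<subseteq> S" "\<And>s. s \<in> F \<Longrightarrow> \<phi> s \<in> Ccr"
      "\<And>s x. s \<in> F \<Longrightarrow> 0 \<le> \<phi> s x" "\<And>s x. s \<in> F \<Longrightarrow> x \<notin> U s \<Longrightarrow> \<phi> s x = 0"
      "\<And>x. (\<Sum>s\<in>F. \<phi> s x) \<le> (1::real)" "\<And>x. x \<in> S \<Longrightarrow> (\<Sum>s\<in>F. \<phi> s x) = 1"
    proof (rule partition_of_unity[OF lc S(1), of U])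
      show "open (U s)" for s unfolding U_def by (rule open_translate[OF W(1)])
      show "s \<in> U s" for s unfolding U_def using W(2) by simp
    qed (rule that; assumption)
    have near: "\<bar>f (y' - y) - f (s' - s)\<bar> \<le> e"
      if "s \<in> F" "s' \<in> F" "y \<in> U s" "y' \<in> U s'" "y \<in> S" "y' \<in> S" for s s' y y'
    proof -
      have "s \<in> S" "s' \<in> S" using that F(2) by auto
      then have "s' - s \<in> ?D" "y' - y \<in> ?D" using that(5,6)
        by (auto intro: image_eqI[of _ _ "(s', s)"] image_eqI[of _ _ "(y', y)"])
      then have \<psi>1: "\<psi> (s' - s) = 1" "\<psi> (y' - y) = 1" by (auto intro: \<psi>(2))
      have z: "(- s' + y') - (- s + y) \<in> V" using that(3,4) unfolding U_def by (intro W(3)) auto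
      have "(s' - s) + ((- s' + y') - (- s + y)) = y' - y" by (simp add: algebra_simps)
      then show ?thesis using V(3)[OF z, of "s' - s"] \<psi>1 by simp
    qed
    define w where "w s y = \<phi> s y * v y" for s y
    have w: "w s \<in> Ccr" if "s \<in> F" for s
      unfolding w_def by (rule Ccr_mult[OF v(1) Ccr_continuous[OF F(3)[OF that]]])
    \<comment> \<open>In the integral of \<open>f x * (v (y - x) * v y)\<close> one has
      \<open>x = y - (y - x)\<close>; with \<open>y\<close> near \<open>s'\<close> and
      \<open>y - x\<close> near \<open>s\<close>, this suggests replacing \<open>f x\<close> by
      \<open>f (s' - s)\<close>.\<close>
    define g where "g x = (\<Sum>s\<in>F. \<Sum>s'\<in>F. f (s' - s) * corr (w s) (w s') x)" for x
    have gC: "g \<in> Ccr" unfolding g_def using w by (intro Ccr_sum Ccr_cmult corr_in_Ccr)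
    have g_pos: "0 \<le> sint m g"
    proof -
      have "sint m g = (\<Sum>s\<in>F. \<Sum>s'\<in>F. f (s' - s) * sint m (corr (w s) (w s')))"
      proof -
        have b: "(\<lambda>x. f (s' - s) * corr (w s) (w s') x) \<in> bdd_borel" if "s \<in> F" "s' \<in> F" for s s'
          using w that by (intro Ccr_bdd_borel Ccr_cmult corr_in_Ccr)
        show ?thesis unfolding g_def using b
          by (simp add: sint_sum[OF m] bdd_borel_sum sint_cmult)
      qed
      also have "0 \<le> \<dots>"
      proof (rule psd_sum_product_nonneg[OF F(1)])
        show "f (j - i) = f (i - j)" for i j using real_pd_even[OF f(2), of "i - j"] by simp
        show "0 \<le> (\<Sum>i\<in>F. \<Sum>j\<in>F. a i * a j * f (j - i))" for a
        proof -
          have "(\<Sum>i\<in>F. \<Sum>j\<in>F. a i * a j * f (j - i)) = (\<Sum>i\<in>F. \<Sum>j\<in>F. a i * a j * f (i - j))"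
            using real_pd_even[OF f(2), of "i - j" for i j] by (intro sum.cong refl) simp
          then show ?thesis using real_pd_sum_nonneg[OF f(2) F(1), of a] by simp
        qed
        \<comment> \<open>Bilinearity turns this form into the integral of the correlation of
          \<open>?w\<close> with itself. The matrix need not be symmetric, as \<open>m\<close> need
          not be even.\<close>
        show "0 \<le> (\<Sum>i\<in>F. \<Sum>j\<in>F. a i * a j * sint m (corr (w i) (w j)))" for a
        proof -
          let ?w = "\<lambda>y. \<Sum>s\<in>F. a s * w s y"
          have b: "(\<lambda>x. a s * a s' * corr (w s) (w s') x) \<in> bdd_borel" if "s \<in> F" "s' \<in> F" for s s'
            using w that by (intro Ccr_bdd_borel Ccr_cmult corr_in_Ccr)
          have "0 \<le> sint m (corr ?w ?w)" by (intro pos Ccr_sum Ccr_cmult w)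
          also have "corr ?w ?w = (\<lambda>x. \<Sum>i\<in>F. \<Sum>j\<in>F. a i * a j * corr (w i) (w j) x)"
            by (rule ext, rule corr_sum[OF w F(1)])
          also have "sint m \<dots> = (\<Sum>i\<in>F. \<Sum>j\<in>F. a i * a j * sint m (corr (w i) (w j)))"
            using b by (simp add: sint_sum[OF m] bdd_borel_sum sint_cmult)
          finally show ?thesis .
        qed
      qed
      finally show ?thesis .
    qed
    have diff: "\<bar>f x * corr v v x - g x\<bar> \<le> e * M" for x
    proof -
      let ?k = "\<lambda>y. \<Sum>s\<in>F. \<Sum>s'\<in>F. f (s' - s) * (\<phi> s (y - x) * \<phi> s' y)"
      have gx: "g x = (LINT y|H. ?k y * (v (y - x) * v y))"
      proof -
        have "g x = (\<Sum>s\<in>F. \<Sum>s'\<in>F. LINT y|H. f (s' - s) * (w s (y - x) * w s' y))"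
          unfolding g_def corr_def by simp
        also have "\<dots> = (LINT y|H. (\<Sum>s\<in>F. \<Sum>s'\<in>F. f (s' - s) * (w s (y - x) * w s' y)))"
          using w by (simp add: Bochner_Integration.integral_sum Bochner_Integration.integrable_sum corr_integrable)
        also have "\<dots> = (LINT y|H. ?k y * (v (y - x) * v y))"
          unfolding sum_distrib_right w_def
          by (intro Bochner_Integration.integral_cong sum.cong refl) (simp add: algebra_simps)
        finally show ?thesis .
      qed
      have kC: "integrable H (\<lambda>y. ?k y * (v (y - x) * v y))"
        using Ccr_continuous[OF F(3)] Ccr_continuous[OF Ccr_translate[OF F(3)]]
        by (intro integrable_Ccr Ccr_mult corr_Ccr v continuous_on_sum continuous_on_mult continuous_on_const)
      have "f x * corr v v x - g x = (LINT y|H. f x * (v (y - x) * v y)) - (LINT y|H. ?k y * (v (y - x) * v y))"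
        unfolding gx corr_def by simp
      also have "\<dots> = (LINT y|H. f x * (v (y - x) * v y) - ?k y * (v (y - x) * v y))"
        by (rule Bochner_Integration.integral_diff[symmetric, OF integrable_mult_right[OF corr_integrable[OF v(1) v(1)]] kC])
      finally have "\<bar>f x * corr v v x - g x\<bar> = \<bar>LINT y|H. f x * (v (y - x) * v y) - ?k y * (v (y - x) * v y)\<bar>"
        by simp
      also have "\<dots> \<le> (LINT y|H. \<bar>f x * (v (y - x) * v y) - ?k y * (v (y - x) * v y)\<bar>)"
        by (rule integral_abs_bound)
      also have "\<dots> \<le> (LINT y|H. e * (v (y - x) * v y))"
      proof (rule integral_mono)
        show "integrable H (\<lambda>y. \<bar>f x * (v (y - x) * v y) - ?k y * (v (y - x) * v y)\<bar>)"
          by (intro integrable_abs Bochner_Integration.integrable_diff kC integrable_mult_right corr_integrable v)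
        show "integrable H (\<lambda>y. e * (v (y - x) * v y))"
          by (intro integrable_mult_right corr_integrable v)
        fix y
        \<comment> \<open>Where \<open>v (y - x) * v y\<close> can be nonzero, the weights
          \<open>\<phi> s (y - x) * \<phi> s' y\<close> sum to 1 and the error is an average of
          errors of at most \<open>e\<close>; elsewhere both sides vanish.\<close>
        show "\<bar>f x * (v (y - x) * v y) - ?k y * (v (y - x) * v y)\<bar> \<le> e * (v (y - x) * v y)"
        proof (cases "y \<in> S \<and> y - x \<in> S")
          case True
          have "f x = (\<Sum>s\<in>F. \<Sum>s'\<in>F. f x * (\<phi> s (y - x) * \<phi> s' y))"
            using F(7) True by (simp add: sum_product[symmetric] sum_distrib_left[symmetric])
          then have "f x - ?k y = (\<Sum>s\<in>F. \<Sum>s'\<in>F. (f x - f (s' - s)) * (\<phi> s (y - x) * \<phi> s' y))"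
            by (simp add: left_diff_distrib sum_subtractf)
          also have "\<bar>\<dots>\<bar> \<le> (\<Sum>s\<in>F. \<Sum>s'\<in>F. e * (\<phi> s (y - x) * \<phi> s' y))"
          proof (intro order_trans[OF sum_abs] sum_mono)
            fix s s' assume s: "s \<in> F" "s' \<in> F"
            have nn: "0 \<le> \<phi> s (y - x) * \<phi> s' y" using F(4) s by simp
            show "\<bar>(f x - f (s' - s)) * (\<phi> s (y - x) * \<phi> s' y)\<bar> \<le> e * (\<phi> s (y - x) * \<phi> s' y)"
            proof (cases "y - x \<in> U s \<and> y \<in> U s'")
              case u: True
              have "\<bar>f (y - (y - x)) - f (s' - s)\<bar> \<le> e" using u True s by (intro near) auto
              then have "\<bar>f x - f (s' - s)\<bar> \<le> e" by simp
              then have "\<bar>f x - f (s' - s)\<bar> * (\<phi> s (y - x) * \<phi> s' y) \<le> e * (\<phi> s (y - x) * \<phi> s' y)"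
                using nn by (rule mult_right_mono)
              then show ?thesis by (simp only: abs_mult[of "f x - f (s' - s)"] abs_of_nonneg[OF nn])
            next
              case False
              then show ?thesis using F(5)[OF s(1), of "y - x"] F(5)[OF s(2), of y] by auto
            qed
          qed
          also have "\<dots> = e"
            using F(7) True by (simp add: sum_product[symmetric] sum_distrib_left[symmetric])
          finally have "\<bar>f x - ?k y\<bar> * (v (y - x) * v y) \<le> e * (v (y - x) * v y)"
            using v(2) by (intro mult_right_mono) auto
          moreover have "\<bar>f x * (v (y - x) * v y) - ?k y * (v (y - x) * v y)\<bar> = \<bar>f x - ?k y\<bar> * (v (y - x) * v y)"
            using v(2) unfolding left_diff_distrib[symmetric] abs_mult by simp
          ultimately show ?thesis by linarith
        next
          case False
          then have "v (y - x) * v y = 0" using S(2) by auto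
          then show ?thesis by (simp only: mult_zero_right diff_self abs_zero order_refl)
        qed
      qed
      also have "\<dots> = e * corr v v x" unfolding corr_def by simp
      also have "\<dots> \<le> e * M" using M(2)[of x] e by (intro mult_left_mono) auto
      finally show ?thesis .
    qed
    have fb: "(\<lambda>x. f x * corr v v x) \<in> bdd_borel" by (rule Ccr_bdd_borel[OF Ccr_mult[OF cC f(1)]])
    have gb: "g \<in> bdd_borel" by (rule Ccr_bdd_borel[OF gC])
    have "\<bar>sint m (\<lambda>x. f x * corr v v x - g x)\<bar> \<le> ?t * (e * M)"
      by (rule sint_abs_le[OF m bdd_borel_diff[OF fb gb] diff])
    then show ?thesis using g_pos unfolding sint_diff[OF m fb gb] by linarith
  qed
  show ?thesis by (rule nonneg_if_approx[of "?t * M"]) (use M(1) approx in \<open>simp_all add: mult_ac\<close>)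
qed

subsection \<open>Amenability\<close>

text \<open>Inner regularity of the nonzero measure on the whole space supplies a compact set of
  positive measure, above whose indicator a bump is placed.\<close>

lemma normalized_Ccr:
  obtains g where "g \<in> Ccr" "\<And>x. 0 \<le> g x" "integral\<^sup>L H g = 1"
proof -
  note h = haar[unfolded haar_measure_def]
  have "emeasure H UNIV = (SUP K \<in> {K. compact K \<and> K \<subseteq> UNIV}. emeasure H K)"
    using h[THEN conjunct2, THEN conjunct2, THEN conjunct2, THEN conjunct2, THEN conjunct2, THEN spec[of _ UNIV]]
    by simp
  moreover have "emeasure H UNIV \<noteq> 0" by (rule h[THEN conjunct2, THEN conjunct1])
  ultimately obtain K where K: "compact K" "emeasure H K \<noteq> 0"
    by (metis (no_types, lifting) SUP_bot_conv(1) bot_ennreal mem_Collect_eq)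
  obtain \<phi> :: "'a \<Rightarrow> real" where \<phi>: "\<phi> \<in> Ccr" "\<And>x. 0 \<le> \<phi> x" "\<And>x. x \<in> K \<Longrightarrow> \<phi> x = 1"
    using Urysohn_compact[OF lc K(1) open_UNIV] by (metis subset_UNIV)
  have fin: "emeasure H K < \<infinity>" by (rule compact_finite[OF K(1)])
  have KH: "K \<in> sets H" using borel_compact[OF K(1)] by simp
  have "0 < measure H K" using fin K(2)
    by (simp add: measure_def enn2real_positive_iff less_top zero_less_iff_neq_zero)
  also have "measure H K = (LINT x|H. indicator K x)" using KH by simp
  also have "\<dots> \<le> integral\<^sup>L H \<phi>"
  proof (rule integral_mono)
    show "integrable H (indicator K :: 'a \<Rightarrow> real)" using KH fin by simp
    show "integrable H \<phi>" by (rule integrable_Ccr[OF \<phi>(1)])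
    show "indicator K x \<le> \<phi> x" for x using \<phi>(2,3) by (simp add: indicator_def)
  qed
  finally have p: "0 < integral\<^sup>L H \<phi>" .
  show ?thesis
  proof (rule that)
    show "(\<lambda>x. (1 / integral\<^sup>L H \<phi>) * \<phi> x) \<in> Ccr" by (rule Ccr_cmult[OF \<phi>(1)])
  qed (use \<phi> p in auto)
qed

text \<open>The L1 distance between \<open>g\<close> and its translate by \<open>z\<close>.\<close>

definition defect :: "('a \<Rightarrow> real) \<Rightarrow> 'a \<Rightarrow> real" where
  "defect g z = (LINT y|H. \<bar>g (y - z) - g y\<bar>)"

lemma Ccr_abs: "f \<in> Ccr \<Longrightarrow> (\<lambda>y. \<bar>f y\<bar> :: real) \<in> Ccr"
  by (rule Ccr_dominated, assumption, rule continuous_on_rabs[OF Ccr_continuous]) auto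

lemma defect_Ccr:
  fixes g :: "'a \<Rightarrow> real"
  assumes "g \<in> Ccr" shows "(\<lambda>y. \<bar>g (y - z) - g y\<bar> :: real) \<in> Ccr"
  by (rule Ccr_abs[OF Ccr_diff[OF Ccr_translate[OF assms] assms]])

lemma defect_translate:
  assumes "g \<in> Ccr"
  shows "(LINT y|H. \<bar>g (y - z - u) - g (y - u)\<bar>) = defect g z"
proof -
  have "(LINT y|H. \<bar>g (y - u - z) - g (y - u)\<bar>) = (LINT y|H. \<bar>g (y - z) - g y\<bar>)"
    by (rule integral_translate[OF defect_Ccr[OF assms]])
  then show ?thesis unfolding defect_def by (simp only: diff_diff_eq add.commute)
qed

lemma translate_defect_Ccr:
  fixes g :: "'a \<Rightarrow> real"
  assumes g: "g \<in> Ccr" shows "(\<lambda>y. \<bar>g (y - z - u) - g (y - u)\<bar> :: real) \<in> Ccr"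
  using Ccr_translate[OF defect_Ccr[OF g, where z = z], where x = u]
  by (simp add: diff_diff_eq add.commute)

lemma defect_triangle:
  assumes g: "g \<in> Ccr"
  shows "defect g (s + u) \<le> defect g s + defect g u"
proof -
  have "defect g (s + u) \<le> (LINT y|H. \<bar>g (y - s - u) - g (y - u)\<bar> + \<bar>g (y - u) - g y\<bar>)"
    unfolding defect_def
  proof (rule integral_mono)
    show "\<bar>g (y - (s + u)) - g y\<bar> \<le> \<bar>g (y - s - u) - g (y - u)\<bar> + \<bar>g (y - u) - g y\<bar>" for y
      unfolding diff_diff_eq by linarith
  qed (intro integrable_Ccr Ccr_add translate_defect_Ccr defect_Ccr g)+
  also have "\<dots> = (LINT y|H. \<bar>g (y - s - u) - g (y - u)\<bar>) + (LINT y|H. \<bar>g (y - u) - g y\<bar>)"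
    by (intro Bochner_Integration.integral_add integrable_Ccr translate_defect_Ccr defect_Ccr g)
  finally show ?thesis
    unfolding defect_translate[OF g] defect_def[symmetric] .
qed

text \<open>Averaging the translates by \<open>0, a, \<dots>, (n - 1) a\<close> makes \<open>g\<close> almost invariant under \<open>a\<close>; as the
  group is abelian, it does not increase the defect of any other translation.\<close>

lemma averaging:
  assumes g: "g \<in> Ccr" "\<And>x. 0 \<le> g x" "integral\<^sup>L H g = 1" and e: "0 < e"
  obtains g' where "g' \<in> Ccr" "\<And>x. 0 \<le> g' x" "integral\<^sup>L H g' = 1"
    "\<And>z. defect g' z \<le> defect g z" "defect g' a \<le> e"
proof -
  \<comment> \<open>Telescoping will leave two translates of \<open>g\<close>, of total integral 2,
    divided by \<open>n\<close>.\<close>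
  obtain n where n: "2 / e < real n" using reals_Archimedean2 by blast
  let ?N = "real n"
  have N: "0 < ?N" using n e by (meson divide_pos_pos less_trans zero_less_numeral)
  define p :: "nat \<Rightarrow> 'a" where "p k = (\<Sum>i<k. a)" for k
  have p_Suc: "p (Suc k) = a + p k" for k unfolding p_def by (simp add: add.commute)
  define g' where "g' y = (1 / ?N) * (\<Sum>k<n. g (y - p k))" for y
  have g'C: "g' \<in> Ccr" unfolding g'_def by (intro Ccr_cmult Ccr_sum Ccr_translate g)
  have int_g': "integral\<^sup>L H g' = 1"
  proof -
    have "integral\<^sup>L H g' = (1 / ?N) * (\<Sum>k<n. (LINT y|H. g (y - p k)))"
      unfolding g'_def by (simp add: Bochner_Integration.integral_sum integrable_Ccr[OF Ccr_translate[OF g(1)]])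
    then show ?thesis using N by (simp add: integral_translate[OF g(1)] g(3))
  qed
  have 1: "defect g' z \<le> defect g z" for z
  proof -
    have "defect g' z \<le> (LINT y|H. (1 / ?N) * (\<Sum>k<n. \<bar>g (y - z - p k) - g (y - p k)\<bar>))"
      unfolding defect_def
    proof (rule integral_mono)
      fix y
      have "g' (y - z) - g' y = (1 / ?N) * (\<Sum>k<n. g (y - z - p k) - g (y - p k))"
        unfolding g'_def by (simp only: sum_subtractf right_diff_distrib)
      then have "\<bar>g' (y - z) - g' y\<bar> = (1 / ?N) * \<bar>\<Sum>k<n. g (y - z - p k) - g (y - p k)\<bar>"
        using N by (simp add: abs_mult)
      also have "\<dots> \<le> (1 / ?N) * (\<Sum>k<n. \<bar>g (y - z - p k) - g (y - p k)\<bar>)"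
        using N by (intro mult_left_mono sum_abs) simp
      finally show "\<bar>g' (y - z) - g' y\<bar> \<le> (1 / ?N) * (\<Sum>k<n. \<bar>g (y - z - p k) - g (y - p k)\<bar>)" .
    qed (intro integrable_Ccr Ccr_cmult Ccr_sum translate_defect_Ccr defect_Ccr g g'C)+
    also have "\<dots> = (1 / ?N) * (\<Sum>k<n. (LINT y|H. \<bar>g (y - z - p k) - g (y - p k)\<bar>))"
      by (simp add: Bochner_Integration.integral_sum integrable_Ccr[OF translate_defect_Ccr[OF g(1)]])
    also have "\<dots> = defect g z"
      unfolding defect_translate[OF g(1)] using N by simp
    finally show ?thesis .
  qed
  have 2: "defect g' a \<le> e"
  proof -
    have "defect g' a \<le> (LINT y|H. (1 / ?N) * (g (y - p n) + g y))"
      unfolding defect_def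
    proof (rule integral_mono)
      fix y
      have "g' (y - a) - g' y = (1 / ?N) * (\<Sum>k<n. g (y - p (Suc k)) - g (y - p k))"
        unfolding g'_def p_Suc diff_diff_eq by (simp only: sum_subtractf right_diff_distrib)
      also have "(\<Sum>k<n. g (y - p (Suc k)) - g (y - p k)) = g (y - p n) - g (y - p 0)"
        by (rule sum_lessThan_telescope)
      finally have "\<bar>g' (y - a) - g' y\<bar> = (1 / ?N) * \<bar>g (y - p n) - g y\<bar>"
        using N by (simp add: abs_mult p_def)
      also have "\<dots> \<le> (1 / ?N) * (g (y - p n) + g y)"
      proof (rule mult_left_mono)
        show "\<bar>g (y - p n) - g y\<bar> \<le> g (y - p n) + g y" using g(2)[of y] g(2)[of "y - p n"] by linarith
      qed (use N in simp)
      finally show "\<bar>g' (y - a) - g' y\<bar> \<le> (1 / ?N) * (g (y - p n) + g y)" .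
    qed (intro integrable_Ccr Ccr_cmult Ccr_add Ccr_translate defect_Ccr g g'C)+
    also have "\<dots> = (1 / ?N) * ((LINT y|H. g (y - p n)) + integral\<^sup>L H g)"
      by (simp add: integrable_Ccr[OF Ccr_translate[OF g(1)]] integrable_Ccr[OF g(1)])
    also have "\<dots> = 2 / ?N" unfolding integral_translate[OF g(1)] g(3) by simp
    also have "\<dots> \<le> e" using n e N by (simp add: field_simps)
    finally show ?thesis .
  qed
  show ?thesis
    by (rule that[OF g'C _ int_g' 1 2]) (use g(2) N in \<open>auto simp: g'_def intro!: sum_nonneg divide_nonneg_nonneg\<close>)
qed

text \<open>The elements of \<open>F\<close> are treated one at a time; a later averaging does not
  spoil an earlier one, since it increases no defect. The comparison with \<open>\<phi>\<close> is
  carried along so that a neighbourhood chosen for \<open>\<phi>\<close> before \<open>F\<close>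
  still works for \<open>g\<close>.\<close>

lemma almost_invariant_finite:
  assumes "finite F" and \<phi>: "\<phi> \<in> Ccr" "\<And>x. 0 \<le> \<phi> x" "integral\<^sup>L H \<phi> = 1" and e: "0 < e"
  shows "\<exists>g. g \<in> Ccr \<and> (\<forall>x. 0 \<le> g x) \<and> integral\<^sup>L H g = 1 \<and>
    (\<forall>z. defect g z \<le> defect \<phi> z) \<and> (\<forall>a\<in>F. defect g a \<le> e)"
  using assms(1)
proof (induction F)
  case empty
  then show ?case using \<phi> by auto
next
  case (insert a F)
  then obtain g where g: "g \<in> Ccr" "\<And>x. 0 \<le> g x" "integral\<^sup>L H g = 1"
    "\<And>z. defect g z \<le> defect \<phi> z" "\<And>a. a \<in> F \<Longrightarrow> defect g a \<le> e" by blast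
  obtain g' where g': "g' \<in> Ccr" "\<And>x. 0 \<le> g' x" "integral\<^sup>L H g' = 1"
    "\<And>z. defect g' z \<le> defect g z" "defect g' a \<le> e"
    using averaging[OF g(1-3) e] by metis
  have "defect g' z \<le> defect \<phi> z" for z by (rule order_trans[OF g'(4) g(4)])
  moreover have "defect g' b \<le> e" if "b \<in> insert a F" for b
    using that g'(5) order_trans[OF g'(4) g(5)] by blast
  ultimately show ?case using g'(1-3) by blast
qed

text \<open>Off the carrier \<open>K\<close> of \<open>\<phi>\<close> the difference
  \<open>\<phi> (y - z) - \<phi> y\<close> is nonnegative, so its absolute value exceeds it only on
  \<open>K\<close>, by at most \<open>2 * d\<close>. The difference integrates to zero, and only
  this excess remains.\<close>

lemma defect_small:
  assumes \<phi>: "\<phi> \<in> Ccr" "\<And>x. 0 \<le> \<phi> x" "integral\<^sup>L H \<phi> = 1" and e: "0 < e"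
  obtains V where "open V" "0 \<in> V" "\<And>z. z \<in> V \<Longrightarrow> defect \<phi> z \<le> e"
proof -
  obtain K where K: "compact K" "\<And>x. x \<notin> K \<Longrightarrow> \<phi> x = 0" using CcrE[OF \<phi>(1)] by blast
  obtain h :: "'a \<Rightarrow> real" where h: "h \<in> Ccr" "\<And>x. 0 \<le> h x" "\<And>x. x \<in> K \<Longrightarrow> h x = 1"
    using Urysohn_compact[OF lc K(1) open_UNIV] by (metis subset_UNIV)
  have I: "0 \<le> integral\<^sup>L H h" using h(2) by (rule Bochner_Integration.integral_nonneg)
  define d where "d = e / (2 * (integral\<^sup>L H h + 1))"
  have d: "0 < d" unfolding d_def using I e by (intro divide_pos_pos mult_pos_pos) linarith+
  have dI: "2 * (d * integral\<^sup>L H h) \<le> e"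
  proof -
    have "2 * (d * integral\<^sup>L H h) \<le> 2 * (d * (integral\<^sup>L H h + 1))" using d by simp
    also have "\<dots> = e"
    proof -
      have "2 * (e / (2 * X) * X) = e" if "X \<noteq> 0" for X :: real using that by simp
      moreover have "integral\<^sup>L H h + 1 \<noteq> 0" using I by linarith
      ultimately show ?thesis unfolding d_def by blast
    qed
    finally show ?thesis .
  qed
  obtain V where V: "open V" "0 \<in> V" "\<And>x z. z \<in> V \<Longrightarrow> \<bar>\<phi> (x + z) - \<phi> x\<bar> < d"
    using Ccr_uniformly_continuous[OF \<phi>(1) d] by metis
  \<comment> \<open>Uniform continuity speaks of \<open>x + z\<close>, the defect of
    \<open>y - z\<close>.\<close>
  have V': "open (uminus -` V)" by (intro open_vimage V continuous_intros)
  show ?thesis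
  proof (rule that[OF V'])
    show "0 \<in> uminus -` V" using V(2) by simp
    fix z assume "z \<in> uminus -` V"
    then have z: "- z \<in> V" by simp
    have "defect \<phi> z \<le> (LINT y|H. (\<phi> (y - z) - \<phi> y) + 2 * (d * h y))"
      unfolding defect_def
    proof (rule integral_mono)
      fix y
      show "\<bar>\<phi> (y - z) - \<phi> y\<bar> \<le> (\<phi> (y - z) - \<phi> y) + 2 * (d * h y)"
      proof (cases "y \<in> K")
        case True
        have "\<bar>\<phi> (y - z) - \<phi> y\<bar> < d" using V(3)[OF z, of y] by simp
        then show ?thesis using h(3)[OF True] by simp
      next
        case False
        then show ?thesis using K(2)[OF False] \<phi>(2)[of "y - z"] h(2)[of y] d by simp
      qed
    qed (intro integrable_Ccr Ccr_add Ccr_diff Ccr_cmult Ccr_translate defect_Ccr \<phi> h)+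
    also have "\<dots> = (LINT y|H. \<phi> (y - z)) - integral\<^sup>L H \<phi> + 2 * (d * integral\<^sup>L H h)"
      by (simp add: integrable_Ccr \<phi>(1) h(1) Ccr_translate)
    also have "\<dots> \<le> e" unfolding integral_translate[OF \<phi>(1)] using dI by simp
    finally show "defect \<phi> z \<le> e" .
  qed
qed

text \<open>Reiter's condition. The square root turns almost invariance in \<open>L\<^sup>1\<close> into almost invariance
  in \<open>L\<^sup>2\<close>, because \<open>(sqrt a - sqrt b)\<^sup>2 \<le> \<bar>a - b\<bar>\<close>.\<close>

lemma reiter:
  assumes S: "compact S" and e: "0 < e"
  obtains v where "v \<in> Ccr" "\<And>x. 0 \<le> v x" "\<And>x. 0 \<le> corr v v x" "\<And>x. corr v v x \<le> 1"
    "\<And>x. x \<in> S \<Longrightarrow> 1 - e \<le> corr v v x"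
proof -
  obtain \<phi> where \<phi>: "\<phi> \<in> Ccr" "\<And>x. 0 \<le> \<phi> x" "integral\<^sup>L H \<phi> = 1" using normalized_Ccr by metis
  obtain V where V: "open V" "0 \<in> V" "\<And>z. z \<in> V \<Longrightarrow> defect \<phi> z \<le> e"
    using defect_small[OF \<phi> e] by metis
  define N where "N s = (\<lambda>y. - s + y) -` V" for s
  have "open (N s)" for s unfolding N_def by (rule open_translate[OF V(1)])
  moreover have "S \<subseteq> (\<Union>s\<in>S. N s)" unfolding N_def using V(2) by auto
  ultimately obtain F where F: "F \<subseteq> S" "finite F" "S \<subseteq> (\<Union>s\<in>F. N s)"
    using compactE_image[OF S] by metis
  obtain g where g: "g \<in> Ccr" "\<And>x. 0 \<le> g x" "integral\<^sup>L H g = 1"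
    "\<And>z. defect g z \<le> defect \<phi> z" "\<And>a. a \<in> F \<Longrightarrow> defect g a \<le> e"
    using almost_invariant_finite[OF F(2) \<phi> e] by blast
  \<comment> \<open>\<open>x\<close> is \<open>s\<close> plus an element of \<open>V\<close>: the
    defect of \<open>s\<close> is small by averaging, that of the rest by the choice of
    \<open>V\<close>.\<close>
  have gS: "defect g x \<le> 2 * e" if x: "x \<in> S" for x
  proof -
    obtain s where s: "s \<in> F" "x \<in> N s" using F(3) x by blast
    then have "- s + x \<in> V" unfolding N_def by simp
    then have "defect g (- s + x) \<le> e" using V(3) g(4) order_trans by blast
    moreover have "defect g (s + (- s + x)) \<le> defect g s + defect g (- s + x)"
      by (rule defect_triangle[OF g(1)])
    ultimately show ?thesis using g(5)[OF s(1)] by simp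
  qed
  define v where "v y = sqrt (g y)" for y
  have v: "v \<in> Ccr" unfolding v_def
    by (rule Ccr_dominated[OF g(1)]) (auto intro: continuous_on_real_sqrt Ccr_continuous[OF g(1)])
  have v0: "0 \<le> v y" for y unfolding v_def using g(2) by simp
  have v2: "v y * v y = g y" for y unfolding v_def using g(2) by simp
  have vt: "(\<lambda>y. v (y - x) * v y) \<in> Ccr" for x by (rule corr_Ccr[OF v v])
  \<comment> \<open>The square of \<open>v\<close> integrates to 1, so expanding expresses the
    squared L2 distance by \<open>corr v v x\<close>; the bound \<open>2 * e\<close> for the defect
    thus leaves an error of \<open>e\<close>.\<close>
  have sq: "(LINT y|H. (v (y - x) - v y) * (v (y - x) - v y)) = 2 - 2 * corr v v x" for x
  proof -
    have "(LINT y|H. (v (y - x) - v y) * (v (y - x) - v y)) = (LINT y|H. (g (y - x) + g y) - 2 * (v (y - x) * v y))"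
      unfolding v2[symmetric] by (intro Bochner_Integration.integral_cong refl) (simp add: algebra_simps)
    also have "\<dots> = (LINT y|H. g (y - x)) + integral\<^sup>L H g - 2 * corr v v x"
      unfolding corr_def by (simp add: integrable_Ccr Ccr_translate g(1) vt)
    finally show ?thesis unfolding integral_translate[OF g(1)] g(3) by simp
  qed
  have c1: "corr v v x \<le> 1" for x
  proof -
    have "0 \<le> (LINT y|H. (v (y - x) - v y) * (v (y - x) - v y))"
      by (intro Bochner_Integration.integral_nonneg zero_le_square)
    then show ?thesis unfolding sq by simp
  qed
  have cS: "1 - e \<le> corr v v x" if "x \<in> S" for x
  proof -
    have "(LINT y|H. (v (y - x) - v y) * (v (y - x) - v y)) \<le> defect g x"
      unfolding defect_def
    proof (rule integral_mono)
      show "integrable H (\<lambda>y. (v (y - x) - v y) * (v (y - x) - v y))"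
        by (intro integrable_Ccr Ccr_mult Ccr_continuous[OF Ccr_diff[OF Ccr_translate[OF v] v]] Ccr_diff Ccr_translate v)
      show "integrable H (\<lambda>y. \<bar>g (y - x) - g y\<bar>)" by (intro integrable_Ccr defect_Ccr g)
      fix y
      let ?a = "v (y - x)" and ?b = "v y"
      have "\<bar>?a - ?b\<bar> \<le> ?a + ?b" using v0[of y] v0[of "y - x"] by linarith
      then have "\<bar>?a - ?b\<bar> * \<bar>?a - ?b\<bar> \<le> (?a + ?b) * \<bar>?a - ?b\<bar>" by (rule mult_right_mono) simp
      also have "\<dots> = \<bar>(?a + ?b) * (?a - ?b)\<bar>" using v0[of y] v0[of "y - x"] by (simp add: abs_mult)
      also have "(?a + ?b) * (?a - ?b) = g (y - x) - g y" unfolding v2[symmetric] by (simp add: algebra_simps)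
      finally show "(?a - ?b) * (?a - ?b) \<le> \<bar>g (y - x) - g y\<bar>" by simp
    qed
    then show ?thesis using gS[OF that] unfolding sq by simp
  qed
  show ?thesis
  proof (rule that[OF v v0 _ c1 cS])
    show "0 \<le> corr v v x" for x unfolding corr_def using v0 by (intro Bochner_Integration.integral_nonneg) simp
  qed
qed

end

section \<open>Passage between real and complex test functions, and parity\<close>

lemma real_pd_bdd_borel:
  assumes "continuous_on UNIV f" "real_pd f" shows "f \<in> bdd_borel"
  by (rule bdd_borelI[OF borel_measurable_continuous_onI[OF assms(1)] real_pd_bound[OF assms(2)]])

lemma Cc_of_real:
  fixes w :: "'a::t2_space \<Rightarrow> real"
  assumes "w \<in> Ccr" shows "(\<lambda>x. complex_of_real (w x)) \<in> Cc"
proof -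
  obtain K where K: "compact K" "\<And>x. x \<notin> K \<Longrightarrow> w x = 0" using CcrE[OF assms] by blast
  have "closure {x. complex_of_real (w x) \<noteq> 0} \<subseteq> K"
    using K by (intro closure_minimal compact_imp_closed) auto
  then have "compact (closure {x. complex_of_real (w x) \<noteq> 0})"
    using compact_Int_closed[OF K(1) closed_closure] by (metis inf.absorb_iff2)
  then show ?thesis unfolding Cc_def using Ccr_continuous[OF assms] by (simp add: continuous_on_of_real)
qed

lemma Ccr_of_Cc:
  assumes "u \<in> Cc" shows "(\<lambda>x. Re (u x)) \<in> Ccr" "(\<lambda>x. Im (u x)) \<in> Ccr"
proof -
  have c: "continuous_on UNIV u" "compact (closure {x. u x \<noteq> 0})" using assms unfolding Cc_def by auto
  have z: "u x = 0" if "x \<notin> closure {x. u x \<noteq> 0}" for x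
    using that subsetD[OF closure_subset, of x "{x. u x \<noteq> 0}"] by blast
  show "(\<lambda>x. Re (u x)) \<in> Ccr"
    by (rule CcrI[OF continuous_on_Re[OF c(1)] c(2)]) (drule z, simp)
  show "(\<lambda>x. Im (u x)) \<in> Ccr"
    by (rule CcrI[OF continuous_on_Im[OF c(1)] c(2)]) (drule z, simp)
qed

lemma Ccr_uminus:
  fixes w :: "'a::{topological_ab_group_add,t2_space} \<Rightarrow> real"
  assumes "w \<in> Ccr" shows "(\<lambda>x. w (- x)) \<in> Ccr"
proof -
  obtain K where K: "compact K" "\<And>x. x \<notin> K \<Longrightarrow> w x = 0" using CcrE[OF assms] by blast
  show ?thesis
  proof (rule CcrI)
    show "continuous_on UNIV (\<lambda>x. w (- x))"
      by (rule continuous_on_compose2[OF Ccr_continuous[OF assms]]) (auto intro: continuous_intros)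
    show "compact (uminus ` K)" by (intro compact_continuous_image continuous_intros K)
    show "w (- x) = 0" if "x \<notin> uminus ` K" for x
      using that by (intro K(2)) (simp add: uminus_image_eq_vimage)
  qed
qed

text \<open>Reflecting the measure multiplies the integral by \<open>c\<close>, reflecting the
  function by \<open>- c\<close>. The values 1 and -1 of \<open>c\<close> cover even measures with
  odd functions and odd measures with even ones.\<close>

lemma sint_even_odd:
  fixes m :: "'a::{topological_ab_group_add,t2_space} set \<Rightarrow> real"
  assumes m: "bounded_regular_measure m" and c: "\<And>E. E \<in> sets borel \<Longrightarrow> m (uminus ` E) = c * m E"
    and f: "f \<in> bdd_borel" "\<And>x. f (- x) = - c * f x" and "c \<noteq> 0"
  shows "sint m f = 0"
proof -
  note fm = bounded_regular_measureD[OF m]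
  note fr = bounded_regular_measureD[OF bounded_regular_measure_reflect[OF m]]
  have "sint (\<lambda>E. m (uminus ` E)) f = c * sint m f + 0 * sint m f"
    by (rule sint_lincomb[OF fm fm fr]) (use c f in auto)
  moreover have "sint (\<lambda>E. m (uminus ` E)) f = - c * sint m f"
    unfolding sint_reflect[OF m f(1)] f(2) by (rule sint_cmult)
  ultimately show ?thesis using \<open>c \<noteq> 0\<close> by simp
qed

section \<open>Measures of positive type, and the inequality from the decomposition\<close>

context haar begin

text \<open>\<open>reiter\<close> gives a correlation close to 1 on a compact \<open>K\<close> off
  which \<open>m\<close> is small, and \<open>localized_positivity\<close> handles the product with
  \<open>f\<close>. Pointwise, replacing \<open>f\<close> by the product costs at most
  \<open>f 0 * e\<close> on \<open>K\<close> and \<open>f 0\<close> elsewhere.\<close>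

lemma integral_real_pd_nonneg:
  assumes m: "bounded_regular_measure m" and pos: "\<And>w. w \<in> Ccr \<Longrightarrow> 0 \<le> sint m (corr w w)"
    and f: "continuous_on UNIV f" "real_pd f"
  shows "0 \<le> sint m f"
proof -
  note fm = bounded_regular_measureD[OF m]
  note fb = real_pd_bdd_borel[OF f]
  let ?t = "\<lambda>E. variation m E"
  have f0: "0 \<le> f 0" using real_pd_bound[OF f(2), of 0] by simp
  have approx: "- ((?t UNIV * f 0 + 2 * f 0) * e) \<le> sint m f" if e: "0 < e" for e
  proof -
    obtain K U where K: "compact K" "UNIV \<subseteq> U" "\<And>B. B \<in> sets borel \<Longrightarrow> B \<subseteq> U - K \<Longrightarrow> \<bar>m B\<bar> \<le> e"
      using bounded_regular_measure_approx[OF m _ e, of UNIV] by (metis borel_open open_UNIV)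
    have KB: "K \<in> sets borel" "- K \<in> sets borel" using borel_compact[OF K(1)] by auto
    \<comment> \<open>Values of \<open>m\<close> up to \<open>e\<close> on subsets allow a variation
      up to \<open>2 * e\<close>; hence the 2 in the constant of \<open>approx\<close>.\<close>
    have tK: "?t (- K) \<le> 2 * e"
    proof (rule total_variation_real_le[OF fm KB(2)])
      fix B assume B: "B \<in> sets borel" "B \<subseteq> - K"
      then have "B \<subseteq> U - K" using K(2) by blast
      then show "\<bar>m B\<bar> \<le> e" by (rule K(3)[OF B(1)])
    qed
    obtain v where v: "v \<in> Ccr" "\<And>x. 0 \<le> v x" "\<And>x. 0 \<le> corr v v x" "\<And>x. corr v v x \<le> 1"
      "\<And>x. x \<in> K \<Longrightarrow> 1 - e \<le> corr v v x" using reiter[OF K(1) e] by metis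
    note cb = Ccr_bdd_borel[OF corr_in_Ccr[OF v(1) v(1)]]
    define h where "h x = f x * (1 - corr v v x)" for x
    have hb: "h \<in> bdd_borel" unfolding h_def
      by (intro bdd_borel_mult bdd_borel_diff bdd_borel_const fb cb)
    have hx: "\<bar>h x\<bar> \<le> f 0 * (1 - corr v v x)" for x
      unfolding h_def abs_mult using real_pd_bound[OF f(2), of x] v(4)[of x]
      by (simp add: mult_right_mono)
    define h1 where "h1 x = indicator K x * h x" for x
    define h2 where "h2 x = indicator (- K) x * h x" for x
    have h1b: "h1 \<in> bdd_borel" "h2 \<in> bdd_borel" unfolding h1_def h2_def
      by (intro bdd_borel_mult bdd_borel_indicator hb KB)+
    have "\<bar>h1 x\<bar> \<le> f 0 * e" for x
    proof (cases "x \<in> K")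
      case True
      have "f 0 * (1 - corr v v x) \<le> f 0 * e" using v(5)[OF True] f0 by (intro mult_left_mono) auto
      then show ?thesis using hx[of x] True by (simp add: h1_def)
    next
      case False
      then show ?thesis using f0 e by (simp add: h1_def)
    qed
    then have s1: "\<bar>sint m h1\<bar> \<le> ?t UNIV * (f 0 * e)" by (rule sint_abs_le[OF fm h1b(1)])
    have "\<bar>h2 x\<bar> \<le> f 0 * indicator (- K) x" for x
    proof -
      have "f 0 * (1 - corr v v x) \<le> f 0 * 1" using v(3)[of x] f0 by (intro mult_left_mono) auto
      then show ?thesis using hx[of x] f0 by (simp add: h2_def indicator_def)
    qed
    then have "\<bar>sint m h2\<bar> \<le> ?t (- K) * f 0" by (rule sint_abs_le_on[OF fm h1b(2) KB(2)])
    also have "\<dots> \<le> 2 * e * f 0" using tK f0 by (rule mult_right_mono)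
    finally have s2: "\<bar>sint m h2\<bar> \<le> 2 * e * f 0" .
    have fc: "(\<lambda>x. f x * corr v v x) \<in> bdd_borel" by (intro bdd_borel_mult fb cb)
    have "f = (\<lambda>x. f x * corr v v x + (h1 x + h2 x))"
      by (rule ext) (simp add: h1_def h2_def h_def indicator_def algebra_simps)
    then have "sint m f = sint m (\<lambda>x. f x * corr v v x + (h1 x + h2 x))" by (rule arg_cong)
    also have "\<dots> = sint m (\<lambda>x. f x * corr v v x) + (sint m h1 + sint m h2)"
      by (simp only: sint_add[OF fm fc bdd_borel_add[OF h1b]] sint_add[OF fm h1b])
    finally have "sint m f = sint m (\<lambda>x. f x * corr v v x) + (sint m h1 + sint m h2)" .
    moreover have "0 \<le> sint m (\<lambda>x. f x * corr v v x)"
      by (rule localized_positivity[OF fm pos f v(1,2)])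
    moreover have "(?t UNIV * f 0 + 2 * f 0) * e = ?t UNIV * (f 0 * e) + 2 * e * f 0"
      by (simp add: algebra_simps)
    ultimately show ?thesis using s1 s2 by linarith
  qed
  show ?thesis by (rule nonneg_if_approx[OF _ approx]) (use f0 in simp_all)
qed

text \<open>Substituting \<open>y \<mapsto> u (- y)\<close> turns the convolution into a correlation, for which
  translation invariance of \<open>H\<close> suffices.\<close>

lemma convolution_involution:
  assumes "u \<in> Cc"
  defines "p \<equiv> \<lambda>y. Re (u (- y))" and "q \<equiv> \<lambda>y. Im (u (- y))"
  shows "p \<in> Ccr" "q \<in> Ccr"
    "convolution H u (involution u) x = Complex (corr p p x + corr q q x) (corr q p x - corr p q x)"
proof -
  show p: "p \<in> Ccr" and q: "q \<in> Ccr"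
    unfolding p_def q_def using Ccr_uminus Ccr_of_Cc[OF assms(1)] by blast+
  have "convolution H u (involution u) x =
    (LINT y|H. Complex (p (y - x) * p y + q (y - x) * q y) (q (y - x) * p y - p (y - x) * q y))"
    unfolding convolution_def involution_def
    by (intro Bochner_Integration.integral_cong refl) (simp add: p_def q_def complex_eq_iff)
  also have "\<dots> = Complex (corr p p x + corr q q x) (corr q p x - corr p q x)"
    unfolding corr_def
    by (subst integral_Complex) (simp_all add: corr_integrable p q)
  finally show "convolution H u (involution u) x = Complex (corr p p x + corr q q x) (corr q p x - corr p q x)" .
qed

text \<open>The reflection of \<open>w\<close> is the test function whose convolution with its
  involution is \<open>corr w w\<close>.\<close>

lemma positive_type_corr:
  assumes "positive_type H m" and w: "w \<in> Ccr"
  shows "0 \<le> sint m (corr w w)"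
proof -
  let ?u = "\<lambda>y. complex_of_real (w (- y))"
  have u: "?u \<in> Cc" by (rule Cc_of_real[OF Ccr_uminus[OF w]])
  have "corr (\<lambda>y. 0) v x = 0" "corr v (\<lambda>y. 0) x = 0" for v x unfolding corr_def by simp_all
  then have "convolution H ?u (involution ?u) = (\<lambda>x. complex_of_real (corr w w x))"
    using convolution_involution(3)[OF u] by (intro ext) (simp add: complex_of_real_def)
  then show ?thesis using assms(1) u unfolding positive_type_def
    by (metis signed_integral_of_real less_eq_complex_def Re_complex_of_real zero_complex.sel(1))
qed

text \<open>The imaginary part of the convolution is an odd function, which the even measure
  \<open>m\<close> annihilates; the real part is a sum of two correlations, hence positive
  definite.\<close>

lemma positive_typeI:
  assumes m: "bounded_regular_measure m" and even: "\<And>E. E \<in> sets borel \<Longrightarrow> m (uminus ` E) = m E"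
    and pos: "\<And>f. f \<in> Ccr \<Longrightarrow> real_pd f \<Longrightarrow> 0 \<le> sint m f"
  shows "positive_type H m"
  unfolding positive_type_def
proof
  fix u :: "'a \<Rightarrow> complex" assume u: "u \<in> Cc"
  let ?p = "\<lambda>y. Re (u (- y))" and ?q = "\<lambda>y. Im (u (- y))"
  note pq = convolution_involution(1,2)[OF u]
  let ?F = "\<lambda>x. corr ?p ?p x + corr ?q ?q x" and ?G = "\<lambda>x. corr ?q ?p x - corr ?p ?q x"
  have F: "?F \<in> Ccr" "real_pd ?F"
    by (intro Ccr_add corr_in_Ccr pq, intro real_pd_add corr_real_pd pq)
  have G: "?G \<in> Ccr" by (intro Ccr_diff corr_in_Ccr pq)
  have "sint m ?G = 0"
    by (rule sint_even_odd[OF m, of 1])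
      (simp_all add: even Ccr_bdd_borel[OF G] corr_swap[OF pq] corr_swap[OF pq(2,1)])
  moreover have "convolution H u (involution u) = (\<lambda>x. Complex (?F x) (?G x))"
    by (rule ext) (rule convolution_involution(3)[OF u])
  ultimately have "signed_integral m (convolution H u (involution u)) = Complex (sint m ?F) 0"
    using signed_integral_Complex[OF bounded_regular_measureD[OF m] Ccr_bdd_borel[OF F(1)] Ccr_bdd_borel[OF G]]
    by simp
  then show "0 \<le> signed_integral m (convolution H u (involution u))"
    using pos[OF F] by (simp add: less_eq_complex_def)
qed

text \<open>Each summand meets its own property of \<open>f\<close>: nonnegativity, positive
  definiteness, and evenness, the last a consequence of the second.\<close>

lemma doubly_positive_integral_nonneg:
  assumes \<sigma>: "bounded_regular_measure \<sigma>" "nonnegative_measure \<sigma>"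
    and \<tau>: "bounded_regular_measure \<tau>" "positive_type H \<tau>"
    and \<omega>: "bounded_regular_measure \<omega>" "odd_measure \<omega>"
    and \<rho>: "bounded_regular_measure \<rho>" "\<And>E. E \<in> sets borel \<Longrightarrow> \<rho> E = \<sigma> E + \<tau> E + \<omega> E"
    and f: "continuous_on UNIV f" "real_pd f" "\<And>x. 0 \<le> f x"
  shows "0 \<le> sint \<rho> f"
proof -
  note fv = bounded_regular_measureD
  note fb = real_pd_bdd_borel[OF f(1,2)]
  let ?l = "\<lambda>E. 1 * \<sigma> E + 1 * \<tau> E"
  have l: "bounded_regular_measure ?l" by (rule bounded_regular_measure_lincomb[OF \<sigma>(1) \<tau>(1)])
  have "sint ?l f = 1 * sint \<sigma> f + 1 * sint \<tau> f"
    by (rule sint_lincomb[OF fv[OF \<sigma>(1)] fv[OF \<tau>(1)] fv[OF l] refl fb])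
  moreover have "sint \<rho> f = 1 * sint ?l f + 1 * sint \<omega> f"
    by (rule sint_lincomb[OF fv[OF l] fv[OF \<omega>(1)] fv[OF \<rho>(1)] _ fb]) (simp add: \<rho>(2))
  moreover have "0 \<le> sint \<sigma> f" by (rule sint_nonneg[OF fv[OF \<sigma>(1)] \<sigma>(2) f(3)])
  moreover have "0 \<le> sint \<tau> f"
    by (rule integral_real_pd_nonneg[OF \<tau>(1) positive_type_corr[OF \<tau>(2)] f(1,2)])
  moreover have "sint \<omega> f = 0"
    by (rule sint_even_odd[OF \<omega>(1) _ fb, of "-1"])
      (use \<omega>(2) real_pd_even[OF f(2)] in \<open>simp_all add: odd_measure_def\<close>)
  ultimately show ?thesis by simp
qed

lemma bcontfun_Ccr:
  fixes f :: "'a \<Rightarrow> real"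
  assumes "f \<in> Ccr" shows "f \<in> bcontfun"
proof -
  obtain B where "\<And>x. \<bar>f x\<bar> \<le> B" using Ccr_bounded[OF assms] by blast
  then show ?thesis unfolding bcontfun_def using Ccr_continuous[OF assms]
    by (auto simp: bounded_iff)
qed

subsection \<open>Existence of the decomposition\<close>

lemma dominating_functional:
  fixes \<rho> :: "'a set \<Rightarrow> real"
  assumes \<rho>: "bounded_regular_measure \<rho>"
    and pos: "\<And>f. continuous_on UNIV f \<Longrightarrow> real_pd f \<Longrightarrow> (\<And>x. 0 \<le> f x) \<Longrightarrow> 0 \<le> sint \<rho> f"
  shows "\<exists>\<Lambda> :: ('a \<Rightarrow>\<^sub>C real) \<Rightarrow> real. linear \<Lambda> \<and> (\<forall>h. (\<forall>x. 0 \<le> apply_bcontfun h x) \<longrightarrow> 0 \<le> \<Lambda> h) \<and>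
    (\<forall>h f. continuous_on UNIV f \<longrightarrow> real_pd f \<longrightarrow> (\<forall>x. apply_bcontfun h x \<le> f x) \<longrightarrow> \<Lambda> h \<le> sint \<rho> f)"
proof -
  note fr = bounded_regular_measureD[OF \<rho>]
  define A where "A h = {f. continuous_on UNIV f \<and> real_pd f \<and> (\<forall>x. apply_bcontfun h x \<le> f x)}" for h :: "'a \<Rightarrow>\<^sub>C real"
  define q where "q h = (INF f\<in>A h. sint \<rho> f)" for h
  have nb: "\<bar>apply_bcontfun h x\<bar> \<le> norm h" for h :: "'a \<Rightarrow>\<^sub>C real" and x
    using norm_bounded[of h x] by simp
  \<comment> \<open>The constant \<open>norm h\<close> is a competitor, so that \<open>q h\<close>
    is not an infimum over the empty set.\<close>
  have "(\<lambda>x. norm h) \<in> A h" for h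
    unfolding A_def using nb[of h] by (auto simp: real_pd_const abs_le_iff)
  then have ne: "A h \<noteq> {}" for h by blast
  have b: "f \<in> bdd_borel" if "f \<in> A h" for f h
    using that unfolding A_def by (auto intro: real_pd_bdd_borel)
  have bdd: "bdd_below (sint \<rho> ` A h)" for h
  proof (rule bdd_belowI2)
    fix f assume f: "f \<in> A h"
    then have fA: "continuous_on UNIV f" "real_pd f" "\<And>x. apply_bcontfun h x \<le> f x"
      unfolding A_def by auto
    \<comment> \<open>Adding the constant \<open>norm h\<close> makes \<open>f\<close> doubly
      positive, so that the hypothesis on \<open>\<rho>\<close> bounds the infimum from
      below.\<close>
    have nn: "0 \<le> f x + norm h" for x using nb[of h x] fA(3)[of x] by linarith
    have "0 \<le> sint \<rho> (\<lambda>x. f x + norm h)"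
      by (intro pos real_pd_add real_pd_const continuous_on_add continuous_on_const fA nn norm_ge_zero)
    also have "\<dots> = sint \<rho> f + sint \<rho> (\<lambda>x. norm h)" by (rule sint_add[OF fr b[OF f] bdd_borel_const])
    finally show "- sint \<rho> (\<lambda>x. norm h) \<le> sint \<rho> f" by simp
  qed
  have lower: "q h \<le> sint \<rho> f" if "f \<in> A h" for f h
    unfolding q_def by (rule cINF_lower[OF bdd that])
  have "sublinear q"
  proof (rule sublinearI)
    fix h k :: "'a \<Rightarrow>\<^sub>C real"
    have 1: "q (h + k) \<le> sint \<rho> f + sint \<rho> g" if f: "f \<in> A h" and g: "g \<in> A k" for f g
    proof -
      have "(\<lambda>x. f x + g x) \<in> A (h + k)"
        using f g unfolding A_def by (auto intro: continuous_on_add real_pd_add add_mono)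
      from lower[OF this] show ?thesis by (simp add: sint_add[OF fr b[OF f] b[OF g]])
    qed
    have "q (h + k) - sint \<rho> f \<le> q k" if f: "f \<in> A h" for f
      unfolding q_def[of k] using 1[OF f] by (intro cINF_greatest ne) (simp add: algebra_simps)
    then have "q (h + k) - q k \<le> q h"
      unfolding q_def[of h] by (intro cINF_greatest ne) (simp add: algebra_simps)
    then show "q (h + k) \<le> q h + q k" by simp
  next
    fix t :: real and h :: "'a \<Rightarrow>\<^sub>C real" assume t: "0 < t"
    have "q (t *\<^sub>R h) / t \<le> sint \<rho> f" if f: "f \<in> A h" for f
    proof -
      have "(\<lambda>x. t * f x) \<in> A (t *\<^sub>R h)"
        using f t unfolding A_def by (auto intro: continuous_intros real_pd_cmult mult_left_mono)
      from lower[OF this] show ?thesis using t by (simp add: sint_cmult divide_le_eq mult.commute)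
    qed
    then have "q (t *\<^sub>R h) / t \<le> q h" unfolding q_def[of h] by (intro cINF_greatest ne)
    then show "q (t *\<^sub>R h) \<le> t * q h" using t by (simp add: divide_le_eq mult.commute)
  qed
  then obtain \<Lambda> where \<Lambda>: "linear \<Lambda>" "\<And>h. \<Lambda> h \<le> q h" using Hahn_Banach_sublinear by blast
  have dom: "\<Lambda> h \<le> sint \<rho> f" if "continuous_on UNIV f" "real_pd f" "\<forall>x. apply_bcontfun h x \<le> f x" for h f
    using order_trans[OF \<Lambda>(2) lower[of f h]] that unfolding A_def by blast
  have "0 \<le> \<Lambda> h" if "\<forall>x. 0 \<le> apply_bcontfun h x" for h
  proof -
    \<comment> \<open>The function 0 is positive definite and lies above \<open>- h\<close>.\<close>
    have "\<Lambda> (- h) \<le> sint \<rho> (\<lambda>x. 0)" using that by (intro dom) (auto simp: real_pd_const)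
    then show ?thesis by (simp add: sint_def linear_neg[OF \<Lambda>(1)])
  qed
  then show ?thesis using \<Lambda>(1) dom by blast
qed

lemma exists_decomposition:
  fixes \<rho> :: "'a set \<Rightarrow> real"
  assumes \<rho>: "bounded_regular_measure \<rho>"
    and pos: "\<And>f. continuous_on UNIV f \<Longrightarrow> real_pd f \<Longrightarrow> (\<And>x. 0 \<le> f x) \<Longrightarrow> 0 \<le> sint \<rho> f"
  shows "\<exists>\<sigma> \<tau> \<omega>. bounded_regular_measure \<sigma> \<and> nonnegative_measure \<sigma> \<and>
    bounded_regular_measure \<tau> \<and> positive_type H \<tau> \<and> bounded_regular_measure \<omega> \<and> odd_measure \<omega> \<and>
    (\<forall>E\<in>sets borel. \<rho> E = \<sigma> E + \<tau> E + \<omega> E)"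
proof -
  note fv = bounded_regular_measureD
  have "\<exists>\<Lambda> :: ('a \<Rightarrow>\<^sub>C real) \<Rightarrow> real. linear \<Lambda> \<and> (\<forall>h. (\<forall>x. 0 \<le> apply_bcontfun h x) \<longrightarrow> 0 \<le> \<Lambda> h) \<and>
    (\<forall>h f. continuous_on UNIV f \<longrightarrow> real_pd f \<longrightarrow> (\<forall>x. apply_bcontfun h x \<le> f x) \<longrightarrow> \<Lambda> h \<le> sint \<rho> f)"
    by (rule dominating_functional[OF \<rho>]) (use pos in blast)
  then obtain \<Lambda> :: "('a \<Rightarrow>\<^sub>C real) \<Rightarrow> real" where \<Lambda>: "linear \<Lambda>"
    "\<And>h. (\<And>x. 0 \<le> apply_bcontfun h x) \<Longrightarrow> 0 \<le> \<Lambda> h"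
    "\<And>h f. continuous_on UNIV f \<Longrightarrow> real_pd f \<Longrightarrow> (\<And>x. apply_bcontfun h x \<le> f x) \<Longrightarrow> \<Lambda> h \<le> sint \<rho> f"
    by blast
  define L where "L f = \<Lambda> (Bcontfun f)" for f
  have app: "apply_bcontfun (Bcontfun f) = f" if "f \<in> Ccr" for f :: "'a \<Rightarrow> real"
    by (rule Bcontfun_inverse[OF bcontfun_Ccr[OF that]])
  \<comment> \<open>The value at the constant 1 bounds the mass of \<open>L\<close>, as
    \<open>1 - f\<close> is nonnegative.\<close>
  have "positive_functional L (\<Lambda> (const_bcontfun 1))"
  proof
    show "locally_compact_space (euclidean :: 'a topology)" by (rule lc)
    fix f g :: "'a \<Rightarrow> real" and c :: real assume f: "f \<in> Ccr"
    show "L (\<lambda>x. f x + g x) = L f + L g" if g: "g \<in> Ccr"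
    proof -
      have "Bcontfun (\<lambda>x. f x + g x) = Bcontfun f + Bcontfun g"
        by (rule bcontfun_eqI) (simp add: app f g Ccr_add)
      then show ?thesis unfolding L_def by (simp add: linear_add[OF \<Lambda>(1)])
    qed
    show "L (\<lambda>x. c * f x) = c * L f"
    proof -
      have "Bcontfun (\<lambda>x. c * f x) = c *\<^sub>R Bcontfun f"
        by (rule bcontfun_eqI) (simp add: app f Ccr_cmult)
      then show ?thesis unfolding L_def by (simp add: linear_cmul[OF \<Lambda>(1)])
    qed
    show "0 \<le> L f" if "\<And>x. 0 \<le> f x" unfolding L_def by (rule \<Lambda>(2)) (simp add: app f that)
    show "L f \<le> \<Lambda> (const_bcontfun 1)" if "\<And>x. f x \<le> 1"
    proof -
      have "0 \<le> \<Lambda> (const_bcontfun 1 - Bcontfun f)"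
        by (rule \<Lambda>(2)) (simp add: app f that const_bcontfun.rep_eq)
      then show ?thesis unfolding L_def by (simp add: linear_diff[OF \<Lambda>(1)])
    qed
  qed
  then obtain \<sigma> where \<sigma>: "bounded_regular_measure \<sigma>" "nonnegative_measure \<sigma>" "\<And>f. f \<in> Ccr \<Longrightarrow> sint \<sigma> f = L f"
    using Riesz_representation by blast
  define D where "D = (\<lambda>E. 1 * \<rho> E + (-1) * \<sigma> E)"
  define R where "R = (\<lambda>E. D (uminus ` E))"
  define \<tau> where "\<tau> = (\<lambda>E. (1/2) * D E + (1/2) * R E)"
  define \<omega> where "\<omega> = (\<lambda>E. (1/2) * D E + (-1/2) * R E)"
  have D: "bounded_regular_measure D" unfolding D_def by (rule bounded_regular_measure_lincomb[OF \<rho> \<sigma>(1)])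
  have R: "bounded_regular_measure R" unfolding R_def by (rule bounded_regular_measure_reflect[OF D])
  have \<tau>: "bounded_regular_measure \<tau>" unfolding \<tau>_def by (rule bounded_regular_measure_lincomb[OF D R])
  have \<omega>: "bounded_regular_measure \<omega>" unfolding \<omega>_def by (rule bounded_regular_measure_lincomb[OF D R])
  have "positive_type H \<tau>"
  proof (rule positive_typeI[OF \<tau>])
    show "\<tau> (uminus ` E) = \<tau> E" for E by (simp add: \<tau>_def R_def image_image)
    fix f :: "'a \<Rightarrow> real" assume f: "f \<in> Ccr" "real_pd f"
    note fb = Ccr_bdd_borel[OF f(1)]
    \<comment> \<open>\<open>f\<close> is even, so \<open>D\<close>, its reflection \<open>R\<close>
      and hence the even part \<open>\<tau>\<close> give it the same integral.\<close>
    have "sint R f = sint D f"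
      unfolding R_def sint_reflect[OF D fb] using real_pd_even[OF f(2)] by simp
    moreover have "sint \<tau> f = (1/2) * sint D f + (1/2) * sint R f"
      by (rule sint_lincomb[OF fv[OF D] fv[OF R] fv[OF \<tau>] _ fb]) (simp add: \<tau>_def)
    moreover have "sint D f = 1 * sint \<rho> f + (-1) * sint \<sigma> f"
      by (rule sint_lincomb[OF fv[OF \<rho>] fv[OF \<sigma>(1)] fv[OF D] _ fb]) (simp add: D_def)
    \<comment> \<open>Here \<open>f\<close> plays both roles, that of \<open>h\<close> and that of
      its positive definite majorant; having compact support, it is also a function on which
      \<open>\<sigma>\<close> represents \<open>\<Lambda>\<close>.\<close>
    moreover have "sint \<sigma> f \<le> sint \<rho> f"
      unfolding \<sigma>(3)[OF f(1)] L_def by (rule \<Lambda>(3)[OF Ccr_continuous[OF f(1)] f(2)]) (simp add: app f)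
    ultimately show "0 \<le> sint \<tau> f" by simp
  qed
  moreover have "odd_measure \<omega>" by (simp add: odd_measure_def \<omega>_def R_def image_image)
  moreover have "\<rho> E = \<sigma> E + \<tau> E + \<omega> E" for E by (simp add: \<tau>_def \<omega>_def D_def)
  ultimately show ?thesis using \<sigma> \<tau> \<omega> by blast
qed

end

section \<open>Reduction to real functions and to one signed measure\<close>

theorem theorem1:
  fixes H :: "'a::{topological_ab_group_add, t2_space} measure"
    and \<mu> \<nu> :: "'a set \<Rightarrow> real" and C :: real
  assumes "locally_compact_space (euclidean :: 'a topology)"
    and "haar_measure H"
    and "bounded_regular_measure \<mu>"
    and "bounded_regular_measure \<nu>"
  shows "(\<forall>f :: 'a \<Rightarrow> complex. continuous_on UNIV f \<longrightarrow> doubly_positive f \<longrightarrow>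
            signed_integral \<nu> f \<le> of_real C * signed_integral \<mu> f)
     \<longleftrightarrow>
         (\<exists>\<sigma> \<tau> \<omega> :: 'a set \<Rightarrow> real.
            bounded_regular_measure \<sigma> \<and> nonnegative_measure \<sigma> \<and>
            bounded_regular_measure \<tau> \<and> positive_type H \<tau> \<and>
            bounded_regular_measure \<omega> \<and> odd_measure \<omega> \<and>
            (\<forall>E \<in> sets borel. C * \<mu> E - \<nu> E = \<sigma> E + \<tau> E + \<omega> E))"
proof -
  interpret haar H by (rule haar.intro[OF assms(2,1)])
  let ?\<rho> = "\<lambda>E. C * \<mu> E + (-1) * \<nu> E"
  have \<rho>: "bounded_regular_measure ?\<rho>" by (rule bounded_regular_measure_lincomb[OF assms(3,4)])
  have int: "signed_integral \<nu> (\<lambda>x. complex_of_real (f x)) \<le> of_real C * signed_integral \<mu> (\<lambda>x. complex_of_real (f x))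
    \<longleftrightarrow> 0 \<le> sint ?\<rho> f" if "continuous_on UNIV f" "real_pd f" for f
  proof -
    have "sint ?\<rho> f = C * sint \<mu> f + (-1) * sint \<nu> f"
      by (rule sint_lincomb[OF assms(3,4)[THEN bounded_regular_measureD] bounded_regular_measureD[OF \<rho>] refl
            real_pd_bdd_borel[OF that]])
    then show ?thesis by (simp add: signed_integral_of_real less_eq_complex_def)
  qed
  \<comment> \<open>A doubly positive function takes nonnegative real values, so nothing is lost in
    passing to its real part, and the order on complex numbers becomes the real one.\<close>
  have dp: "(\<forall>f :: 'a \<Rightarrow> complex. continuous_on UNIV f \<longrightarrow> doubly_positive f \<longrightarrow>
            signed_integral \<nu> f \<le> of_real C * signed_integral \<mu> f) \<longleftrightarrow>
    (\<forall>f. continuous_on UNIV f \<longrightarrow> real_pd f \<longrightarrow> (\<forall>x. 0 \<le> f x) \<longrightarrow> 0 \<le> sint ?\<rho> f)" (is "?A \<longleftrightarrow> ?B")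
  proof
    assume A: ?A
    show ?B
    proof (intro allI impI)
      fix f :: "'a \<Rightarrow> real" assume f: "continuous_on UNIV f" "real_pd f" "\<forall>x. 0 \<le> f x"
      have "doubly_positive (\<lambda>x. complex_of_real (f x))"
        unfolding doubly_positive_def positive_definite_of_real using f by (simp add: less_eq_complex_def)
      then show "0 \<le> sint ?\<rho> f"
        unfolding int[OF f(1,2), symmetric] using A f(1) by (simp add: continuous_on_of_real)
    qed
  next
    assume B: ?B
    show ?A
    proof (intro allI impI)
      fix f :: "'a \<Rightarrow> complex" assume f: "continuous_on UNIV f" "doubly_positive f"
      have nn: "0 \<le> f x" for x using f(2) unfolding doubly_positive_def by blast
      have eq: "f = (\<lambda>x. complex_of_real (Re (f x)))"
        using nn by (intro ext) (simp add: complex_eq_iff less_eq_complex_def)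
      have pd: "real_pd (\<lambda>x. Re (f x))"
        unfolding positive_definite_of_real[symmetric] eq[symmetric] using f(2) unfolding doubly_positive_def by blast
      have c: "continuous_on UNIV (\<lambda>x. Re (f x))" by (intro continuous_intros f)
      have "0 \<le> sint ?\<rho> (\<lambda>x. Re (f x))" using B c pd nn by (simp add: less_eq_complex_def)
      then show "signed_integral \<nu> f \<le> of_real C * signed_integral \<mu> f"
        unfolding int[OF c pd, symmetric] eq[symmetric] .
    qed
  qed
  have eq: "C * \<mu> E - \<nu> E = x \<longleftrightarrow> ?\<rho> E = x" for E x by simp
  show ?thesis unfolding dp eq
  proof (intro iffI; (elim exE conjE)?)
    assume "\<forall>f. continuous_on UNIV f \<longrightarrow> real_pd f \<longrightarrow> (\<forall>x. 0 \<le> f x) \<longrightarrow> 0 \<le> sint ?\<rho> f"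
    then have "0 \<le> sint ?\<rho> f" if "continuous_on UNIV f" "real_pd f" "\<And>x. 0 \<le> f x" for f using that by blast
    then show "\<exists>\<sigma> \<tau> \<omega> :: 'a set \<Rightarrow> real.
            bounded_regular_measure \<sigma> \<and> nonnegative_measure \<sigma> \<and>
            bounded_regular_measure \<tau> \<and> positive_type H \<tau> \<and>
            bounded_regular_measure \<omega> \<and> odd_measure \<omega> \<and>
            (\<forall>E \<in> sets borel. ?\<rho> E = \<sigma> E + \<tau> E + \<omega> E)" by (rule exists_decomposition[OF \<rho>])
  next
    fix \<sigma> \<tau> \<omega> :: "'a set \<Rightarrow> real"
    assume d: "bounded_regular_measure \<sigma>" "nonnegative_measure \<sigma>"
      "bounded_regular_measure \<tau>" "positive_type H \<tau>" "bounded_regular_measure \<omega>" "odd_measure \<omega>"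
      "\<forall>E \<in> sets borel. ?\<rho> E = \<sigma> E + \<tau> E + \<omega> E"
    show "\<forall>f. continuous_on UNIV f \<longrightarrow> real_pd f \<longrightarrow> (\<forall>x. 0 \<le> f x) \<longrightarrow> 0 \<le> sint ?\<rho> f"
      using doubly_positive_integral_nonneg[OF d(1-6) \<rho> bspec[OF d(7)]] by blast
  qed
qed

end
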